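(* Let $X$ and $Y$ be Polish spaces with non-atomic Borel probability measures $\mu$ and $\nu$ respectively, and let $T:X\to X$ and $S:Y\to Y$ be ergodic measure-preserving homeomorphisms of $(X,\mu)$ and $(Y,\nu)$. Then there are a $T$-invariant $G_\delta$ subset $X'\subset X$ and an $S$-invariant $G_\delta$ subset $Y'\subset Y$, each of full measure, and a homeomorphism $\varphi:X'\to Y'$ (for the subspace topologies) which maps $\mu|_{X'}$ to $\nu|_{Y'}$ and maps $T$-orbits onto $S$-orbits.
   Context: The $T$-orbit of $x$ is $\{T^n x:n\in\mathbb Z\}$, and similarly for $S$. "$\varphi$ maps $T$-orbits onto $S$-orbits" means $\varphi(\{T^n x:n\in\mathbb Z\})=\{S^n\varphi(x):n\in\mathbb Z\}$ for every $x\in X'$. "$\varphi$ maps $\mu|_{X'}$ to $\nu|_{Y'}$" means that the push-forward of $\mu|_{X'}$ under $\varphi$ is $\nu|_{Y'}$. Invariant means $T X'=X'$, $S Y'=Y'$. *)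

theory Defs
  imports "HOL-Probability.Probability_Measure"
begin

definition measure_atom :: "'a measure \<Rightarrow> 'a set \<Rightarrow> bool" where
  "measure_atom M A \<longleftrightarrow> A \<in> sets M \<and> emeasure M A > 0 \<and>
     (\<forall>B\<in>sets M. B \<subseteq> A \<longrightarrow> emeasure M B = 0 \<or> emeasure M B = emeasure M A)"

definition non_atomic :: "'a measure \<Rightarrow> bool" where
  "non_atomic M \<longleftrightarrow> (\<nexists>A. measure_atom M A)"

definition measure_preserving :: "'a measure \<Rightarrow> ('a \<Rightarrow> 'a) \<Rightarrow> bool" where
  "measure_preserving M T \<longleftrightarrow> T \<in> measurable M M \<and> distr M M T = M"

definition ergodic :: "'a measure \<Rightarrow> ('a \<Rightarrow> 'a) \<Rightarrow> bool" where
  "ergodic M T \<longleftrightarrow>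
     (\<forall>A\<in>sets M. T -` A \<inter> space M = A \<longrightarrow> A \<in> null_sets M \<or> space M - A \<in> null_sets M)"

(* Meaningful only for bijective T, since it uses "inv T" for negative exponents. *)
definition int_iterate :: "('a \<Rightarrow> 'a) \<Rightarrow> int \<Rightarrow> 'a \<Rightarrow> 'a" where
  "int_iterate T n = (if n \<ge> 0 then T ^^ nat n else inv T ^^ nat (- n))"

(* Two-sided, unlike "orbit" of HOL-Combinatorics, which uses positive iterates only. *)
definition int_orbit :: "('a \<Rightarrow> 'a) \<Rightarrow> 'a \<Rightarrow> 'a set" where
  "int_orbit T x = {int_iterate T n x | n. n \<in> (UNIV :: int set)}"

end

theory Submission
  imports Defs "HOL-Probability.Distribution_Functions" "HOL-Library.Nat_Bijection"
begin

text \<open>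
  This is Dye's theorem, that two ergodic probability preserving transformations without atoms
  have isomorphic orbit relations, in a form where the isomorphism is a homeomorphism between
  invariant \<open>G\<^sub>\<delta>\<close> sets of full measure.

  The idea is to describe both systems by the same codes. A \<^emph>\<open>division\<close> of a set into \<open>K\<close> parts of
  equal measure labels the parts by \<open>0, \<dots>, K - 1\<close> and moves every point, along its own orbit, to a
  point of part \<open>0\<close>, in such a way that each part is carried bijectively to part \<open>0\<close>. Dividing the
  whole space into \<open>N 1\<close> parts, then part \<open>0\<close> again, and so on, gives an increasing sequence of
  finite subrelations of the orbit relation and, for each point \<open>x\<close>, a sequence of numbers
  \<open>D n x < N n\<close>. At stage \<open>n\<close> every class of the subrelation has exactly one point for each
  number below \<open>N n\<close>, and within a class \<open>D m - D n\<close> does not change for \<open>m \<ge> n\<close>. Three things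
  have to be achieved.

  (1) The finite relations exhaust the orbit relation. \<open>capturing_step\<close> refines a division so that
  \<open>x\<close> and \<open>T x\<close> are in one class except on a set of small measure. It cuts the returns to part \<open>0\<close>
  into blocks of length \<open>K\<close> that start at a rare marker set (\<open>block_division\<close>). The few points
  outside complete blocks are divided arbitrarily.

  (2) The codes determine the point and the topology. \<open>separating_step\<close> refines a division so that
  most labels decide the membership in finitely many sets of a countable base.

  (3) The number of parts can be prescribed. Both steps work for every sufficiently large \<open>K\<close>, so one
  sequence \<open>N\<close> serves both systems. As the parts have equal measure, the distribution of the codes
  is then the same in both systems.

  Now \<open>x\<close> is matched with the point \<open>y\<close> of the other system that has the same code. By (2) this is a
  homeomorphism, by (3) it preserves measure and is defined almost everywhere, and by (1) it maps
  orbits onto orbits: if \<open>x'\<close> is in the orbit of \<open>x\<close>, then the two are in one class at some stage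
  \<open>n\<close>, and the point with number \<open>D n x'\<close> in the class of \<open>y\<close> has the code of \<open>x'\<close>.

  Two tools make the steps possible. Sets of equal measure are linked by a map along
  the orbits (\<open>Hopf_equivalence\<close>), and every set can be split into parts of equal measure that respect
  a finite partition up to a few parts (\<open>equal_parts\<close>).

  The topological part of the claim needs care, because a null set need not be contained in a null
  \<open>F\<^sub>\<sigma>\<close> set. All sets and maps in the construction are therefore locally constant near every
  point of a countable intersection of open sets of full measure. This property survives
  unbounded searches that succeed almost everywhere (\<open>nlc_Least\<close>, \<open>NE_of_AE_search\<close>), and this is
  what allows countably many pieces in the greedy constructions.
\<close>

section \<open>Nearly everywhere statements for an ergodic action of the integers\<close>

text \<open>The transformation enters through its iterates \<open>tt k\<close> only. A complete measure makes every set measurable that is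
  open up to a null set. Ergodicity is used in the form that almost every orbit meets a given set of
  positive measure.\<close>
locale ergodic_Z_action = prob_space M + complete_measure M
  for M :: "'a::polish_space measure" +
  fixes tt :: "int \<Rightarrow> 'a \<Rightarrow> 'a"
  assumes space_UNIV: "space M = UNIV"
    and borel_sub: "sets borel \<subseteq> sets M"
    and tt_0: "tt 0 x = x"
    and tt_add: "tt (j + k) x = tt j (tt k x)"
    and tt_cont: "continuous_on UNIV (tt k)"
    and tt_sets: "E \<in> sets M \<Longrightarrow> tt k -` E \<in> sets M"
    and tt_emeasure: "E \<in> sets M \<Longrightarrow> emeasure M (tt k -` E) = emeasure M E"
    and ergodicity: "E \<in> sets M \<Longrightarrow> emeasure M E > 0 \<Longrightarrow> AE x in M. \<exists>k. tt k x \<in> E"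
    and point_null: "emeasure M {x} = 0"
begin

lemma tt_inverse [simp]: "tt (- k) (tt k x) = x" "tt k (tt (- k) x) = x"
  using tt_add[of "- k" k x] tt_add[of k "- k" x] by (simp_all add: tt_0)

lemma tt_measure: "E \<in> sets M \<Longrightarrow> prob (tt k -` E) = prob E"
  by (simp add: measure_def tt_emeasure)

lemma open_sets: "open U \<Longrightarrow> U \<in> sets M"
  using borel_sub by auto

lemma closed_sets: "closed U \<Longrightarrow> U \<in> sets M"
  using borel_sub by auto

lemma AE_nullE:
  assumes "AE x in M. P x"
  obtains N where "N \<in> null_sets M" "{x. \<not> P x} \<subseteq> N"
  using AE_E3[OF assms] by (metis (mono_tags, lifting) Diff_iff UNIV_I mem_Collect_eq space_UNIV subsetI)

lemma AE_shift: "AE x in M. P x \<Longrightarrow> AE x in M. P (tt k x)"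
proof -
  assume "AE x in M. P x"
  then obtain N where N: "N \<in> null_sets M" "{x. \<not> P x} \<subseteq> N"
    by (rule AE_nullE)
  have "tt k -` N \<in> null_sets M" using N(1) tt_sets tt_emeasure by (auto simp: null_sets_def)
  then show ?thesis by (rule AE_I') (use N(2) in auto)
qed

lemma open_tt_vimage: "open U \<Longrightarrow> open (tt k -` U)"
  using tt_cont[of k] by (simp add: continuous_on_open_vimage)

lemma tt_tendsto: "filterlim (tt k) (nhds (tt k x)) (nhds x)"
  using tt_cont[of k] by (simp add: continuous_on_eq_continuous_at isCont_def tendsto_at_iff_tendsto_nhds)


text \<open>The filter of \<open>nearly everywhere\<close> true properties: those that hold on a countable intersection of
  open sets of full measure. They hold almost everywhere, but the converse fails in general.\<close>
definition NE :: "'a filter" where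
  "NE = Abs_filter (\<lambda>P. \<exists>\<U>. countable \<U> \<and> (\<forall>U\<in>\<U>. open U \<and> (AE x in M. x \<in> U)) \<and>
     (\<forall>x. (\<forall>U\<in>\<U>. x \<in> U) \<longrightarrow> P x))"

lemma eventually_NE: "eventually P NE \<longleftrightarrow>
  (\<exists>\<U>. countable \<U> \<and> (\<forall>U\<in>\<U>. open U \<and> (AE x in M. x \<in> U)) \<and> (\<forall>x. (\<forall>U\<in>\<U>. x \<in> U) \<longrightarrow> P x))"
  unfolding NE_def
proof (rule eventually_Abs_filter, rule is_filter.intro, goal_cases)
  case 1
  show ?case by (rule exI[of _ "{}"]) auto
next
  case (2 P Q)
  then obtain \<U> \<V> where "countable \<U>" "\<forall>U\<in>\<U>. open U \<and> (AE x in M. x \<in> U)" "\<forall>x. (\<forall>U\<in>\<U>. x \<in> U) \<longrightarrow> P x"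
    "countable \<V>" "\<forall>U\<in>\<V>. open U \<and> (AE x in M. x \<in> U)" "\<forall>x. (\<forall>U\<in>\<V>. x \<in> U) \<longrightarrow> Q x" by metis
  then show ?case by (intro exI[of _ "\<U> \<union> \<V>"]) auto
next
  case (3 P Q)
  then show ?case by metis
qed

lemma NE_open: "open U \<Longrightarrow> AE x in M. x \<in> U \<Longrightarrow> eventually (\<lambda>x. x \<in> U) NE"
  unfolding eventually_NE by (rule exI[of _ "{U}"]) auto

lemma NE_AE: "eventually P NE \<Longrightarrow> AE x in M. P x"
proof -
  assume "eventually P NE"
  then obtain \<U> where U: "countable \<U>" "\<forall>U\<in>\<U>. open U \<and> (AE x in M. x \<in> U)"
    "\<forall>x. (\<forall>U\<in>\<U>. x \<in> U) \<longrightarrow> P x" unfolding eventually_NE by auto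
  then have "AE x in M. \<forall>U\<in>\<U>. x \<in> U" by (simp add: AE_ball_countable)
  then show ?thesis using U(3) by (auto elim: eventually_mono)
qed

lemma NE_all_countable:
  fixes P :: "'i::countable \<Rightarrow> 'a \<Rightarrow> bool"
  assumes "\<And>i. eventually (P i) NE"
  shows "eventually (\<lambda>x. \<forall>i. P i x) NE"
proof -
  have "\<forall>i. \<exists>\<U>. countable \<U> \<and> (\<forall>U\<in>\<U>. open U \<and> (AE x in M. x \<in> U)) \<and> (\<forall>x. (\<forall>U\<in>\<U>. x \<in> U) \<longrightarrow> P i x)"
    using assms unfolding eventually_NE by auto
  then obtain \<U> where "\<And>i. countable (\<U> i)" "\<And>i. \<forall>U\<in>\<U> i. open U \<and> (AE x in M. x \<in> U)"
    "\<And>i x. (\<forall>U\<in>\<U> i. x \<in> U) \<Longrightarrow> P i x" by metis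
  then show ?thesis unfolding eventually_NE by (intro exI[of _ "\<Union>i. \<U> i"]) auto
qed

lemma NE_orbit:
  assumes "eventually P NE"
  shows "eventually (\<lambda>x. \<forall>k. P (tt k x)) NE"
proof (rule NE_all_countable)
  fix k
  obtain \<U> where U: "countable \<U>" "\<forall>U\<in>\<U>. open U \<and> (AE x in M. x \<in> U)"
    "\<forall>x. (\<forall>U\<in>\<U>. x \<in> U) \<longrightarrow> P x" using assms unfolding eventually_NE by auto
  have "\<forall>U\<in>(\<lambda>U. tt k -` U) ` \<U>. open U \<and> (AE x in M. x \<in> U)"
    using U(2) open_tt_vimage AE_shift[where k = k] by auto
  with U show "eventually (\<lambda>x. P (tt k x)) NE" unfolding eventually_NE
    by (intro exI[of _ "(\<lambda>U. tt k -` U) ` \<U>"]) auto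
qed

lemma NE_shift: "eventually P NE \<Longrightarrow> eventually (\<lambda>x. P (tt k x)) NE"
  by (drule NE_orbit) (auto elim!: eventually_mono)

text \<open>The preimages under all iterates of the sets that witness \<open>P\<close> give an invariant witness.\<close>
lemma NE_gdelta_invariant:
  assumes "eventually P NE"
  obtains \<U> where "countable \<U>" "\<And>U. U \<in> \<U> \<Longrightarrow> open U" "AE x in M. x \<in> \<Inter>\<U>"
    "\<And>x. x \<in> \<Inter>\<U> \<Longrightarrow> P x" "\<And>x k. x \<in> \<Inter>\<U> \<Longrightarrow> tt k x \<in> \<Inter>\<U>"
proof -
  obtain \<U> where U: "countable \<U>" "\<forall>U\<in>\<U>. open U \<and> (AE x in M. x \<in> U)"
    "\<forall>x. (\<forall>U\<in>\<U>. x \<in> U) \<longrightarrow> P x" using assms unfolding eventually_NE by auto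
  let ?V = "(\<lambda>(k, U). tt k -` U) ` ((UNIV :: int set) \<times> \<U>)"
  show thesis
  proof
    show c: "countable ?V" using U(1) by auto
    show "open U" if "U \<in> ?V" for U using that U(2) open_tt_vimage by auto
    have *: "x \<in> \<Inter>?V \<longleftrightarrow> (\<forall>U\<in>\<U>. \<forall>k. tt k x \<in> U)" for x by auto
    have "AE x in M. \<forall>V\<in>?V. x \<in> V"
      unfolding AE_ball_countable[OF c] using U(2) AE_shift by auto
    then show "AE x in M. x \<in> \<Inter>?V" by simp
    show "P x" if "x \<in> \<Inter>?V" for x using that U(3) tt_0 unfolding * by metis
    show "tt k x \<in> \<Inter>?V" if "x \<in> \<Inter>?V" for x k using that unfolding * tt_add[symmetric] by auto
  qed
qed


text \<open>Nearly locally constant functions. A predicate is of this kind if and only if it defines a set with a null boundary.\<close>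
definition nlc :: "('a \<Rightarrow> 'c) \<Rightarrow> bool" where
  "nlc f \<longleftrightarrow> eventually (\<lambda>x. eventually (\<lambda>y. f y = f x) (nhds x)) NE"

lemma nlc_const [simp, intro]: "nlc (\<lambda>x. c)"
  by (simp add: nlc_def)

lemma nlc_comp: "nlc f \<Longrightarrow> nlc (\<lambda>x. h (f x))"
  unfolding nlc_def by (auto elim!: eventually_mono)

lemma nlc_comp2:
  assumes "nlc f" "nlc g"
  shows "nlc (\<lambda>x. h (f x) (g x))"
  using assms unfolding nlc_def
proof eventually_elim
  case (elim x)
  then show ?case by eventually_elim simp
qed

lemmas nlc_conj = nlc_comp2[where h = "(\<and>)"]
  and nlc_disj = nlc_comp2[where h = "(\<or>)"]
  and nlc_imp = nlc_comp2[where h = "(\<longrightarrow>)"]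
  and nlc_eq = nlc_comp2[where h = "(=)"]
  and nlc_plus = nlc_comp2[where h = "(+)"]
  and nlc_not = nlc_comp[where h = Not]

lemma nlc_select:
  fixes e :: "'a \<Rightarrow> 'i::countable"
  assumes "nlc e" "\<And>i. nlc (f i)"
  shows "nlc (\<lambda>x. f (e x) x)"
proof -
  have "eventually (\<lambda>x. \<forall>i. eventually (\<lambda>y. f i y = f i x) (nhds x)) NE"
    using assms(2) unfolding nlc_def by (rule NE_all_countable)
  with assms(1) show ?thesis unfolding nlc_def
  proof (eventually_elim, goal_cases)
    case (1 x)
    from 1(1) 1(2)[rule_format, of "e x"] show ?case by eventually_elim auto
  qed
qed

lemma nlc_if: "nlc b \<Longrightarrow> nlc f \<Longrightarrow> nlc g \<Longrightarrow> nlc (\<lambda>x. if b x then f x else g x)"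
  using nlc_select[of b "\<lambda>i. if i then f else g"] by (simp add: if_distrib[where f = "\<lambda>f. f _"] cong: if_cong)

lemma nlc_shift: "nlc f \<Longrightarrow> nlc (\<lambda>x. f (tt k x))"
  unfolding nlc_def
  by (drule NE_shift[of _ k]) (auto elim!: eventually_mono intro: eventually_compose_filterlim[OF _ tt_tendsto])

lemma nlc_all_less: "(\<And>i. i < n \<Longrightarrow> nlc (R i)) \<Longrightarrow> nlc (\<lambda>x. \<forall>i<(n::nat). R i x)"
proof (induction n)
  case (Suc n)
  have "nlc (\<lambda>x. (\<forall>i<n. R i x) \<and> R n x)" using Suc by (intro nlc_conj) auto
  then show ?case by (simp add: All_less_Suc conj_commute)
qed simp

lemma nlc_ex_less: "(\<And>i. i < n \<Longrightarrow> nlc (R i)) \<Longrightarrow> nlc (\<lambda>x. \<exists>i<(n::nat). R i x)"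
  using nlc_not[OF nlc_all_less[of n "\<lambda>i x. \<not> R i x"]] nlc_not by simp

lemma nlc_sum: "finite I \<Longrightarrow> (\<And>i. i \<in> I \<Longrightarrow> nlc (f i)) \<Longrightarrow> nlc (\<lambda>x. \<Sum>i\<in>I. (f i x :: 'c::comm_monoid_add))"
  by (induction I rule: finite_induct) (auto intro: nlc_plus)

lemma nlc_list_map: "(\<And>i. i \<in> set xs \<Longrightarrow> nlc (f i)) \<Longrightarrow> nlc (\<lambda>x. map (\<lambda>i. f i x) xs)"
  by (induction xs) (auto intro: nlc_comp2[where h = "(#)"])

text \<open>The result of an unbounded search is decided by the finitely many tests up to the first
  success, and these are constant near most points.\<close>
lemma nlc_Least:
  fixes R :: "nat \<Rightarrow> 'a \<Rightarrow> bool"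
  assumes R: "\<And>n. nlc (R n)" and ex: "eventually (\<lambda>x. \<exists>n. R n x) NE"
  shows "nlc (\<lambda>x. LEAST n. R n x)"
proof -
  have "eventually (\<lambda>x. \<forall>n. eventually (\<lambda>y. R n y = R n x) (nhds x)) NE"
    using R unfolding nlc_def by (rule NE_all_countable)
  with ex show ?thesis unfolding nlc_def
  proof (eventually_elim, goal_cases)
    case (1 x)
    let ?n = "LEAST n. R n x"
    have "eventually (\<lambda>y. \<forall>n\<in>{..?n}. R n y = R n x) (nhds x)"
      using 1(2) by (intro eventually_ball_finite) auto
    then show ?case
    proof eventually_elim
      case (elim y)
      have n: "R ?n x" using 1(1) by (auto intro: LeastI_ex)
      show "(LEAST n. R n y) = ?n"
      proof (rule Least_equality)
        show "R ?n y" using elim n by auto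
        fix m assume "R m y"
        show "?n \<le> m"
        proof (rule ccontr)
          assume "\<not> ?n \<le> m"
          then show False using elim \<open>R m y\<close> not_less_Least[of m "\<lambda>n. R n x"] by auto
        qed
      qed
    qed
  qed
qed

text \<open>The points near which \<open>P\<close> holds form an open set.\<close>
lemma NE_of_AE_open_points:
  assumes "AE x in M. eventually P (nhds x)"
  shows "eventually P NE"
proof -
  have "open {x. eventually P (nhds x)}"
    unfolding open_subopen[of "{x. eventually P (nhds x)}"]
    by (auto simp: eventually_nhds)
  from NE_open[OF this] assms have "eventually (\<lambda>x. eventually P (nhds x)) NE" by simp
  then show ?thesis by (rule eventually_mono) (auto dest: eventually_nhds_x_imp_x)
qed

text \<open>This is how a null set of exceptions is improved to a set that misses a \<open>G\<^sub>\<delta>\<close> set of full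
  measure: where a nearly locally constant test succeeds, it succeeds on a neighbourhood.\<close>
lemma NE_of_AE_search:
  fixes R :: "nat \<Rightarrow> 'a \<Rightarrow> bool"
  assumes "\<And>n. nlc (R n)" "AE x in M. \<exists>n. R n x"
  shows "eventually (\<lambda>x. \<exists>n. R n x) NE"
proof (rule NE_of_AE_open_points)
  have "AE x in M. \<forall>n. eventually (\<lambda>y. R n y = R n x) (nhds x)"
    using assms(1) unfolding nlc_def AE_all_countable by (auto intro: NE_AE)
  with assms(2) show "AE x in M. eventually (\<lambda>x. \<exists>n. R n x) (nhds x)"
  proof (eventually_elim, goal_cases)
    case (1 x)
    then obtain n where "R n x" by auto
    with 1(2) have "eventually (R n) (nhds x)" by (auto elim!: allE[of _ n] eventually_mono)
    then show ?case by eventually_elim auto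
  qed
qed

abbreviation pr :: "('a \<Rightarrow> bool) \<Rightarrow> real" where
  "pr A \<equiv> prob {x. A x}"

text \<open>The set differs from its interior by a subset of a null set.\<close>
lemma nlc_sets [intro]:
  assumes "nlc A"
  shows "{x. A x} \<in> sets M"
proof -
  let ?U = "interior {x. A x}"
  have U: "?U \<in> sets M" by (simp add: open_sets)
  have "AE x in M. eventually (\<lambda>y. A y = A x) (nhds x)"
    using assms unfolding nlc_def by (rule NE_AE)
  then obtain N where N: "N \<in> null_sets M" "{x. \<not> eventually (\<lambda>y. A y = A x) (nhds x)} \<subseteq> N"
    by (rule AE_nullE)
  have "{x. A x} - ?U \<subseteq> N"
  proof
    fix x assume x: "x \<in> {x. A x} - ?U"
    then have "\<not> eventually A (nhds x)" by (auto simp: interior_def eventually_nhds)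
    with x have "\<not> eventually (\<lambda>y. A y = A x) (nhds x)" by auto
    with N show "x \<in> N" by auto
  qed
  then have "{x. A x} - ?U \<in> sets M" using N(1) complete by blast
  then have "({x. A x} - ?U) \<union> ?U \<in> sets M" using U by blast
  also have "({x. A x} - ?U) \<union> ?U = {x. A x}" using interior_subset[of "{x. A x}"] by auto
  finally show ?thesis .
qed

lemma NE_sets:
  assumes "eventually P NE"
  shows "{x. P x} \<in> sets M"
proof -
  from NE_AE[OF assms] obtain N where N: "N \<in> null_sets M" "{x. \<not> P x} \<subseteq> N"
    by (rule AE_nullE)
  then have "{x. \<not> P x} \<in> sets M" using complete by blast
  then have "space M - {x. \<not> P x} \<in> sets M" by blast
  then show ?thesis by (simp add: space_UNIV Diff_eq Compl_eq)
qed

lemma pr_mono: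
  assumes "nlc B" "eventually (\<lambda>x. A x \<longrightarrow> B x) NE"
  shows "pr A \<le> pr B"
  by (rule finite_measure_mono_AE) (use NE_AE[OF assms(2)] assms(1) in auto)

lemma pr_cong:
  assumes "nlc A" "nlc B" "eventually (\<lambda>x. A x \<longleftrightarrow> B x) NE"
  shows "pr A = pr B"
  by (intro antisym pr_mono) (use assms in \<open>auto elim!: eventually_mono\<close>)

lemma pr_shift: "nlc A \<Longrightarrow> pr (\<lambda>x. A (tt k x)) = pr A"
  using tt_measure[of "{x. A x}" k] by (auto simp: vimage_def)

lemma pr_disj: "nlc A \<Longrightarrow> nlc B \<Longrightarrow> pr (\<lambda>x. A x \<or> B x) \<le> pr A + pr B"
  using measure_Un_le[of "{x. A x}" M "{x. B x}"] by (auto simp: Un_def)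

lemma pr_disj_disjoint:
  "nlc A \<Longrightarrow> nlc B \<Longrightarrow> (\<And>x. \<not> (A x \<and> B x)) \<Longrightarrow> pr (\<lambda>x. A x \<or> B x) = pr A + pr B"
  using finite_measure_Union[of "{x. A x}" "{x. B x}"] by (auto simp: Un_def)

lemma pr_split: "nlc A \<Longrightarrow> nlc B \<Longrightarrow> pr A = pr (\<lambda>x. A x \<and> B x) + pr (\<lambda>x. A x \<and> \<not> B x)"
  by (subst pr_disj_disjoint[symmetric]) (auto intro: nlc_conj nlc_not intro!: arg_cong[where f = prob])

section \<open>Maps along orbits and Hopf equivalence\<close>


text \<open>A map that moves points along their orbits is given by the time \<open>f x\<close> that it moves \<open>x\<close>.
  Working with times instead of points makes periodic orbits harmless.\<close>
definition act :: "('a \<Rightarrow> int) \<Rightarrow> 'a \<Rightarrow> 'a" where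
  "act f x = tt (f x) x"

definition kcomp :: "('a \<Rightarrow> int) \<Rightarrow> ('a \<Rightarrow> int) \<Rightarrow> 'a \<Rightarrow> int" where
  "kcomp g f x = g (act f x) + f x"

lemma act_kcomp: "act (kcomp g f) x = act g (act f x)"
  by (simp add: act_def kcomp_def tt_add)

lemma nlc_act: "nlc g \<Longrightarrow> nlc f \<Longrightarrow> nlc (\<lambda>x. g (act f x))"
  unfolding act_def by (rule nlc_select[where f = "\<lambda>i x. g (tt i x)"]) (auto intro: nlc_shift)

lemma nlc_kcomp: "nlc g \<Longrightarrow> nlc f \<Longrightarrow> nlc (kcomp g f)"
  unfolding kcomp_def by (intro nlc_plus nlc_act)

lemma ex_countable_sets:
  fixes P :: "'i::countable \<Rightarrow> 'a \<Rightarrow> bool"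
  assumes "\<And>i. {x. P i x} \<in> sets M"
  shows "{x. \<exists>i. P i x} \<in> sets M"
proof -
  have "{x. \<exists>i. P i x} = (\<Union>i. {x. P i x})" by auto
  then show ?thesis using assms by simp
qed

lemma all_countable_sets:
  fixes P :: "'i::countable \<Rightarrow> 'a \<Rightarrow> bool"
  assumes "\<And>i. {x. P i x} \<in> sets M"
  shows "{x. \<forall>i. P i x} \<in> sets M"
proof -
  have "{x. \<forall>i. P i x} = (\<Inter>i. {x. P i x})" by auto
  then show ?thesis using assms by simp
qed

lemma and_sets: "{x. P x} \<in> sets M \<Longrightarrow> {x. Q x} \<in> sets M \<Longrightarrow> {x. P x \<and> Q x} \<in> sets M"
  using sets.Int[of "{x. P x}" M "{x. Q x}"] by (simp add: Int_def)

text \<open>Injectivity and surjectivity of such a map on \<open>A\<close>, expressed by the times: the point \<open>tt k x\<close> has the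
  same image as \<open>x\<close> if its time is \<open>f x - k\<close>.\<close>
abbreviation injects :: "('a \<Rightarrow> bool) \<Rightarrow> ('a \<Rightarrow> int) \<Rightarrow> bool" where
  "injects A f \<equiv> eventually (\<lambda>x. A x \<longrightarrow> (\<forall>k. A (tt k x) \<and> f (tt k x) + k = f x \<longrightarrow> k = 0)) NE"

abbreviation reaches :: "('a \<Rightarrow> bool) \<Rightarrow> ('a \<Rightarrow> int) \<Rightarrow> ('a \<Rightarrow> bool) \<Rightarrow> bool" where
  "reaches A f E \<equiv> eventually (\<lambda>z. E z \<longrightarrow> (\<exists>k. A (tt k z) \<and> f (tt k z) = - k)) NE"

text \<open>On the set where \<open>f\<close> has the value \<open>k\<close>, the map is the measure preserving \<open>tt k\<close>, and the images of these
  sets are disjoint by injectivity.\<close>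
lemma pr_act:
  assumes A: "nlc A" and f: "nlc f" and E: "nlc E"
    and inj: "injects A f"
  shows "pr (\<lambda>x. A x \<and> E (act f x)) = pr (\<lambda>z. E z \<and> (\<exists>k. A (tt k z) \<and> f (tt k z) = - k))"
proof -
  let ?G = "\<lambda>x. A x \<longrightarrow> (\<forall>k. A (tt k x) \<and> f (tt k x) + k = f x \<longrightarrow> k = 0)"
  let ?S = "\<lambda>k. {x. ?G x \<and> (A x \<and> f x = k \<and> E (tt k x))}"
  let ?W = "\<lambda>k. tt (- k) -` ?S k"
  have S: "?S k \<in> sets M" for k
    by (rule and_sets[OF NE_sets[OF inj] nlc_sets[OF nlc_conj[OF A nlc_conj[OF nlc_eq[OF f nlc_const] nlc_shift[OF E]]]]])
  have W: "?W k \<in> sets M" for k by (rule tt_sets[OF S])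
  have "emeasure M (\<Union>k. ?S k) = (\<integral>\<^sup>+k. emeasure M (?S k) \<partial>count_space UNIV)"
    using S by (intro emeasure_UN_countable) (auto simp: disjoint_family_on_def)
  also have "\<dots> = (\<integral>\<^sup>+k. emeasure M (?W k) \<partial>count_space UNIV)"
    by (intro nn_integral_cong tt_emeasure[symmetric] S)
  also have "\<dots> = emeasure M (\<Union>k. ?W k)"
  proof (intro emeasure_UN_countable[symmetric])
    show "disjoint_family ?W"
      unfolding disjoint_family_on_def
    proof (intro ballI impI, rule ccontr)
      fix k l :: int assume kl: "k \<noteq> l" and "?W k \<inter> ?W l \<noteq> {}"
      then obtain z where z: "z \<in> ?W k" "z \<in> ?W l" by auto
      have "tt (k - l) (tt (- k) z) = tt (- l) z" by (simp add: tt_add[symmetric])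
      with z have "A (tt (k - l) (tt (- k) z))" "f (tt (k - l) (tt (- k) z)) + (k - l) = f (tt (- k) z)" by auto
      with z(1) have "k - l = 0" by blast
      then show False using kl by simp
    qed
  qed (use W in auto)
  finally have eq: "measure M (\<Union>k. ?S k) = measure M (\<Union>k. ?W k)" by (simp add: measure_def)
  have "pr (\<lambda>x. A x \<and> E (act f x)) = measure M (\<Union>k. ?S k)"
  proof (rule finite_measure_eq_AE)
    show "AE x in M. x \<in> {x. A x \<and> E (act f x)} \<longleftrightarrow> x \<in> (\<Union>k. ?S k)"
      using NE_AE[OF inj] by eventually_elim (auto simp: act_def)
    show "{x. A x \<and> E (act f x)} \<in> sets M" by (intro nlc_sets nlc_conj nlc_act A E f)
  qed (use S in auto)
  also have "\<dots> = pr (\<lambda>z. E z \<and> (\<exists>k. A (tt k z) \<and> f (tt k z) = - k))"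
    unfolding eq
  proof (rule finite_measure_eq_AE)
    show "AE x in M. x \<in> (\<Union>k. ?W k) \<longleftrightarrow> x \<in> {z. E z \<and> (\<exists>k. A (tt k z) \<and> f (tt k z) = - k)}"
      using NE_AE[OF NE_orbit[OF inj]]
    proof eventually_elim
      case (elim z)
      have "z \<in> (\<Union>k. ?W k) \<longleftrightarrow> (\<exists>k. A (tt (-k) z) \<and> f (tt (-k) z) = k \<and> E z)"
        using elim by (auto simp: tt_add[symmetric] tt_0)
      also have "\<dots> \<longleftrightarrow> (\<exists>k. A (tt k z) \<and> f (tt k z) = - k \<and> E z)"
        by (metis minus_minus)
      finally show ?case by auto
    qed
    show "{z. E z \<and> (\<exists>k. A (tt k z) \<and> f (tt k z) = - k)} \<in> sets M"
      by (rule and_sets[OF nlc_sets[OF E] ex_countable_sets[OF nlc_sets[OF nlc_conj[OF nlc_shift[OF A] nlc_eq[OF nlc_shift[OF f] nlc_const]]]]])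
  qed (use W in auto)
  finally show ?thesis .
qed

lemma pr_act_le:
  assumes "nlc A" "nlc f" "nlc E"
    and "injects A f"
  shows "pr (\<lambda>x. A x \<and> E (act f x)) \<le> pr E"
  unfolding pr_act[OF assms] by (rule pr_mono) (use assms in auto)

lemma pr_act_eq:
  assumes "nlc A" "nlc f" "nlc E"
    and "injects A f"
    and "reaches A f E"
  shows "pr (\<lambda>x. A x \<and> E (act f x)) = pr E"
  unfolding pr_act[OF assms(1-4)]
proof (rule finite_measure_eq_AE)
  show "{z. E z \<and> (\<exists>k. A (tt k z) \<and> f (tt k z) = - k)} \<in> sets M"
    by (rule and_sets[OF nlc_sets[OF assms(3)] ex_countable_sets[OF nlc_sets[OF nlc_conj[OF nlc_shift[OF assms(1)] nlc_eq[OF nlc_shift[OF assms(2)] nlc_const]]]]])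
qed (use NE_AE[OF assms(5)] assms in auto)

text \<open>Poincare recurrence in the direction \<open>s\<close>. The sets of points with a visit at time at least
  \<open>m\<close> are shifts of each other, hence of equal measure, so their intersection has the measure of the first.
  It is invariant, and ergodicity makes it of full measure.\<close>
lemma recurrence_direction:
  assumes A: "nlc A" "pr A > 0" and s: "s = 1 \<or> s = - 1"
  shows "eventually (\<lambda>x. \<forall>m. \<exists>k\<ge>m. A (tt (s * int k) x)) NE"
proof (rule NE_all_countable)
  fix m :: nat
  define V where "V m = {x. \<exists>k\<ge>m. A (tt (s * int k) x)}" for m
  have V: "V m \<in> sets M" for m
    unfolding V_def by (rule ex_countable_sets[OF nlc_sets[OF nlc_conj[OF nlc_const nlc_shift[OF A(1)]]]])
  have "V (Suc m) = tt s -` V m" for m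
  proof -
    have "(\<exists>k\<ge>Suc m. A (tt (s * int k) x)) \<longleftrightarrow> (\<exists>k\<ge>m. A (tt (s * int k) (tt s x)))" for x
      unfolding tt_add[symmetric]
    proof
      assume "\<exists>k\<ge>Suc m. A (tt (s * int k) x)"
      then obtain k where "Suc m \<le> k" "A (tt (s * int k) x)" by auto
      then show "\<exists>k\<ge>m. A (tt (s * int k + s) x)"
        by (intro exI[of _ "k - 1"]) (auto simp: of_nat_diff algebra_simps)
    next
      assume "\<exists>k\<ge>m. A (tt (s * int k + s) x)"
      then obtain k where "m \<le> k" "A (tt (s * int k + s) x)" by auto
      then show "\<exists>k\<ge>Suc m. A (tt (s * int k) x)"
        by (intro exI[of _ "Suc k"]) (auto simp: algebra_simps)
    qed
    then show ?thesis by (auto simp: V_def)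
  qed
  then have "prob (V (Suc m)) = prob (V m)" for m using tt_measure[OF V] by simp
  then have const: "prob (V m) = prob (V 0)" for m by (induction m) simp_all
  have "(\<lambda>m. prob (V m)) = (\<lambda>m. prob (V 0))" using const by (intro ext)
  moreover have "decseq V"
    unfolding decseq_def V_def by (intro allI impI Collect_mono) (meson le_trans)
  then have "(\<lambda>m. prob (V m)) \<longlonglongrightarrow> prob (\<Inter>m. V m)"
    using V by (intro finite_Lim_measure_decseq) auto
  ultimately have eq: "prob (\<Inter>m. V m) = prob (V 0)" by (simp add: LIMSEQ_const_iff)
  have "{x. A x} \<subseteq> V 0" by (auto simp: V_def tt_0 intro!: exI[of _ 0])
  then have "pr A \<le> prob (V 0)" using V by (intro finite_measure_mono) auto
  then have "prob (\<Inter>m. V m) > 0" using A eq by simp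
  then have "AE x in M. \<exists>k. tt k x \<in> (\<Inter>m. V m)"
    using V by (intro ergodicity) (auto simp: emeasure_eq_measure)
  then have "AE x in M. \<exists>k\<ge>m. A (tt (s * int k) x)"
  proof eventually_elim
    case (elim x)
    then obtain k where k: "\<And>m. tt k x \<in> V m" by auto
    have ss: "s * s = 1" using s by auto
    obtain l where l: "l \<ge> m + nat \<bar>k\<bar>" "A (tt (s * int l) (tt k x))"
      using k[of "m + nat \<bar>k\<bar>"] unfolding V_def by auto
    have "\<bar>s * k\<bar> = \<bar>k\<bar>" using s by auto
    then have ge: "int l + s * k \<ge> int m" using l(1) by linarith
    have "s * int (nat (int l + s * k)) = s * int l + (s * s) * k"
      using ge by (simp add: algebra_simps)
    then have "A (tt (s * int (nat (int l + s * k))) x)" using l(2) ss by (simp add: tt_add)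
    then show ?case using ge by (intro exI[of _ "nat (int l + s * k)"]) auto
  qed
  then show "eventually (\<lambda>x. \<exists>k\<ge>m. A (tt (s * int k) x)) NE"
    by (rule NE_of_AE_search[rotated]) (rule nlc_conj[OF nlc_const nlc_shift[OF A(1)]])
qed

text \<open>The integers are tried one after another, in the order given by \<open>int_decode\<close>. At step \<open>n\<close>, all points of \<open>A\<close>
  are used that have not been used before and that \<open>int_decode n\<close> moves into a part of \<open>B\<close> which has not been
  hit before.\<close>
fun greedy :: "('a \<Rightarrow> bool) \<Rightarrow> ('a \<Rightarrow> bool) \<Rightarrow> nat \<Rightarrow> 'a \<Rightarrow> bool" where
  "greedy A B n x \<longleftrightarrow> A x \<and> B (tt (int_decode n) x) \<and>
     (\<forall>m\<in>{..<n}. \<not> greedy A B m x \<and> \<not> greedy A B m (tt (int_decode n - int_decode m) x))"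

declare greedy.simps [simp del]

lemma nlc_greedy: "nlc A \<Longrightarrow> nlc B \<Longrightarrow> nlc (greedy A B n)"
proof (induction n rule: less_induct)
  case (less n)
  have "nlc (\<lambda>x. A x \<and> B (tt (int_decode n) x) \<and>
     (\<forall>m<n. \<not> greedy A B m x \<and> \<not> greedy A B m (tt (int_decode n - int_decode m) x)))"
    by (intro nlc_conj nlc_all_less nlc_not nlc_shift less)
  moreover have "greedy A B n = (\<lambda>x. A x \<and> B (tt (int_decode n) x) \<and>
     (\<forall>m<n. \<not> greedy A B m x \<and> \<not> greedy A B m (tt (int_decode n - int_decode m) x)))"
    by (rule ext, subst greedy.simps) auto
  ultimately show ?case by simp
qed

text \<open>What the greedy construction leaves of \<open>A\<close> and of \<open>B\<close> has equal measure, and no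
  iterate maps a point of the one remainder to the other, as it would have been used. By
  ergodicity, both remainders are null.\<close>
lemma Hopf_equivalence:
  assumes A: "nlc A" and B: "nlc B" and eq: "pr A = pr B"
  obtains f where "nlc f"
    "eventually (\<lambda>x. A x \<longrightarrow> B (act f x)) NE"
    "injects A f"
    "reaches A f B"
proof -
  define H where "H = greedy A B"
  have H: "nlc (H n)" for n unfolding H_def by (rule nlc_greedy[OF A B])
  have H_iff: "H n x \<longleftrightarrow> A x \<and> B (tt (int_decode n) x) \<and>
     (\<forall>m<n. \<not> H m x \<and> \<not> H m (tt (int_decode n - int_decode m) x))" for n x
    unfolding H_def by (subst greedy.simps) auto
  have H_A: "A x" and H_B: "B (tt (int_decode n) x)" if "H n x" for n x
    using that by (simp_all add: H_iff[of n x])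
  have H_unique: "m = n" if "H m x" "H n x" for m n x
    using that H_iff[of m x] H_iff[of n x] by (cases m n rule: linorder_cases) auto
  have H_unique': "m = n" if "H m x" "H n (tt k x)" "int_decode n + k = int_decode m" for m n x k
  proof (cases m n rule: linorder_cases)
    case less
    have "tt (int_decode n - int_decode m) (tt k x) = x"
    proof -
      have "int_decode n - int_decode m + k = 0" using that(3) by simp
      then show ?thesis by (simp add: tt_add[symmetric] tt_0)
    qed
    then show ?thesis using less that H_iff[of n "tt k x"] by auto
  next
    case greater
    have "int_decode m - int_decode n = k" using that(3) by simp
    moreover have "\<not> H n (tt (int_decode m - int_decode n) x)" using H_iff[of m x] that(1) greater by blast
    ultimately show ?thesis using that(2) by simp
  qed
  let ?I = "\<lambda>n z. H n (tt (- int_decode n) z)"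
  \<comment> \<open>the parts of A and B that the construction never uses\<close>
  let ?RA = "{x. A x \<and> (\<forall>n. \<not> H n x)}"
  let ?RB = "{z. B z \<and> (\<forall>n. \<not> ?I n z)}"
  have sRA: "?RA \<in> sets M" and sRB: "?RB \<in> sets M"
    by (rule and_sets[OF nlc_sets[OF A] all_countable_sets[OF nlc_sets[OF nlc_not[OF H]]]]
      and_sets[OF nlc_sets[OF B] all_countable_sets[OF nlc_sets[OF nlc_not[OF nlc_shift[OF H]]]]])+
  have HI: "nlc (?I n)" for n by (intro nlc_shift H)
  have "(\<lambda>n. pr (H n)) sums prob (\<Union>n. {x. H n x})"
    by (intro finite_measure_UNION) (use H H_unique in \<open>auto simp: disjoint_family_on_def\<close>)
  moreover have "(\<lambda>n. pr (?I n)) sums prob (\<Union>n. {x. ?I n x})"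
  proof (intro finite_measure_UNION)
    show "disjoint_family (\<lambda>n. {x. ?I n x})"
      unfolding disjoint_family_on_def
    proof (intro ballI impI, rule ccontr)
      fix m n :: nat assume "m \<noteq> n" "{x. ?I m x} \<inter> {x. ?I n x} \<noteq> {}"
      then obtain z where "?I m z" "?I n z" by auto
      then show False using \<open>m \<noteq> n\<close>
        H_unique'[of m "tt (- int_decode m) z" n "int_decode m - int_decode n"]
        by (auto simp: tt_add[symmetric])
    qed
  qed (use HI in auto)
  moreover have "pr (?I n) = pr (H n)" for n by (intro pr_shift H)
  ultimately have HI_eq: "prob (\<Union>n. {x. H n x}) = prob (\<Union>n. {x. ?I n x})"
    by (auto dest: sums_unique2)
  have sH: "(\<Union>n. {x. H n x}) \<in> sets M" "(\<Union>n. {x. ?I n x}) \<in> sets M"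
    using H HI by (auto intro!: sets.countable_UN)
  have HA: "(\<Union>n. {x. H n x}) \<subseteq> {x. A x}" using H_A by auto
  have HB: "(\<Union>n. {x. ?I n x}) \<subseteq> {x. B x}" using H_B[of n "tt (- int_decode n) z" for n z] by auto
  have "?RA = {x. A x} - (\<Union>n. {x. H n x})" by blast
  then have "prob ?RA = pr A - prob (\<Union>n. {x. H n x})"
    using finite_measure_Diff[OF nlc_sets[OF A] sH(1) HA] by simp
  also have "\<dots> = pr B - prob (\<Union>n. {x. ?I n x})" using HI_eq eq by simp
  also have "\<dots> = prob ?RB"
  proof -
    have "?RB = {z. B z} - (\<Union>n. {z. ?I n z})" by blast
    then show ?thesis using finite_measure_Diff[OF nlc_sets[OF B] sH(2) HB] by simp
  qed
  finally have R_eq: "prob ?RA = prob ?RB" .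
  have "prob ?RA = 0"
  proof (rule ccontr)
    assume "prob ?RA \<noteq> 0"
    then have "emeasure M ?RA > 0" by (simp add: emeasure_eq_measure zero_less_measure_iff)
    then have "AE z in M. \<exists>k. tt k z \<in> ?RA" by (intro ergodicity sRA)
    then have "AE z in M. z \<notin> ?RB"
    proof eventually_elim
      case (elim z)
      then obtain k where k: "A (tt k z)" "\<And>n. \<not> H n (tt k z)" by auto
      show ?case
      proof
        assume z: "z \<in> ?RB"
        obtain n where n: "int_decode n = - k" using surj_int_decode by (metis surjD)
        have "B (tt (int_decode n) (tt k z))" using z n by simp
        moreover have "\<not> H m (tt (int_decode n - int_decode m) (tt k z))" for m
          using z n by (auto simp: tt_add[symmetric])
        ultimately show False using k H_iff[of n "tt k z"] by auto
      qed
    qed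
    then have "prob ?RB = 0" by (simp only: prob_eq_0[OF sRB])
    then show False using R_eq \<open>prob ?RA \<noteq> 0\<close> by simp
  qed
  then have nA: "AE x in M. x \<notin> ?RA" and nB: "AE x in M. x \<notin> ?RB"
    using R_eq prob_eq_0[OF sRA] prob_eq_0[OF sRB] by simp_all
  let ?R = "\<lambda>n x. \<not> A x \<or> H n x"
  have R: "nlc (?R n)" for n by (intro nlc_disj nlc_not A H)
  have Rex: "eventually (\<lambda>x. \<exists>n. ?R n x) NE"
    using R by (rule NE_of_AE_search) (use nA in auto)
  have Bex: "eventually (\<lambda>z. \<exists>n. \<not> B z \<or> ?I n z) NE"
    by (rule NE_of_AE_search) (rule nlc_disj[OF nlc_not[OF B] HI], use nB in auto)
  define f where "f x = int_decode (LEAST n. ?R n x)" for x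
  have f_eq: "f x = int_decode n" if "H n x" for n x
  proof -
    have "A x" using that by (rule H_A)
    then have "(LEAST n. ?R n x) = n" using that H_unique by (intro Least_equality) auto
    then show ?thesis by (simp add: f_def)
  qed
  show thesis
  proof
    show "nlc f" unfolding f_def by (rule nlc_comp[where h = int_decode], rule nlc_Least[OF R Rex])
    show "eventually (\<lambda>x. A x \<longrightarrow> B (act f x)) NE"
      using Rex by eventually_elim (use H_B f_eq in \<open>auto simp: act_def\<close>)
    show "injects A f"
      using NE_orbit[OF Rex]
    proof eventually_elim
      case (elim x)
      show ?case
      proof (intro impI allI)
        fix k assume "A x" and k: "A (tt k x) \<and> f (tt k x) + k = f x"
        obtain m where m: "H m x" using elim \<open>A x\<close> tt_0 by metis
        obtain n where n: "H n (tt k x)" using elim k by blast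
        have "m = n" using H_unique'[OF m n] k f_eq[OF m] f_eq[OF n] by simp
        then show "k = 0" using k f_eq[OF m] f_eq[OF n] by simp
      qed
    qed
    show "reaches A f B"
      using Bex
    proof eventually_elim
      case (elim z)
      show ?case
      proof
        assume "B z"
        then obtain n where "?I n z" using elim by auto
        then show "\<exists>k. A (tt k z) \<and> f (tt k z) = - k"
          using H_A f_eq[of n] by (intro exI[of _ "- int_decode n"]) auto
      qed
    qed
  qed
qed

section \<open>Splitting sets into equal parts\<close>


lemma NE_neq: "eventually (\<lambda>x. x \<noteq> z) NE"
proof -
  have "{z} \<in> null_sets M" using point_null closed_sets[of "{z}"] by (auto simp: null_sets_def)
  then have "AE x in M. x \<in> - {z}" by (auto intro: AE_I')
  from NE_open[OF open_Compl[OF closed_singleton] this] show ?thesis by simp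
qed

lemma nlc_less_threshold:
  fixes f :: "'a \<Rightarrow> real"
  assumes "eventually (\<lambda>x. filterlim f (nhds (f x)) (nhds x)) NE" "eventually (\<lambda>x. f x \<noteq> t) NE"
  shows "nlc (\<lambda>x. f x < t)"
  using assms unfolding nlc_def
proof eventually_elim
  case (elim x)
  show ?case
  proof (cases "f x < t")
    case True
    then show ?thesis using order_tendstoD(2)[OF elim(1)] by (auto elim: eventually_mono)
  next
    case False
    then have "f x > t" using elim by simp
    then have "eventually (\<lambda>y. f y > t) (nhds x)" using order_tendstoD(1)[OF elim(1)] by auto
    then show ?thesis by eventually_elim (use False in auto)
  qed
qed

text \<open>The spheres around \<open>d\<close> are disjoint, so only countably many radii give positive measure.\<close>
lemma sphere_null_radius:
  fixes d :: 'a
  assumes "0 \<le> a" "a < b"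
  shows "\<exists>r. a < r \<and> r < b \<and> nlc (\<lambda>x. dist d x < r)"
proof -
  have cont: "continuous_on UNIV (dist d)" by (intro continuous_intros)
  have meas: "dist d \<in> borel_measurable M"
  proof (rule measurableI)
    fix S :: "real set" assume "S \<in> sets borel"
    then have "dist d -` S \<inter> space borel \<in> sets borel"
      using borel_measurable_continuous_onI[OF cont] by (rule measurable_sets[rotated])
    then show "dist d -` S \<inter> space M \<in> sets M" using borel_sub by (auto simp: space_UNIV)
  qed simp
  interpret N: finite_measure "distr M borel (dist d)"
    by (intro finite_measure_distr meas)
  have "uncountable ({a<..<b} - {r. measure (distr M borel (dist d)) {r} \<noteq> 0})"
    using N.countable_support assms(2) by (intro uncountable_minus_countable) (simp_all add: uncountable_open_interval)
  then have "{a<..<b} - {r. measure (distr M borel (dist d)) {r} \<noteq> 0} \<noteq> {}" by (metis countable_empty)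
  then obtain r where r: "a < r" "r < b" "measure (distr M borel (dist d)) {r} = 0" by auto
  have "closed {x. dist d x = r}" by (intro closed_Collect_eq continuous_intros)
  then have s: "{x. dist d x = r} \<in> sets M" by (rule closed_sets)
  have "measure M {x. dist d x = r} = 0"
    using r(3) meas by (simp add: measure_distr space_UNIV vimage_def)
  then have "{x. dist d x = r} \<in> null_sets M" using s by (auto simp: null_sets_def emeasure_eq_measure)
  then have "AE x in M. x \<in> {x. dist d x \<noteq> r}" by (auto intro: AE_I')
  moreover have "open {x. dist d x \<noteq> r}" by (intro open_Collect_neq continuous_intros)
  ultimately have "eventually (\<lambda>x. dist d x \<noteq> r) NE" using NE_open by force
  then have "nlc (\<lambda>x. dist d x < r)"
    by (rule nlc_less_threshold[rotated]) (intro always_eventually allI tendsto_dist tendsto_const filterlim_ident)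
  then show ?thesis using r by auto
qed

text \<open>Balls with null spheres around the points of a dense set; the radius for \<open>d\<close> and \<open>n\<close> is chosen between
  \<open>1 / (n + 2)\<close> and \<open>1 / (n + 1)\<close>.\<close>
lemma nlc_basis:
  obtains q :: "nat \<Rightarrow> 'a \<Rightarrow> bool" where
    "\<And>k. nlc (q k)"
    "\<And>x U. open U \<Longrightarrow> x \<in> U \<Longrightarrow> \<exists>k. q k x \<and> (\<forall>y. q k y \<longrightarrow> y \<in> U)"
proof -
  obtain D :: "'a set" where D: "countable D" "\<And>X. open X \<Longrightarrow> X \<noteq> {} \<Longrightarrow> \<exists>d\<in>D. d \<in> X"
    using countable_dense_exists by blast
  have "D \<noteq> {}" using D(2)[of UNIV] by auto
  have "\<forall>d n. \<exists>r. 1 / real (n + 2) < r \<and> r < 1 / real (n + 1) \<and> nlc (\<lambda>x. dist d x < r)"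
    by (intro allI sphere_null_radius) (auto simp: field_simps)
  then obtain r where r: "\<And>d n. 1 / real (n + 2) < r d n" "\<And>d n. r d n < 1 / real (n + 1)"
    "\<And>d n. nlc (\<lambda>x. dist d x < r d n)" by metis
  define q where "q k x \<longleftrightarrow> dist (from_nat_into D (fst (prod_decode k))) x <
    r (from_nat_into D (fst (prod_decode k))) (snd (prod_decode k))" for k x
  show thesis
  proof
    show "nlc (q k)" for k unfolding q_def by (rule r(3))
    fix x :: 'a and U :: "'a set" assume "open U" "x \<in> U"
    then obtain \<epsilon> where \<epsilon>: "\<epsilon> > 0" "ball x \<epsilon> \<subseteq> U" by (auto simp: open_contains_ball)
    obtain n where n: "2 / real (n + 1) < \<epsilon>"
    proof -
      obtain n where "2 / \<epsilon> < real n" using reals_Archimedean2 by auto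
      then have "2 / real (n + 1) < \<epsilon>" using \<epsilon>(1) by (simp add: field_simps)
      then show thesis by (rule that)
    qed
    obtain d where d: "d \<in> D" "d \<in> ball x (1 / real (n + 2))"
      using D(2)[of "ball x (1 / real (n + 2))"] by auto
    obtain i where i: "from_nat_into D i = d" using from_nat_into_surj[OF D(1) d(1)] by auto
    let ?k = "prod_encode (i, n)"
    have "q ?k x" using d(2) r(1)[of n d] by (simp add: q_def i dist_commute)
    moreover have "y \<in> U" if "q ?k y" for y
    proof -
      have "dist d y < r d n" "dist d x < r d n"
        using that \<open>q ?k x\<close> by (simp_all add: q_def i)
      then have "dist x y < 2 / real (n + 1)" using r(2)[of d n] dist_triangle3[of x y d] by simp
      then show ?thesis using \<epsilon>(2) n by (auto simp: ball_def)
    qed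
    ultimately show "\<exists>k. q k x \<and> (\<forall>y. q k y \<longrightarrow> y \<in> U)" by auto
  qed
qed

end

text \<open>Base \<open>3\<close> makes the map from sequences of digits to real numbers injective.\<close>
definition ternary :: "(nat \<Rightarrow> bool) \<Rightarrow> real" where
  "ternary a = (\<Sum>k. of_bool (a k) * (1/3) ^ Suc k)"

lemma third_sums: "(\<lambda>k. (1/3::real) ^ Suc (k + n)) sums ((1/3) ^ n / 2)"
proof -
  have "(\<lambda>k. (1/3::real) ^ Suc n * (1/3) ^ k) sums ((1/3) ^ Suc n * (1 / (1 - 1/3)))"
    by (intro sums_mult geometric_sums) simp
  then show ?thesis by (simp add: power_add mult_ac)
qed

lemma summable_ternary: "summable (\<lambda>k. of_bool (a k) * (1/3::real) ^ Suc k)"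
  by (rule summable_comparison_test[OF _ sums_summable[OF third_sums[of 0]]]) auto

lemma ternary_bounds: "0 \<le> ternary a" "ternary a < 1"
proof -
  show "0 \<le> ternary a" unfolding ternary_def by (intro suminf_nonneg summable_ternary) auto
  have "ternary a \<le> (\<Sum>k. (1/3::real) ^ Suc (k + 0))" unfolding ternary_def
    by (intro suminf_le summable_ternary sums_summable[OF third_sums]) auto
  then show "ternary a < 1" using sums_unique[OF third_sums[of 0]] by simp
qed

lemma ternary_diff:
  assumes "\<And>k. k < n \<Longrightarrow> a k = b k"
  shows "\<bar>ternary a - ternary b\<bar> \<le> (1/3) ^ n / 2"
    and "\<bar>ternary a - ternary b - (of_bool (a n) - of_bool (b n)) * (1/3) ^ Suc n\<bar> \<le> (1/3) ^ Suc n / 2"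
proof -
  define d :: "nat \<Rightarrow> real" where "d k = of_bool (a k) * (1/3) ^ Suc k - of_bool (b k) * (1/3) ^ Suc k" for k
  have sd: "summable d" unfolding d_def by (intro summable_diff summable_ternary)
  have eq: "ternary a - ternary b = suminf d"
    unfolding ternary_def d_def by (intro suminf_diff summable_ternary)
  have tail: "\<bar>\<Sum>k. d (k + m)\<bar> \<le> (1/3) ^ m / 2" for m
  proof -
    have "norm (\<Sum>k. d (k + m)) \<le> (\<Sum>k. (1/3::real) ^ Suc (k + m))"
      by (rule norm_suminf_le) (auto simp: d_def intro: sums_summable[OF third_sums])
    then show ?thesis using sums_unique[OF third_sums[of m]] by simp
  qed
  have 0: "(\<Sum>k<n. d k) = 0" using assms by (intro sum.neutral) (auto simp: d_def)
  show "\<bar>ternary a - ternary b\<bar> \<le> (1/3) ^ n / 2"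
    unfolding eq suminf_split_initial_segment[OF sd, of n] 0 using tail[of n] by simp
  have split: "suminf d = (\<Sum>k. d (k + Suc n)) + d n"
    unfolding suminf_split_initial_segment[OF sd, of "Suc n"] using 0 by simp
  have dn: "(of_bool (a n) - of_bool (b n)) * (1/3) ^ Suc n = d n"
    unfolding d_def by (simp only: left_diff_distrib)
  show "\<bar>ternary a - ternary b - (of_bool (a n) - of_bool (b n)) * (1/3) ^ Suc n\<bar> \<le> (1/3) ^ Suc n / 2"
    unfolding eq dn split add_diff_cancel_right' by (rule tail)
qed

lemma ternary_inj: "ternary a = ternary b \<Longrightarrow> a = b"
proof (rule ccontr)
  assume eq: "ternary a = ternary b" and "a \<noteq> b"
  then have ex: "\<exists>n. a n \<noteq> b n" by auto
  define n where "n = (LEAST n. a n \<noteq> b n)"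
  have n: "a n \<noteq> b n" "\<And>k. k < n \<Longrightarrow> a k = b k"
    using LeastI_ex[OF ex] not_less_Least unfolding n_def by auto
  have "\<bar>(of_bool (a n) - of_bool (b n)) * (1/3::real) ^ Suc n\<bar> \<le> (1/3) ^ Suc n / 2"
    using ternary_diff(2)[of n a b, OF n(2)] unfolding eq by (simp only: diff_self diff_0 abs_minus_cancel)
  moreover have "\<bar>(of_bool (a n) - of_bool (b n)) * (1/3::real) ^ Suc n\<bar> = (1/3) ^ Suc n"
    using n(1) by (cases "a n"; cases "b n") (auto simp: abs_mult)
  ultimately show False using zero_less_power[of "1/3::real" "Suc n"] by linarith
qed

context ergodic_Z_action begin

text \<open>The ternary number whose digits record the membership in the sets of the basis. The fibres
  of an injective function are points, and so null.\<close>
lemma injective_coordinate: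
  obtains g :: "'a \<Rightarrow> real" where "inj g" "\<And>x. 0 \<le> g x" "\<And>x. g x < 1"
    "eventually (\<lambda>x. filterlim g (nhds (g x)) (nhds x)) NE"
proof -
  obtain q where q: "\<And>k. nlc (q k)"
    "\<And>x U. open U \<Longrightarrow> x \<in> U \<Longrightarrow> \<exists>k::nat. q k x \<and> (\<forall>y. q k y \<longrightarrow> y \<in> U)"
    using nlc_basis by metis
  let ?g = "\<lambda>x. ternary (\<lambda>k. q k x)"
  show thesis
  proof
    show "inj ?g"
    proof (rule injI, rule ccontr)
      fix x y assume "?g x = ?g y" and xy: "x \<noteq> y"
      then have eq: "q k x = q k y" for k using ternary_inj by metis
      obtain k where "q k x" "\<forall>z. q k z \<longrightarrow> z \<in> - {y}" using q(2)[of "- {y}" x] xy by auto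
      then show False using eq by auto
    qed
    have "eventually (\<lambda>x. \<forall>k. eventually (\<lambda>y. q k y = q k x) (nhds x)) NE"
      using q(1) unfolding nlc_def by (rule NE_all_countable)
    then show "eventually (\<lambda>x. filterlim ?g (nhds (?g x)) (nhds x)) NE"
    proof eventually_elim
      case (elim x)
      show ?case
      proof (rule tendstoI)
        fix \<epsilon> :: real assume "\<epsilon> > 0"
        then obtain n where n: "(1/3) ^ n < \<epsilon>" using real_arch_pow_inv[of \<epsilon> "1/3"] by auto
        have "eventually (\<lambda>y. \<forall>k\<in>{..<n}. q k y = q k x) (nhds x)"
          using elim by (intro eventually_ball_finite) auto
        then show "eventually (\<lambda>y. dist (?g y) (?g x) < \<epsilon>) (nhds x)"
        proof eventually_elim
          case (elim y)
          have "\<bar>?g y - ?g x\<bar> \<le> (1/3) ^ n / 2" using elim by (intro ternary_diff) auto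
          also have "\<dots> \<le> (1/3) ^ n" by simp
          finally show ?case using n by (simp add: dist_real_def)
        qed
      qed
    qed
  qed (auto intro: ternary_bounds)
qed

text \<open>The parts are cut along the function \<open>h\<close> that adds the number of the class \<open>j x\<close> to an injective coordinate in
  \<open>[0, 1)\<close>. As its fibres are null, its distribution function is continuous and takes
  the values needed for equal parts. A part meets two classes only if it contains the end of one, which happens
  for at most as many parts (the set \<open>S\<close>) as there are classes.\<close>
lemma equal_parts:
  fixes j :: "'a \<Rightarrow> 'c::countable"
  assumes A: "nlc A" and j: "nlc j" "finite (range j)" and K: "K > 0"
  obtains e :: "'a \<Rightarrow> nat" and S where "nlc e" "\<And>x. e x < K"
    "\<And>i. i < K \<Longrightarrow> pr (\<lambda>x. A x \<and> e x = i) = pr A / K"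
    "finite S" "card S \<le> card (range j)" "\<And>x y. e x = e y \<Longrightarrow> j x \<noteq> j y \<Longrightarrow> e x \<in> S"
proof (cases "pr A = 0")
  case True
  have "card (range j) > 0" using j(2) by (simp add: card_gt_0_iff)
  then show thesis using True K
  proof (intro that[of "\<lambda>_. 0" "{0}"])
    show "pr (\<lambda>x. A x \<and> 0 = i) = pr A / real K" for i using True by (cases "i = 0") auto
  qed (auto simp: Suc_le_eq)
next
  case False
  obtain g :: "'a \<Rightarrow> real" where g: "inj g" "\<And>x. 0 \<le> g x" "\<And>x. g x < 1"
    "eventually (\<lambda>x. filterlim g (nhds (g x)) (nhds x)) NE" using injective_coordinate by metis
  define h where "h x = real (to_nat (j x)) + g x" for x
  have h_cont: "eventually (\<lambda>x. filterlim h (nhds (h x)) (nhds x)) NE"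
    using g(4) j(1) unfolding nlc_def
  proof eventually_elim
    case (elim x)
    have "filterlim (\<lambda>y. real (to_nat (j x)) + g y) (nhds (h x)) (nhds x)"
      unfolding h_def by (intro tendsto_add tendsto_const elim)
    then show ?case
      by (rule Lim_transform_eventually) (use elim(2) in eventually_elim, simp add: h_def)
  qed
  have h_neq: "eventually (\<lambda>x. h x \<noteq> t) NE" for t
  proof -
    have "eventually (\<lambda>x. g x \<noteq> t - real m) NE" for m
    proof (cases "t - real m \<in> range g")
      case True
      then obtain z where z: "t - real m = g z" by auto
      show ?thesis unfolding z using NE_neq[of z] by eventually_elim (use g(1) in \<open>auto dest: injD\<close>)
    next
      case False
      then have "g x \<noteq> t - real m" for x by (metis rangeI)
      then show ?thesis by simp
    qed
    then have "eventually (\<lambda>x. \<forall>m. g x \<noteq> t - real m) NE" by (rule NE_all_countable)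
    then show ?thesis by eventually_elim (auto simp: h_def algebra_simps)
  qed
  have h_nlc: "nlc (\<lambda>x. h x < t)" for t by (rule nlc_less_threshold[OF h_cont h_neq])
  have h_nlc': "nlc (\<lambda>x. t < h x)" for t
  proof -
    have "nlc (\<lambda>x. - h x < - t)"
    proof (rule nlc_less_threshold)
      show "eventually (\<lambda>x. filterlim (\<lambda>y. - h y) (nhds (- h x)) (nhds x)) NE"
        using h_cont by eventually_elim (rule tendsto_minus)
      show "eventually (\<lambda>x. - h x \<noteq> - t) NE" using h_neq[of t] by eventually_elim simp
    qed
    then show ?thesis by simp
  qed
  have h_meas: "h \<in> borel_measurable M"
    by (rule borel_measurableI_less) (use h_nlc in \<open>auto simp: space_UNIV\<close>)
  define N where "N = distr (density M (indicator {x. A x})) borel h"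
  have N_measure: "measure N B = pr (\<lambda>x. A x \<and> h x \<in> B)" if "B \<in> sets borel" for B
  proof -
    have "h -` B \<in> sets M" using h_meas that by (auto simp: measurable_def space_UNIV)
    then have "emeasure N B = emeasure M ({x. A x} \<inter> h -` B)"
      unfolding N_def using that h_meas A by (simp add: emeasure_distr space_UNIV emeasure_restricted nlc_sets)
    then show ?thesis by (simp add: measure_def Int_def vimage_def)
  qed
  have "UNIV \<in> sets M" using sets.top[of M] by (simp add: space_UNIV)
  then have "emeasure N (space N) \<noteq> \<infinity>"
    unfolding N_def using h_meas A
    by (simp add: emeasure_distr space_UNIV emeasure_restricted nlc_sets)
  then have "finite_measure N" by (rule finite_measureI)
  moreover have "sets N = sets borel" by (simp add: N_def)
  ultimately interpret N: finite_borel_measure N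
    by (simp add: finite_borel_measure_def finite_borel_measure_axioms_def)
  have cont: "isCont (cdf N) t" for t
  proof -
    have "measure N {t} = pr (\<lambda>x. A x \<and> h x = t)" by (simp add: N_measure)
    also have "\<dots> \<le> pr (\<lambda>x. False)"
      using h_neq[of t] by (intro pr_mono) (auto elim!: eventually_mono)
    finally show ?thesis by (simp add: N.isCont_cdf measure_le_0_iff)
  qed
  have cdf_eq: "cdf N t = pr (\<lambda>x. A x \<and> h x \<le> t)" for t by (simp add: cdf_def N_measure)
  have total: "measure N (space N) = pr A" using N_measure[of UNIV] by (simp add: N_def)
  have pos: "pr A > 0" using False by (simp add: zero_less_measure_iff)
  have "\<forall>i\<in>{1..<K}. \<exists>t. cdf N t = pr A * (real i / real K)"
  proof
    fix i assume i: "i \<in> {1..<K}"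
    let ?v = "pr A * (real i / real K)"
    have "0 < real i / real K" "real i / real K < 1" using i by auto
    then have v: "0 < ?v" "?v < pr A"
      using pos mult_strict_left_mono[of "real i / real K" 1 "pr A"] mult_pos_pos[of "pr A" "real i / real K"]
      by simp_all
    have "eventually (\<lambda>t. cdf N t < ?v) at_bot" using order_tendstoD(2)[OF N.cdf_lim_at_bot v(1)] .
    then obtain a where a: "\<And>t. t \<le> a \<Longrightarrow> cdf N t < ?v" by (auto simp: eventually_at_bot_linorder)
    have "eventually (\<lambda>t. ?v < cdf N t) at_top"
      using order_tendstoD(1)[OF N.cdf_lim_at_top] v(2) total by simp
    then obtain b where b: "\<And>t. t \<ge> b \<Longrightarrow> ?v < cdf N t" by (auto simp: eventually_at_top_linorder)
    have "\<exists>t. a \<le> t \<and> t \<le> max a b \<and> cdf N t = ?v"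
      by (rule IVT) (use a b cont in \<open>auto intro: less_imp_le\<close>)
    then show "\<exists>t. cdf N t = ?v" by auto
  qed
  then obtain t where t: "\<And>i. i \<in> {1..<K} \<Longrightarrow> cdf N (t i) = pr A * (real i / real K)" by metis
  have t_mono: "t i \<le> t k" if "i \<in> {1..<K}" "k \<in> {1..<K}" "i \<le> k" for i k
  proof (rule ccontr)
    assume "\<not> t i \<le> t k"
    then have "t k < t i" by simp
    then have "cdf N (t k) \<le> cdf N (t i)" by (intro N.cdf_nondecreasing) simp
    then have "real k / real K \<le> real i / real K"
      unfolding t[OF that(1)] t[OF that(2)] mult_le_cancel_left_pos[OF pos] .
    then have "k \<le> i" using K by (simp add: divide_le_cancel)
    then show False using \<open>\<not> t i \<le> t k\<close> that(3) by simp
  qed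
  \<comment> \<open>the number of thresholds below s is the number of the part\<close>
  define u where "u s = card {i \<in> {1..<K}. t i < s}" for s
  have u_mono: "u s \<le> u s'" if "s \<le> s'" for s s'
    unfolding u_def using that by (intro card_mono) auto
  have u_less: "u s < K" for s
  proof -
    have "u s \<le> card {1..<K}" unfolding u_def by (intro card_mono) auto
    then show ?thesis using K by simp
  qed
  have u_iff: "i \<le> u s \<longleftrightarrow> t i < s" if i: "i \<in> {1..<K}" for i s
  proof
    assume "t i < s"
    then have "{1..i} \<subseteq> {i \<in> {1..<K}. t i < s}" using i t_mono by fastforce
    then have "card {1..i} \<le> u s" unfolding u_def by (intro card_mono) auto
    then show "i \<le> u s" by simp
  next
    assume le: "i \<le> u s"
    show "t i < s"
    proof (rule ccontr)
      assume "\<not> t i < s"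
      then have "{i \<in> {1..<K}. t i < s} \<subseteq> {1..<i}"
        using i t_mono by (force simp: not_less)
      then have "u s \<le> card {1..<i}" unfolding u_def by (intro card_mono) auto
      then have "u s \<le> i - 1" by simp
      then show False using le i by (simp only: atLeastLessThan_iff) linarith
    qed
  qed
  define e where "e x = u (h x)" for x
  have e_nlc: "nlc e"
  proof -
    have "nlc (\<lambda>x. \<Sum>i\<in>{1..<K}. of_bool (t i < h x) :: nat)"
      by (intro nlc_sum nlc_comp[where h = of_bool] h_nlc') simp
    moreover have "(\<Sum>i\<in>{1..<K}. of_bool (t i < h x)) = e x" for x
      by (simp add: e_def u_def sum_of_bool_eq Int_def)
    ultimately show ?thesis by simp
  qed
  have cum: "pr (\<lambda>x. A x \<and> i \<le> e x) = pr A * (1 - real i / real K)" if iK: "i \<le> K" for i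
  proof -
    consider "i = 0" | "i = K" | "i \<in> {1..<K}" using iK by fastforce
    then show ?thesis
    proof cases
      case 2
      have "\<not> K \<le> e x" for x using u_less[of "h x"] by (simp add: e_def)
      then show ?thesis using 2 K by simp
    next
      case 3
      have "pr A = pr (\<lambda>x. A x \<and> t i < h x) + pr (\<lambda>x. A x \<and> \<not> t i < h x)"
        by (intro pr_split A h_nlc')
      also have "pr (\<lambda>x. A x \<and> \<not> t i < h x) = pr A * (real i / real K)"
        using t[OF 3] by (simp add: cdf_eq not_less)
      finally have "pr (\<lambda>x. A x \<and> t i < h x) = pr A * (1 - real i / real K)"
        by (simp only: right_diff_distrib mult_1_right add_diff_cancel_right')
      then show ?thesis by (simp only: e_def u_iff[OF 3])
    next
      case 1
      then show ?thesis by simp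
    qed
  qed
  have e_parts: "pr (\<lambda>x. A x \<and> e x = i) = pr A / K" if "i < K" for i
  proof -
    have "pr (\<lambda>x. A x \<and> i \<le> e x) = pr (\<lambda>x. (A x \<and> i \<le> e x) \<and> e x = i) + pr (\<lambda>x. (A x \<and> i \<le> e x) \<and> \<not> e x = i)"
      by (intro pr_split nlc_conj A nlc_comp[OF e_nlc])
    moreover have "(\<lambda>x. (A x \<and> i \<le> e x) \<and> e x = i) = (\<lambda>x. A x \<and> e x = i)" by auto
    moreover have "(\<lambda>x. (A x \<and> i \<le> e x) \<and> \<not> e x = i) = (\<lambda>x. A x \<and> Suc i \<le> e x)" by auto
    ultimately have "pr (\<lambda>x. A x \<and> i \<le> e x) = pr (\<lambda>x. A x \<and> e x = i) + pr (\<lambda>x. A x \<and> Suc i \<le> e x)"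
      by (simp only:)
    then have "pr (\<lambda>x. A x \<and> e x = i) = pr A * (1 - real i / real K) - pr A * (1 - real (Suc i) / real K)"
      using cum[of i] cum[of "Suc i"] that by linarith
    also have "\<dots> = pr A * (real (Suc i) / real K - real i / real K)" by (simp only: right_diff_distrib)
    also have "real (Suc i) / real K - real i / real K = 1 / real K"
      by (simp add: diff_divide_distrib[symmetric])
    finally show ?thesis by simp
  qed
  \<comment> \<open>the parts in which a class ends\<close>
  let ?S = "(\<lambda>c. u (real (to_nat c))) ` range j"
  have bad: "e x \<in> ?S" if "e x = e y" "j x \<noteq> j y" for x y
  proof -
    have *: "e x \<in> ?S" if le: "to_nat (j x) < to_nat (j y)" and eq: "e x = e y" for x y
    proof -
      have "h x \<le> real (to_nat (j y))" using le g(3)[of x] by (simp add: h_def)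
      then have "e x \<le> u (real (to_nat (j y)))" unfolding e_def by (rule u_mono)
      moreover have "u (real (to_nat (j y))) \<le> e y" unfolding e_def by (rule u_mono) (use g(2)[of y] in \<open>simp add: h_def\<close>)
      ultimately show ?thesis using eq by auto
    qed
    have "to_nat (j x) \<noteq> to_nat (j y)" using that(2) by simp
    then have "to_nat (j x) < to_nat (j y) \<or> to_nat (j y) < to_nat (j x)" by linarith
    then show ?thesis
    proof
      assume "to_nat (j x) < to_nat (j y)"
      from *[OF this that(1)] show ?thesis .
    next
      assume "to_nat (j y) < to_nat (j x)"
      from *[OF this that(1)[symmetric]] show ?thesis unfolding that(1) .
    qed
  qed
  show thesis
  proof (rule that[of e ?S])
    show "e x < K" for x unfolding e_def by (rule u_less)
    show "finite ?S" using j(2) by simp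
    show "card ?S \<le> card (range j)" using j(2) by (rule card_image_le)
  qed (rule e_nlc e_parts bad; assumption)+
qed

section \<open>Divisions into equal parts linked along orbits\<close>


text \<open>A division of \<open>A\<close> into \<open>K\<close> parts: \<open>e x\<close> is the number of the part of \<open>x\<close>, and \<open>b x\<close> is the time that moves \<open>x\<close>
  to part \<open>0\<close>, where points stay fixed. The last two clauses say that each class, the points with a common
  image in part \<open>0\<close>, has exactly one point in every part.\<close>
definition division :: "('a \<Rightarrow> bool) \<Rightarrow> nat \<Rightarrow> ('a \<Rightarrow> nat) \<Rightarrow> ('a \<Rightarrow> int) \<Rightarrow> bool" where
  "division A K e b \<longleftrightarrow> nlc e \<and> nlc b \<and>
     eventually (\<lambda>x. A x \<longrightarrow> e x < K \<and> A (act b x) \<and> e (act b x) = 0 \<and> (e x = 0 \<longrightarrow> b x = 0)) NE \<and>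
     eventually (\<lambda>x. A x \<longrightarrow> (\<forall>i<K. \<exists>k. A (tt k x) \<and> e (tt k x) = i \<and> b (tt k x) + k = b x)) NE \<and>
     eventually (\<lambda>x. A x \<longrightarrow> (\<forall>k. A (tt k x) \<and> e (tt k x) = e x \<and> b (tt k x) + k = b x \<longrightarrow> k = 0)) NE"

lemma division_nlc: "division A K e b \<Longrightarrow> nlc e" "division A K e b \<Longrightarrow> nlc b"
  and division_base: "division A K e b \<Longrightarrow>
     eventually (\<lambda>x. A x \<longrightarrow> e x < K \<and> A (act b x) \<and> e (act b x) = 0 \<and> (e x = 0 \<longrightarrow> b x = 0)) NE"
  and division_onto: "division A K e b \<Longrightarrow>
     eventually (\<lambda>x. A x \<longrightarrow> (\<forall>i<K. \<exists>k. A (tt k x) \<and> e (tt k x) = i \<and> b (tt k x) + k = b x)) NE"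
  and division_inj: "division A K e b \<Longrightarrow>
     eventually (\<lambda>x. A x \<longrightarrow> (\<forall>k. A (tt k x) \<and> e (tt k x) = e x \<and> b (tt k x) + k = b x \<longrightarrow> k = 0)) NE"
  by (auto simp: division_def)

text \<open>Each part is carried to part \<open>0\<close> by a Hopf equivalence.\<close>
lemma division_of_equal_parts:
  assumes A: "nlc A" and e: "nlc e" and K: "K > 0" and eK: "\<And>x. e x < K"
    and eq: "\<And>i. i < K \<Longrightarrow> pr (\<lambda>x. A x \<and> e x = i) = c"
  obtains b where "division A K e b"
proof -
  let ?P = "\<lambda>i x. A x \<and> e x = i"
  have P: "nlc (?P i)" for i by (intro nlc_conj A nlc_comp[OF e])
  let ?H = "\<lambda>i f. nlc f \<and> eventually (\<lambda>x. ?P i x \<longrightarrow> ?P 0 (act f x)) NE \<and>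
    injects (?P i) f \<and> reaches (?P i) f (?P 0) \<and> (i = 0 \<longrightarrow> (\<forall>x. f x = 0))"
  have "\<forall>i. \<exists>f. i < K \<longrightarrow> ?H i f"
  proof
    fix i
    show "\<exists>f. i < K \<longrightarrow> ?H i f"
    proof (cases "0 < i \<and> i < K")
      case True
      then have "pr (?P i) = pr (?P 0)" using eq K by simp
      from Hopf_equivalence[OF P P this] obtain f where f: "nlc f"
        "eventually (\<lambda>x. ?P i x \<longrightarrow> ?P 0 (act f x)) NE"
        "injects (?P i) f"
        "reaches (?P i) f (?P 0)" .
      have iz: "i = 0 \<longrightarrow> (\<forall>x. f x = 0)" using True by blast
      show ?thesis by (rule exI[of _ f], rule impI) (rule conjI f iz)+
    next
      case False
      show ?thesis
      proof (rule exI[of _ "\<lambda>x. 0"], rule impI)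
        assume "i < K"
        then have i: "i = 0" using False by linarith
        have "reaches (?P 0) (\<lambda>x. 0) (?P 0)"
          by (intro always_eventually allI impI exI[of _ 0]) (simp add: tt_0)
        then show "?H i (\<lambda>x. 0)"
          unfolding i by (simp add: act_def tt_0)
      qed
    qed
  qed
  from choice[OF this] obtain f where f0: "\<forall>i. i < K \<longrightarrow> ?H i (f i)"
    by (rule exE)
  have f: "\<And>i. i < K \<Longrightarrow> nlc (f i)"
    "\<And>i. i < K \<Longrightarrow> eventually (\<lambda>x. ?P i x \<longrightarrow> ?P 0 (act (f i) x)) NE"
    "\<And>i. i < K \<Longrightarrow> injects (?P i) (f i)"
    "\<And>i. i < K \<Longrightarrow> reaches (?P i) (f i) (?P 0)"
    "\<And>x. f 0 x = 0"
    using f0 K by blast+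
  have to: "eventually (\<lambda>x. \<forall>i<K. ?P i x \<longrightarrow> ?P 0 (act (f i) x)) NE"
    by (rule NE_all_countable) (use f(2) in \<open>auto elim!: eventually_mono\<close>)
  have inj: "eventually (\<lambda>x. \<forall>i<K. ?P i x \<longrightarrow> (\<forall>k. ?P i (tt k x) \<and> f i (tt k x) + k = f i x \<longrightarrow> k = 0)) NE"
    by (rule NE_all_countable) (use f(3) in \<open>auto elim!: eventually_mono\<close>)
  have onto: "eventually (\<lambda>z. \<forall>i<K. ?P 0 z \<longrightarrow> (\<exists>k. ?P i (tt k z) \<and> f i (tt k z) = - k)) NE"
    by (rule NE_all_countable) (use f(4) in \<open>auto elim!: eventually_mono\<close>)
  define F where "F i = (if i < K then f i else (\<lambda>x. 0))" for i
  have F_nlc: "nlc (F i)" for i using f(1) by (simp add: F_def)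
  define b where "b x = F (e x) x" for x
  have b_eq: "b x = f (e x) x" for x using eK[of x] by (simp add: b_def F_def)
  have act_b: "act b x = act (f (e x)) x" for x by (simp add: act_def b_eq)
  show thesis
  proof
    show "division A K e b" unfolding division_def
    proof (intro conjI)
      show "nlc b" unfolding b_def by (rule nlc_select[OF e F_nlc])
      show "eventually (\<lambda>x. A x \<longrightarrow> e x < K \<and> A (act b x) \<and> e (act b x) = 0 \<and> (e x = 0 \<longrightarrow> b x = 0)) NE"
        using to by eventually_elim (use eK f(5) in \<open>auto simp: b_eq act_b\<close>)
      show "eventually (\<lambda>x. A x \<longrightarrow> (\<forall>k. A (tt k x) \<and> e (tt k x) = e x \<and> b (tt k x) + k = b x \<longrightarrow> k = 0)) NE"
        using inj by eventually_elim (use eK in \<open>auto simp: b_eq\<close>)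
      show "eventually (\<lambda>x. A x \<longrightarrow> (\<forall>i<K. \<exists>k. A (tt k x) \<and> e (tt k x) = i \<and> b (tt k x) + k = b x)) NE"
        using to NE_orbit[OF onto]
      proof eventually_elim
        case (elim x)
        show ?case
        proof (intro impI allI)
          fix i assume "A x" "i < K"
          have "?P 0 (act b x)" using elim(1) \<open>A x\<close> eK[of x] by (simp add: act_b)
          then obtain k where k: "?P i (tt k (act b x))" "f i (tt k (act b x)) = - k"
            using elim(2) \<open>i < K\<close> unfolding act_def by blast
          have "tt k (act b x) = tt (k + b x) x" by (simp add: act_def tt_add)
          with k show "\<exists>k. A (tt k x) \<and> e (tt k x) = i \<and> b (tt k x) + k = b x"
            by (intro exI[of _ "k + b x"]) (auto simp: b_eq)
        qed
      qed
    qed (rule e)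
  qed
qed

lemma division_union:
  assumes A: "nlc A" "nlc B" and disj: "\<And>x. \<not> (A x \<and> B x)"
    and d1: "division A K e b" and d2: "division B K e' b'"
  shows "division (\<lambda>x. A x \<or> B x) K (\<lambda>x. if A x then e x else e' x) (\<lambda>x. if A x then b x else b' x)"
    (is "division ?C K ?e ?b")
proof -
  have eb: "?e x = e x" "?b x = b x" "act ?b x = act b x" if "A x" for x using that by (simp_all add: act_def)
  have nA: "\<not> A x" if "B x" for x using that disj by auto
  have eb': "?e x = e' x" "?b x = b' x" "act ?b x = act b' x" if "B x" for x
    using nA[OF that] by (simp_all add: act_def)
  show ?thesis unfolding division_def
  proof (intro conjI)
    show "nlc ?e" "nlc ?b" by (intro nlc_if A division_nlc[OF d1] division_nlc[OF d2])+
    show "eventually (\<lambda>x. ?C x \<longrightarrow> ?e x < K \<and> ?C (act ?b x) \<and> ?e (act ?b x) = 0 \<and> (?e x = 0 \<longrightarrow> ?b x = 0)) NE"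
      using division_base[OF d1] division_base[OF d2]
    proof eventually_elim
      case (elim x)
      show ?case
      proof (intro impI)
        assume "?C x"
        then show "?e x < K \<and> ?C (act ?b x) \<and> ?e (act ?b x) = 0 \<and> (?e x = 0 \<longrightarrow> ?b x = 0)"
        proof
          assume x: "A x"
          with elim(1) show ?thesis unfolding eb[OF x] by simp
        next
          assume x: "B x"
          with elim(2) show ?thesis unfolding eb'[OF x] using nA by simp
        qed
      qed
    qed
    show "eventually (\<lambda>x. ?C x \<longrightarrow> (\<forall>i<K. \<exists>k. ?C (tt k x) \<and> ?e (tt k x) = i \<and> ?b (tt k x) + k = ?b x)) NE"
      using division_onto[OF d1] division_onto[OF d2]
    proof eventually_elim
      case (elim x)
      show ?case
      proof (intro impI allI)
        fix i assume "?C x" and i: "i < K"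
        then show "\<exists>k. ?C (tt k x) \<and> ?e (tt k x) = i \<and> ?b (tt k x) + k = ?b x"
        proof (elim disjE)
          assume x: "A x"
          then obtain k where k: "A (tt k x)" "e (tt k x) = i" "b (tt k x) + k = b x" using elim(1) i by blast
          then show ?thesis using x by (intro exI[of _ k]) simp
        next
          assume x: "B x"
          then obtain k where k: "B (tt k x)" "e' (tt k x) = i" "b' (tt k x) + k = b' x" using elim(2) i by blast
          then show ?thesis using x nA by (intro exI[of _ k]) simp
        qed
      qed
    qed
    show "eventually (\<lambda>x. ?C x \<longrightarrow> (\<forall>k. ?C (tt k x) \<and> ?e (tt k x) = ?e x \<and> ?b (tt k x) + k = ?b x \<longrightarrow> k = 0)) NE"
      using division_inj[OF d1] division_inj[OF d2] NE_orbit[OF division_base[OF d1]] NE_orbit[OF division_base[OF d2]]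
    proof eventually_elim
      case (elim x)
      \<comment> \<open>points of different summands cannot be in one class, as the images lie in their own summand\<close>
      have clash: False if "A (tt j x)" "B (tt l x)" "b (tt j x) + j = b' (tt l x) + l" for j l
      proof -
        have "A (act b (tt j x))" "B (act b' (tt l x))" using elim(3,4) that by blast+
        moreover have "act b (tt j x) = act b' (tt l x)" using that(3) by (simp add: act_def tt_add[symmetric])
        ultimately show False using disj by metis
      qed
      show ?case
      proof (intro impI allI)
        fix k assume C: "?C x" and k: "?C (tt k x) \<and> ?e (tt k x) = ?e x \<and> ?b (tt k x) + k = ?b x"
        show "k = 0"
        proof (cases "A x")
          case x: True
          show ?thesis
          proof (cases "A (tt k x)")
            case True
            then show ?thesis using x elim(1) k by simp
          next
            case False
            then show ?thesis using clash[of 0 k] x k by (simp add: tt_0)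
          qed
        next
          case x: False
          show ?thesis
          proof (cases "A (tt k x)")
            case True
            then show ?thesis using clash[of k 0] x k C by (simp add: tt_0)
          next
            case False
            then show ?thesis using x elim(2) k C by simp
          qed
        qed
      qed
    qed
  qed
qed

text \<open>The number of the new part of \<open>x\<close> has the old number as its remainder modulo \<open>K\<close>; this makes codes of later
  stages determine those of earlier ones.\<close>
lemma division_refine:
  assumes d: "division A K e b" and d': "division (\<lambda>x. A x \<and> e x = 0) L e' b'"
  shows "division A (K * L) (\<lambda>x. e x + K * e' (act b x)) (kcomp b' b)" (is "division A _ ?e ?b")
proof -
  have tk: "tt m (act b x) = tt (m + b x) x" for m x by (simp add: act_def tt_add)
  show ?thesis unfolding division_def
  proof (intro conjI)
    show "nlc ?e" by (intro nlc_plus division_nlc[OF d] nlc_comp[OF nlc_act[OF division_nlc(1)[OF d'] division_nlc(2)[OF d]]])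
    show "nlc ?b" by (intro nlc_kcomp division_nlc[OF d] division_nlc[OF d'])
    show "eventually (\<lambda>x. A x \<longrightarrow> ?e x < K * L \<and> A (act ?b x) \<and> ?e (act ?b x) = 0 \<and> (?e x = 0 \<longrightarrow> ?b x = 0)) NE"
      using division_base[OF d] NE_orbit[OF division_base[OF d']] NE_orbit[OF division_base[OF d]]
    proof eventually_elim
      case (elim x)
      show ?case
      proof (intro impI)
        assume "A x"
        define x0 where "x0 = act b x"
        define z where "z = act b' x0"
        have x0: "e x < K" "A x0" "e x0 = 0" "e x = 0 \<longrightarrow> b x = 0" using elim(1) \<open>A x\<close> by (auto simp: x0_def)
        have z: "e' x0 < L" "A z" "e z = 0" "e' z = 0" "e' x0 = 0 \<longrightarrow> b' x0 = 0"
          using elim(2) x0 by (auto simp: x0_def z_def act_def)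
        have K: "K > 0" using x0(1) by simp
        have zt: "z = tt (b' x0 + b x) x" by (simp add: z_def x0_def act_def tt_add)
        have "b z = 0" using elim(3) z(2,3) unfolding zt by blast
        then have az: "act b z = z" by (simp add: act_def tt_0)
        have abz: "act ?b x = z" by (simp add: act_kcomp z_def x0_def)
        have "e x + K * e' x0 < K * L"
        proof -
          have "e x + K * e' x0 < K * (e' x0 + 1)" using x0(1) by simp
          also have "\<dots> \<le> K * L" using z(1) by (intro mult_left_mono) auto
          finally show ?thesis .
        qed
        moreover have "?b x = 0" if "e x + K * e' x0 = 0"
        proof -
          have "e x = 0" "e' x0 = 0" using that K by auto
          moreover have "?b x = b' x0 + b x" by (simp add: kcomp_def x0_def)
          ultimately show ?thesis using x0(4) z(5) by simp
        qed
        ultimately show "?e x < K * L \<and> A (act ?b x) \<and> ?e (act ?b x) = 0 \<and> (?e x = 0 \<longrightarrow> ?b x = 0)"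
          unfolding abz az x0_def[symmetric] using z by simp
      qed
    qed
    show "eventually (\<lambda>x. A x \<longrightarrow> (\<forall>i<K * L. \<exists>k. A (tt k x) \<and> ?e (tt k x) = i \<and> ?b (tt k x) + k = ?b x)) NE"
      using division_base[OF d] NE_orbit[OF division_onto[OF d']] NE_orbit[OF division_onto[OF d]] NE_orbit[OF division_base[OF d]]
    proof eventually_elim
      case (elim x)
      show ?case
      proof (intro impI allI)
        fix i assume "A x" and i: "i < K * L"
        define r where "r = i mod K"
        define q where "q = i div K"
        have K: "K > 0" using elim(1) \<open>A x\<close> by auto
        have rq: "r < K" "q < L" "r + K * q = i"
          using i K by (auto simp: r_def q_def less_mult_imp_div_less mult.commute)
        define x0 where "x0 = act b x"
        have x0: "A x0" "e x0 = 0" using elim(1) \<open>A x\<close> by (auto simp: x0_def)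
        obtain k where k: "A (tt k x0)" "e (tt k x0) = 0" "e' (tt k x0) = q" "b' (tt k x0) + k = b' x0"
          using elim(2) x0 rq(2) unfolding x0_def act_def by blast
        define z where "z = tt k x0"
        have zt: "z = tt (k + b x) x" by (simp add: z_def x0_def tk)
        have bz: "b z = 0" using elim(4) k(1,2) unfolding z_def[symmetric] unfolding zt by blast
        have "A z" using k(1) by (simp add: z_def)
        then obtain l where l: "A (tt l z)" "e (tt l z) = r" "b (tt l z) + l = 0"
          using elim(3) rq(1) bz unfolding zt by force
        define w where "w = tt l z"
        have wt: "w = tt (l + k + b x) x" by (simp add: w_def zt tt_add)
        have bw: "b w = - l" using l(3) by (simp add: w_def)
        have aw: "act b w = z" unfolding act_def bw by (simp add: w_def)
        show "\<exists>k. A (tt k x) \<and> ?e (tt k x) = i \<and> ?b (tt k x) + k = ?b x"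
        proof (intro exI[of _ "l + k + b x"] conjI)
          show "A (tt (l + k + b x) x)" using l(1) by (simp add: wt[symmetric] w_def)
          show "?e (tt (l + k + b x) x) = i"
            unfolding wt[symmetric] aw using l(2) k(3) rq(3) by (simp add: w_def z_def)
          show "?b (tt (l + k + b x) x) + (l + k + b x) = ?b x"
            unfolding wt[symmetric] kcomp_def aw bw using k(4) by (simp add: z_def x0_def)
        qed
      qed
    qed
    show "eventually (\<lambda>x. A x \<longrightarrow> (\<forall>k. A (tt k x) \<and> ?e (tt k x) = ?e x \<and> ?b (tt k x) + k = ?b x \<longrightarrow> k = 0)) NE"
      using division_inj[OF d] NE_orbit[OF division_inj[OF d']] NE_orbit[OF division_base[OF d]]
    proof eventually_elim
      case (elim x)
      show ?case
      proof (intro impI allI)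
        fix k assume x: "A x" and k: "A (tt k x) \<and> ?e (tt k x) = ?e x \<and> ?b (tt k x) + k = ?b x"
        define w where "w = tt k x"
        have "A (tt 0 x)" using x by (simp add: tt_0)
        then have bx: "e x < K" "A (act b x)" "e (act b x) = 0" using elim(3) by (metis tt_0)+
        have bw: "e w < K" "A (act b w)" "e (act b w) = 0" using elim(3) k by (auto simp: w_def)
        have K: "K > 0" using bx(1) by simp
        have e_eq: "e w + K * e' (act b w) = e x + K * e' (act b x)" using k by (simp add: w_def)
        have "(e w + K * e' (act b w)) mod K = e w" "(e x + K * e' (act b x)) mod K = e x"
          using bx(1) bw(1) by simp_all
        with e_eq have 1: "e w = e x" by metis
        with e_eq K have 2: "e' (act b w) = e' (act b x)" by simp
        have m: "act b w = tt (b w + k - b x) (act b x)" unfolding tk by (simp add: act_def w_def tt_add)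
        have "b w + k - b x = 0"
        proof -
          have "b' (act b w) + (b w + k - b x) = b' (act b x)" using k by (simp add: kcomp_def w_def)
          then show ?thesis using elim(2) bx bw 2 m unfolding act_def by metis
        qed
        then show "k = 0" using elim(1) x k 1 by (auto simp: w_def)
      qed
    qed
  qed
qed

lemma division_part_measure:
  assumes A: "nlc A" and d: "division A K e b" and E: "nlc E" "\<And>x. E x \<Longrightarrow> A x \<and> e x = 0" and i: "i < K"
  shows "pr (\<lambda>x. (A x \<and> e x = i) \<and> E (act b x)) = pr E"
proof (rule pr_act_eq)
  show "nlc (\<lambda>x. A x \<and> e x = i)" by (intro nlc_conj A nlc_comp[OF division_nlc(1)[OF d]])
  show "injects (\<lambda>x. A x \<and> e x = i) b"
    using division_inj[OF d] by eventually_elim auto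
  show "reaches (\<lambda>x. A x \<and> e x = i) b E"
    using division_onto[OF d] division_base[OF d]
  proof eventually_elim
    case (elim z)
    show ?case
    proof
      assume "E z"
      then have z: "A z" "e z = 0" using E(2) by auto
      then obtain k where "A (tt k z)" "e (tt k z) = i" "b (tt k z) + k = b z" using elim(1) i by blast
      moreover have "b z = 0" using elim(2) z by auto
      ultimately show "\<exists>k. (A (tt k z) \<and> e (tt k z) = i) \<and> b (tt k z) = - k" by (intro exI[of _ k]) auto
    qed
  qed
qed (intro E division_nlc[OF d])+

lemma pr_sum_parts:
  fixes e :: "'a \<Rightarrow> nat"
  assumes "nlc A" "nlc e" "eventually (\<lambda>x. A x \<longrightarrow> e x < K) NE"
  shows "pr A = (\<Sum>i<K. pr (\<lambda>x. A x \<and> e x = i))"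
proof -
  have "pr A = pr (\<lambda>x. \<exists>i<K. A x \<and> e x = i)"
  proof (rule pr_cong[OF assms(1)])
    show "nlc (\<lambda>x. \<exists>i<K. A x \<and> e x = i)"
      by (rule nlc_ex_less) (rule nlc_conj[OF assms(1) nlc_eq[OF assms(2) nlc_const]])
    show "eventually (\<lambda>x. A x = (\<exists>i<K. A x \<and> e x = i)) NE"
      using assms(3) by eventually_elim auto
  qed
  also have "\<dots> = prob (\<Union>i\<in>{..<K}. {x. A x \<and> e x = i})" by (rule arg_cong[where f = prob]) auto
  also have "\<dots> = (\<Sum>i<K. pr (\<lambda>x. A x \<and> e x = i))"
    by (rule finite_measure_finite_Union)
       (auto simp: disjoint_family_on_def intro!: nlc_sets nlc_conj assms(1) nlc_eq[OF assms(2) nlc_const])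
  finally show ?thesis .
qed

lemma division_measure:
  assumes A: "nlc A" and d: "division A K e b" and i: "i < K"
  shows "pr (\<lambda>x. A x \<and> e x = i) = pr A / K"
proof -
  let ?B = "\<lambda>x. A x \<and> e x = 0"
  have B: "nlc ?B" by (intro nlc_conj A nlc_comp[OF division_nlc(1)[OF d]])
  have eq: "pr (\<lambda>x. A x \<and> e x = i) = pr ?B" if "i < K" for i
  proof -
    have "pr (\<lambda>x. A x \<and> e x = i) = pr (\<lambda>x. (A x \<and> e x = i) \<and> ?B (act b x))"
      proof (rule pr_cong)
      show C: "nlc (\<lambda>x. A x \<and> e x = i)"
        by (intro nlc_conj A nlc_eq[OF division_nlc(1)[OF d] nlc_const])
      show "nlc (\<lambda>x. (A x \<and> e x = i) \<and> ?B (act b x))"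
        by (intro nlc_conj[OF C] nlc_act[OF B division_nlc(2)[OF d]])
      show "eventually (\<lambda>x. (A x \<and> e x = i) = ((A x \<and> e x = i) \<and> ?B (act b x))) NE"
        using division_base[OF d] by eventually_elim auto
    qed
    also have "\<dots> = pr ?B" by (rule division_part_measure[OF A d B _ that]) simp
    finally show ?thesis .
  qed
  have "pr A = (\<Sum>i<K. pr (\<lambda>x. A x \<and> e x = i))"
    by (rule pr_sum_parts[OF A division_nlc(1)[OF d]]) (use division_base[OF d] in eventually_elim, blast)
  also have "\<dots> = (\<Sum>i<K. pr ?B)" by (rule sum.cong[OF refl]) (rule eq, simp)
  finally have "pr A = K * pr ?B" by simp
  moreover have "K \<noteq> 0" using i by simp
  ultimately show ?thesis unfolding eq[OF i] by simp
qed

text \<open>Each of the \<open>K\<close> parts contributes at most the measure of \<open>E\<close>.\<close>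
lemma pr_pull_back_le:
  assumes A: "nlc A" and d: "division A K e b" and E: "nlc E"
  shows "pr (\<lambda>x. A x \<and> E (act b x)) \<le> K * pr E"
proof -
  have "pr (\<lambda>x. A x \<and> E (act b x)) = (\<Sum>i<K. pr (\<lambda>x. (A x \<and> E (act b x)) \<and> e x = i))"
    by (rule pr_sum_parts[OF nlc_conj[OF A nlc_act[OF E division_nlc(2)[OF d]]] division_nlc(1)[OF d]])
      (use division_base[OF d] in eventually_elim, blast)
  also have "\<dots> \<le> (\<Sum>i<K. pr E)"
  proof (rule sum_mono)
    fix i
    have "pr (\<lambda>x. (A x \<and> E (act b x)) \<and> e x = i) = pr (\<lambda>x. (A x \<and> e x = i) \<and> E (act b x))"
      by (rule arg_cong[where f = prob]) auto
    also have "\<dots> \<le> pr E"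
    proof (rule pr_act_le)
      show "nlc (\<lambda>x. A x \<and> e x = i)" by (intro nlc_conj A nlc_comp[OF division_nlc(1)[OF d]])
      show "injects (\<lambda>x. A x \<and> e x = i) b"
        using division_inj[OF d] by eventually_elim auto
    qed (intro E division_nlc[OF d])+
    finally show "pr (\<lambda>x. (A x \<and> E (act b x)) \<and> e x = i) \<le> pr E" .
  qed
  finally show ?thesis by simp
qed

section \<open>Divisions that separate points\<close>


lemma NE_nontrivial: "\<not> eventually (\<lambda>x. False) NE"
proof
  assume "eventually (\<lambda>x. False) NE"
  then have "AE x in M. False" by (rule NE_AE)
  then show False by simp
qed

lemma division_pos:
  assumes "division (\<lambda>_. True) N D c"
  shows "N > 0"
proof (rule ccontr)
  assume "\<not> N > 0"
  then have "eventually (\<lambda>x. False) NE"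
    using division_base[OF assms] by (auto elim!: eventually_mono)
  then show False using NE_nontrivial by blast
qed

lemma prob_UNIV: "prob UNIV = 1"
  using prob_space by (simp add: space_UNIV)

lemma pr_base: 
  assumes d: "division (\<lambda>_. True) N D c"
  shows "pr (\<lambda>x. D x = 0) = 1 / N"
  using division_measure[OF nlc_const d division_pos[OF d]] by (simp add: prob_UNIV)

text \<open>A point \<open>a\<close> of part \<open>0\<close> stands for its class, and \<open>J a\<close> lists the values of \<open>w\<close> on the class. Splitting
  part \<open>0\<close> into many equal parts that nearly respect the partition by \<open>J\<close> makes \<open>w\<close> a function
  of the new number, except for the numbers in \<open>S\<close>.\<close>
lemma separating_step:
  fixes w :: "'a \<Rightarrow> 'w::countable"
  assumes d: "division (\<lambda>_. True) N D c" and w: "nlc w" "finite (range w)" and \<epsilon>: "\<epsilon> > (0::real)"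
  shows "\<exists>K0. \<forall>K\<ge>K0. \<exists>e b S G. division (\<lambda>x. D x = 0) K e b \<and>
    pr (\<lambda>x. D x + N * e (act c x) \<in> S) < \<epsilon> \<and> eventually G NE \<and>
    (\<forall>x y. G x \<longrightarrow> G y \<longrightarrow> D x + N * e (act c x) = D y + N * e (act c y) \<longrightarrow>
       D x + N * e (act c x) \<notin> S \<longrightarrow> w x = w y)" (is "\<exists>K0. \<forall>K\<ge>K0. ?goal K")
proof -
  note N = division_pos[OF d]
  have nD: "nlc D" and nc: "nlc c" by (rule division_nlc[OF d])+
  let ?A = "\<lambda>x. D x = 0"
  have A: "nlc ?A" by (rule nlc_eq[OF nD nlc_const])
  define R where "R s n a \<longleftrightarrow> \<not> (D a = 0 \<and> s < N) \<or>
    D (tt (int_decode n) a) = s \<and> c (tt (int_decode n) a) + int_decode n = 0" for s n a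
  have R: "nlc (R s n)" for s n
    unfolding R_def
    by (intro nlc_disj nlc_not nlc_conj nlc_const A nlc_eq[OF nlc_shift[OF nD] nlc_const]
      nlc_eq[OF nlc_plus[OF nlc_shift[OF nc] nlc_const] nlc_const])
  have Rex: "eventually (\<lambda>a. \<forall>s. \<exists>n. R s n a) NE"
    using division_onto[OF d] division_base[OF d]
  proof eventually_elim
    case (elim a)
    show ?case
    proof
      fix s
      show "\<exists>n. R s n a"
      proof (cases "D a = 0 \<and> s < N")
        case True
        then obtain k where k: "D (tt k a) = s" "c (tt k a) + k = c a" using elim(1) by blast
        obtain n where n: "int_decode n = k" using surj_int_decode by (metis surjD)
        have "c a = 0" using elim(2) True by simp
        then show ?thesis unfolding R_def using k n by auto
      qed (simp add: R_def)
    qed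
  qed
  \<comment> \<open>the time from a to the point with number s in its class\<close>
  define \<kappa> where "\<kappa> s a = int_decode (LEAST n. R s n a)" for s a
  have \<kappa>: "nlc (\<kappa> s)" for s
    unfolding \<kappa>_def
  proof (rule nlc_comp[where h = int_decode], rule nlc_Least[OF R])
    show "eventually (\<lambda>x. \<exists>n. R s n x) NE" using Rex by eventually_elim blast
  qed
  define J where "J a = map (\<lambda>s. w (act (\<kappa> s) a)) [0..<N]" for a
  have J_nlc: "nlc J" unfolding J_def by (intro nlc_list_map nlc_act w(1) \<kappa>)
  have "range J \<subseteq> {xs. set xs \<subseteq> range w \<and> length xs = N}" by (auto simp: J_def)
  then have J_fin: "finite (range J)" by (rule finite_subset) (rule finite_lists_length_eq[OF w(2)])
  define G where "G x \<longleftrightarrow> D x < N \<and> w x = J (act c x) ! D x" for x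
  have G: "eventually G NE"
    using division_base[OF d] NE_orbit[OF Rex] division_inj[OF d]
  proof eventually_elim
    case (elim x)
    define a where "a = act c x"
    have a: "D x < N" "D a = 0" using elim(1) by (auto simp: a_def)
    have "\<exists>n. R (D x) n a" using elim(2) unfolding a_def act_def by blast
    then have "R (D x) (LEAST n. R (D x) n a) a" by (rule LeastI_ex)
    then have k: "D (tt (\<kappa> (D x) a) a) = D x" "c (tt (\<kappa> (D x) a) a) + \<kappa> (D x) a = 0"
      using a unfolding R_def \<kappa>_def by auto
    \<comment> \<open>the point found has the number and the class of x, so it is x\<close>
    define m where "m = \<kappa> (D x) a + c x"
    have m: "tt (\<kappa> (D x) a) a = tt m x" by (simp add: m_def a_def act_def tt_add)
    have "D (tt m x) = D x" "c (tt m x) + m = c x" using k unfolding m by (simp_all add: m_def)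
    then have "m = 0" using elim(3) by blast
    then have "act (\<kappa> (D x)) a = x" using m by (simp add: act_def tt_0)
    then show ?case unfolding G_def a_def[symmetric] J_def using a(1) by simp
  qed
  obtain K0 :: nat where K0: "card (range J) / \<epsilon> < K0" using reals_Archimedean2 by blast
  show ?thesis
  proof (intro exI[of _ K0] allI impI)
    fix K assume K: "K0 \<le> K"
    have KR: "card (range J) / \<epsilon> < K" using K0 K by (meson le_less_trans less_le_trans of_nat_le_iff)
    moreover have "0 \<le> card (range J) / \<epsilon>" using \<epsilon> by simp
    ultimately have Kpos: "K > 0" by (metis le_less_trans of_nat_0_less_iff)
    have Ke: "card (range J) / K < \<epsilon>" using KR \<epsilon> Kpos by (simp add: field_simps)
    obtain e S where e: "nlc e" "\<And>x. e x < K" "\<And>i. i < K \<Longrightarrow> pr (\<lambda>x. ?A x \<and> e x = i) = pr ?A / K"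
      "finite S" "card S \<le> card (range J)" "\<And>x y. e x = e y \<Longrightarrow> J x \<noteq> J y \<Longrightarrow> e x \<in> S"
      by (rule equal_parts[OF A J_nlc J_fin Kpos]) (rule that; assumption)
    obtain b where b: "division ?A K e b" by (rule division_of_equal_parts[OF A e(1) Kpos e(2,3)])
    let ?S = "{n. n div N \<in> S}"
    let ?E = "\<lambda>x. D x = 0 \<and> e x \<in> S"
    have nE: "nlc ?E" by (rule nlc_conj[OF A nlc_comp[OF e(1)]])
    have "pr ?E \<le> card S * (1 / N / K)"
    proof -
      have "pr ?E = prob (\<Union>i\<in>S. {x. ?A x \<and> e x = i})" by (rule arg_cong[where f = prob]) auto
      also have "\<dots> \<le> (\<Sum>i\<in>S. pr (\<lambda>x. ?A x \<and> e x = i))"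
        by (rule finite_measure_subadditive_finite[OF e(4)])
           (auto intro!: nlc_sets nlc_conj A nlc_eq[OF e(1) nlc_const])
      also have "\<dots> \<le> (\<Sum>i\<in>S. 1 / N / K)"
      proof (rule sum_mono)
        fix i
        show "pr (\<lambda>x. ?A x \<and> e x = i) \<le> 1 / N / K"
        proof (cases "i < K")
          case True
          then show ?thesis using e(3) pr_base[OF d] by simp
        next
          case False
          then have "{x. ?A x \<and> e x = i} = {}" using e(2) by auto
          then show ?thesis by (simp only: measure_empty) simp
        qed
      qed
      finally show ?thesis by simp
    qed
    have "pr (\<lambda>x. D x + N * e (act c x) \<in> ?S) = pr (\<lambda>x. True \<and> ?E (act c x))"
    proof (rule pr_cong)
      show "nlc (\<lambda>x. D x + N * e (act c x) \<in> ?S)"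
        by (rule nlc_comp[where h = "\<lambda>n. n \<in> ?S"], rule nlc_plus[OF nD nlc_comp[OF nlc_act[OF e(1) nc]]])
      show "nlc (\<lambda>x. True \<and> ?E (act c x))" by (rule nlc_conj[OF nlc_const nlc_act[OF nE nc]])
      show "eventually (\<lambda>x. (D x + N * e (act c x) \<in> ?S) = (True \<and> ?E (act c x))) NE"
        using division_base[OF d] by eventually_elim auto
    qed
    also have "\<dots> \<le> N * pr ?E" by (rule pr_pull_back_le[OF nlc_const d nE])
    also have "\<dots> \<le> N * (card S * (1 / N / K))" using \<open>pr ?E \<le> _\<close> by (rule mult_left_mono) simp
    also have "\<dots> = card S / K" using N by simp
    also have "\<dots> \<le> card (range J) / K" using e(5) by (simp add: divide_right_mono)
    also note Ke
    finally have bad: "pr (\<lambda>x. D x + N * e (act c x) \<in> ?S) < \<epsilon>" .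
    have sep: "w x = w y" if "G x" "G y" "D x + N * e (act c x) = D y + N * e (act c y)"
      "D x + N * e (act c x) \<notin> ?S" for x y
    proof -
      have lt: "D x < N" "D y < N" using that(1,2) by (auto simp: G_def)
      have "(D x + N * e (act c x)) mod N = (D y + N * e (act c y)) mod N"
        "(D x + N * e (act c x)) div N = (D y + N * e (act c y)) div N" using that(3) by simp_all
      then have "D x = D y" "e (act c x) = e (act c y)" using lt by simp_all
      moreover have "e (act c x) \<notin> S" using that(4) lt by simp
      ultimately have "J (act c x) = J (act c y)" using e(6) by blast
      then show ?thesis using that(1,2) \<open>D x = D y\<close> by (simp add: G_def)
    qed
    show "?goal K"
      by (rule exI[of _ e], rule exI[of _ b], rule exI[of _ ?S], rule exI[of _ G],
          intro conjI b bad G) (use sep in blast)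
  qed
qed

section \<open>Blocks of returns to a set\<close>


lemma equal_partition:
  assumes A: "nlc A" and K: "K > 0"
  obtains e :: "'a \<Rightarrow> nat" where "nlc e" "\<And>x. e x < K"
    "\<And>i. i < K \<Longrightarrow> pr (\<lambda>x. A x \<and> e x = i) = pr A / K"
proof -
  have "finite (range (\<lambda>x::'a. ()))" by simp
  from A nlc_const this K show thesis
    by (rule equal_parts) (rule that)
qed

context
  fixes A :: "'a \<Rightarrow> bool"
  assumes A_nlc: "nlc A" and A_pos: "pr A > 0"
begin

text \<open>The first return time to \<open>A\<close>, forwards for \<open>s = 1\<close> and backwards for \<open>s = - 1\<close>.\<close>
definition ret :: "int \<Rightarrow> 'a \<Rightarrow> int" where
  "ret s x = s * int (LEAST n. 1 \<le> n \<and> A (tt (s * int n) x))"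

definition recurrent :: "'a \<Rightarrow> bool" where
  "recurrent x \<longleftrightarrow> (\<forall>k. \<forall>s\<in>{1, -1}. \<exists>n\<ge>1. A (tt (s * int n) (tt k x)))"

lemma recurrent_NE: "eventually recurrent NE"
proof -
  have "eventually (\<lambda>x. \<exists>n\<ge>1. A (tt (s * int n) x)) NE" if "s \<in> {1, -1}" for s
    using recurrence_direction[OF A_nlc A_pos, of s] that by (auto elim!: eventually_mono)
  then have "eventually (\<lambda>x. \<forall>s\<in>{1, -1}. \<exists>n\<ge>1. A (tt (s * int n) x)) NE"
    by (intro eventually_ball_finite) auto
  from NE_orbit[OF this] show ?thesis unfolding recurrent_def .
qed

lemma recurrent_tt: "recurrent x \<Longrightarrow> recurrent (tt k x)"
  unfolding recurrent_def by (metis tt_add)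

lemma recurrent_act: "recurrent x \<Longrightarrow> recurrent (act f x)"
  unfolding act_def by (rule recurrent_tt)

lemma ret_nlc: "s \<in> {1, -1} \<Longrightarrow> nlc (ret s)"
  unfolding ret_def
proof (rule nlc_comp[where h = "\<lambda>n. s * int n"], rule nlc_Least)
  show "nlc (\<lambda>x. 1 \<le> n \<and> A (tt (s * int n) x))" for n
    by (rule nlc_conj[OF nlc_const nlc_shift[OF A_nlc]])
  show "s \<in> {1, -1} \<Longrightarrow> eventually (\<lambda>x. \<exists>n. 1 \<le> n \<and> A (tt (s * int n) x)) NE"
    using recurrence_direction[OF A_nlc A_pos, of s] by (auto elim!: eventually_mono)
qed

lemma ret_props:
  assumes "recurrent x" "s \<in> {1, -1}"
  obtains n where "ret s x = s * int n" "1 \<le> n" "A (tt (s * int n) x)"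
    "\<And>m. 1 \<le> m \<Longrightarrow> m < n \<Longrightarrow> \<not> A (tt (s * int m) x)"
proof -
  let ?n = "LEAST n. 1 \<le> n \<and> A (tt (s * int n) x)"
  have "\<exists>n\<ge>1. A (tt (s * int n) (tt 0 x))" using assms unfolding recurrent_def by blast
  then have "1 \<le> ?n \<and> A (tt (s * int ?n) x)" unfolding tt_0 by (rule LeastI_ex)
  moreover have "\<not> A (tt (s * int m) x)" if "1 \<le> m" "m < ?n" for m
    using not_less_Least[OF that(2)] that(1) by blast
  ultimately show thesis by (intro that[of ?n]) (auto simp: ret_def)
qed

text \<open>Between \<open>x\<close> and the next visit to \<open>A\<close> there is no other visit, so seen from there \<open>x\<close> is the previous one.\<close>
lemma ret_cancel:
  assumes "recurrent x" "s \<in> {1, -1}" "A x"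
  shows "kcomp (ret (- s)) (ret s) x = 0"
proof -
  obtain n where n: "ret s x = s * int n" "1 \<le> n" "A (tt (s * int n) x)"
    "\<And>m. 1 \<le> m \<Longrightarrow> m < n \<Longrightarrow> \<not> A (tt (s * int m) x)" using ret_props[OF assms(1,2)] by metis
  define y where "y = tt (s * int n) x"
  have reverse: "tt (- s * int m) y = tt (s * int (n - m)) x" if "m \<le> n" for m
    using that by (simp add: y_def tt_add[symmetric] of_nat_diff algebra_simps)
  have "(LEAST m. 1 \<le> m \<and> A (tt (- s * int m) y)) = n"
  proof (rule Least_equality)
    show "1 \<le> n \<and> A (tt (- s * int n) y)" using n(2) assms(3) reverse[of n] by (simp add: tt_0)
    fix m assume m: "1 \<le> m \<and> A (tt (- s * int m) y)"
    show "n \<le> m"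
    proof (rule ccontr)
      assume "\<not> n \<le> m"
      then show False using m reverse[of m] n(4)[of "n - m"] by simp
    qed
  qed
  then have "ret (- s) y = - s * int n" by (simp add: ret_def)
  then show ?thesis using n(1) by (simp add: kcomp_def act_def y_def)
qed

text \<open>The time of the \<open>j\<close>th return to \<open>A\<close> in direction \<open>s\<close>.\<close>
primrec pw :: "int \<Rightarrow> nat \<Rightarrow> 'a \<Rightarrow> int" where
  "pw s 0 = (\<lambda>x. 0)"
| "pw s (Suc j) = kcomp (ret s) (pw s j)"

lemma kcomp_assoc: "kcomp f (kcomp g h) = kcomp (kcomp f g) h"
  by (rule ext) (simp add: kcomp_def act_kcomp[unfolded kcomp_def[abs_def]] act_def tt_add)

lemma kcomp_zero: "kcomp f (\<lambda>x. 0) = f" "kcomp (\<lambda>x. 0) f = f"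
  by (rule ext; simp add: kcomp_def act_def tt_0)+

lemma pw_add: "pw s (i + j) = kcomp (pw s i) (pw s j)"
  by (induction i) (simp_all add: kcomp_zero kcomp_assoc)

lemma pw_Suc': "pw s (Suc j) = kcomp (pw s j) (ret s)"
  using pw_add[of s j 1] by (simp add: kcomp_zero)

lemma pw_nlc: "s \<in> {1, -1} \<Longrightarrow> nlc (pw s j)"
  by (induction j) (auto intro: nlc_kcomp ret_nlc)

lemma act_pw_A:
  assumes "recurrent x" "s \<in> {1, -1}" "A x"
  shows "A (act (pw s j) x)"
proof (cases j)
  case 0
  then show ?thesis using assms(3) by (simp add: act_def tt_0)
next
  case (Suc i)
  have "recurrent (act (pw s i) x)" using assms(1) by (rule recurrent_act)
  from ret_props[OF this assms(2)] obtain n where "ret s (act (pw s i) x) = s * int n"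
    "A (tt (s * int n) (act (pw s i) x))" by metis
  then show ?thesis unfolding Suc pw.simps act_kcomp by (simp add: act_def)
qed

lemma pw_cancel:
  assumes "recurrent x" "s \<in> {1, -1}" "A x"
  shows "kcomp (pw (- s) j) (pw s j) x = 0"
proof (induction j)
  case 0
  then show ?case by (simp add: kcomp_def)
next
  case (Suc j)
  let ?y = "act (pw s j) x"
  have y: "kcomp (ret (- s)) (ret s) ?y = 0"
    by (rule ret_cancel[OF recurrent_act[OF assms(1)] assms(2) act_pw_A[OF assms]])
  have "kcomp (pw (- s) (Suc j)) (pw s (Suc j)) x = kcomp (kcomp (pw (- s) j) (kcomp (ret (- s)) (ret s))) (pw s j) x"
  proof -
    have 1: "pw (- s) (Suc j) = kcomp (pw (- s) j) (ret (- s))" by (rule pw_Suc')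
    have 2: "pw s (Suc j) = kcomp (ret s) (pw s j)" by (rule pw.simps)
    show ?thesis unfolding 1 2 by (simp only: kcomp_assoc)
  qed
  also have "\<dots> = pw (- s) j (act (kcomp (ret (- s)) (ret s)) ?y) + kcomp (ret (- s)) (ret s) ?y + pw s j x"
    by (simp add: kcomp_def[of "kcomp _ _"] kcomp_def[of "pw _ _"])
  also have "\<dots> = kcomp (pw (- s) j) (pw s j) x"
    using y by (simp add: kcomp_def[of "pw _ _"] act_def[of "kcomp _ _"] tt_0)
  finally show ?case using Suc by simp
qed

lemma act_pw_cancel:
  assumes "recurrent x" "s \<in> {1, -1}" "A x"
  shows "act (pw (- s) j) (act (pw s j) x) = x" "pw (- s) j (act (pw s j) x) = - pw s j x"
  using pw_cancel[OF assms, of j] act_kcomp[of "pw (- s) j" "pw s j" x]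
  by (simp_all add: act_def[of "kcomp _ _"] tt_0) (simp add: kcomp_def)

text \<open>Every visit to \<open>A\<close> is a return of some order, which is at most the elapsed time.\<close>
lemma pw_reaches:
  assumes "recurrent x" "s \<in> {1, -1}" "A x" "A (tt (s * int l) x)"
  shows "\<exists>j\<le>l. pw s j x = s * int l"
  using assms
proof (induction l arbitrary: x rule: less_induct)
  case (less l)
  show ?case
  proof (cases "l = 0")
    case False
    obtain n where n: "ret s x = s * int n" "1 \<le> n" "A (tt (s * int n) x)"
      "\<And>m. 1 \<le> m \<Longrightarrow> m < n \<Longrightarrow> \<not> A (tt (s * int m) x)" using ret_props[OF less(2,3)] by metis
    have nl: "n \<le> l" using n(4)[of l] less(5) False by force
    define y where "y = tt (s * int n) x"
    have "tt (s * int (l - n)) y = tt (s * int l) x"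
      using nl by (simp add: y_def tt_add[symmetric] of_nat_diff algebra_simps)
    then have "\<exists>j\<le>l - n. pw s j y = s * int (l - n)"
      using n(2,3) nl less by (intro less.IH) (auto simp: y_def intro: recurrent_tt)
    then obtain j where j: "j \<le> l - n" "pw s j y = s * int (l - n)" by blast
    have "pw s (Suc j) x = s * int l"
      unfolding pw_Suc' kcomp_def act_def n(1) y_def[symmetric] j(2) using nl
      by (simp add: of_nat_diff algebra_simps)
    moreover have "Suc j \<le> l" using j(1) n(2) nl by linarith
    ultimately show ?thesis by blast
  qed (auto intro!: exI[of _ 0])
qed


context
  fixes B :: "'a \<Rightarrow> bool" and K :: nat
  assumes B_nlc: "nlc B" and B_pos: "pr B > 0" and BA: "\<And>x. B x \<Longrightarrow> A x" and K_pos: "K > 0"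
begin

text \<open>\<open>B\<close> is a marker subset of \<open>A\<close>. The visits to \<open>A\<close> since the last visit to \<open>B\<close> are counted by \<open>idx\<close> and
  grouped into blocks of length \<open>K\<close>: \<open>pos\<close> is the position in the block and \<open>start\<close> the time that leads back
  to its first point. A block is complete, and its points are \<open>full\<close>, if \<open>B\<close> is not met before its
  end.\<close>
definition idx :: "'a \<Rightarrow> nat" where
  "idx x = (LEAST j. \<not> A x \<or> B (act (pw (- 1) j) x))"

definition pos :: "'a \<Rightarrow> nat" where
  "pos x = idx x mod K"

definition start :: "'a \<Rightarrow> int" where
  "start x = pw (- 1) (pos x) x"

definition full :: "'a \<Rightarrow> bool" where
  "full x \<longleftrightarrow> A x \<and> (\<forall>m<K. 1 \<le> m \<and> pos x + m < K \<longrightarrow> \<not> B (act (pw 1 m) x))"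

definition marked :: "'a \<Rightarrow> bool" where
  "marked x \<longleftrightarrow> recurrent x \<and> (\<forall>k. \<exists>j. \<not> A (tt k x) \<or> B (act (pw (- 1) j) (tt k x)))"

text \<open>Recurrence to \<open>B\<close> backwards in time, together with \<open>pw_reaches\<close>, shows that \<open>idx\<close> is well defined.\<close>
lemma marked_NE: "eventually marked NE"
proof -
  have "eventually (\<lambda>x. \<exists>j. \<not> A x \<or> B (act (pw (- 1) j) x)) NE"
    using recurrent_NE recurrence_direction[OF B_nlc B_pos, of "- 1", simplified]
  proof eventually_elim
    case (elim x)
    show ?case
    proof (cases "A x")
      case True
      from elim(2) obtain l where l: "B (tt (- int l) x)" by blast
      then have "A (tt (- 1 * int l) x)" using BA by simp
      from pw_reaches[OF elim(1) _ True this] obtain j where "pw (- 1) j x = - 1 * int l" by auto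
      then show ?thesis using l by (intro exI[of _ j]) (simp add: act_def)
    qed simp
  qed
  from NE_orbit[OF this] recurrent_NE show ?thesis
    unfolding marked_def by eventually_elim blast
qed

lemma marked_recurrent: "marked x \<Longrightarrow> recurrent x"
  by (simp add: marked_def)

lemma idx_props:
  assumes "marked x" "A x"
  shows "B (act (pw (- 1) (idx x)) x)" "j < idx x \<Longrightarrow> \<not> B (act (pw (- 1) j) x)"
proof -
  have "\<exists>j. \<not> A (tt 0 x) \<or> B (act (pw (- 1) j) (tt 0 x))" using assms(1) unfolding marked_def by blast
  then have "\<not> A x \<or> B (act (pw (- 1) (idx x)) x)" unfolding tt_0 idx_def by (rule LeastI_ex)
  then show "B (act (pw (- 1) (idx x)) x)" using assms(2) by blast
  show "\<not> B (act (pw (- 1) j) x)" if "j < idx x"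
    using not_less_Least[of j "\<lambda>j. \<not> A x \<or> B (act (pw (- 1) j) x)"] that unfolding idx_def by blast
qed

lemma idx_eqI:
  assumes "A x" "B (act (pw (- 1) n) x)" "\<And>j. j < n \<Longrightarrow> \<not> B (act (pw (- 1) j) x)"
  shows "idx x = n"
  unfolding idx_def
proof (rule Least_equality)
  show "\<not> A x \<or> B (act (pw (- 1) n) x)" using assms(2) by blast
  show "n \<le> j" if "\<not> A x \<or> B (act (pw (- 1) j) x)" for j
    using assms(1,3) that by (meson leI)
qed

lemma idx_nlc: "nlc idx"
  unfolding idx_def
proof (rule nlc_Least)
  show "nlc (\<lambda>x. \<not> A x \<or> B (act (pw (- 1) n) x))" for n
    by (intro nlc_disj nlc_not A_nlc nlc_act[OF B_nlc pw_nlc]) simp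
  show "eventually (\<lambda>x. \<exists>n. \<not> A x \<or> B (act (pw (- 1) n) x)) NE"
    using marked_NE
  proof eventually_elim
    case (elim x)
    have "\<exists>j. \<not> A (tt 0 x) \<or> B (act (pw (- 1) j) (tt 0 x))" using elim unfolding marked_def by blast
    then show ?case unfolding tt_0 .
  qed
qed

lemma pos_nlc: "nlc pos"
  unfolding pos_def by (rule nlc_comp[OF idx_nlc])

lemma start_nlc: "nlc start"
  unfolding start_def by (rule nlc_select[OF pos_nlc pw_nlc]) simp

lemma full_nlc: "nlc full"
  unfolding full_def
proof (intro nlc_conj[OF A_nlc] nlc_all_less)
  fix m assume "m < K"
  show "nlc (\<lambda>x. 1 \<le> m \<and> pos x + m < K \<longrightarrow> \<not> B (act (pw 1 m) x))"
    by (intro nlc_imp nlc_conj nlc_const nlc_comp[OF pos_nlc, of "\<lambda>n. n + m < K"] nlc_not nlc_act[OF B_nlc pw_nlc]) simp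
qed

lemma pw_back_fwd:
  assumes "recurrent x" "A x" "s \<in> {1, - 1}"
  shows "act (pw (- s) (j + n)) (act (pw s n) x) = act (pw (- s) j) x"
  unfolding pw_add act_kcomp act_pw_cancel(1)[OF assms(1,3,2)] ..

lemma idx_forward:
  assumes x: "marked x" "A x" and noB: "\<And>m. 1 \<le> m \<Longrightarrow> m \<le> n \<Longrightarrow> \<not> B (act (pw 1 m) x)"
  shows "idx (act (pw 1 n) x) = idx x + n"
proof (rule idx_eqI)
  note rx = marked_recurrent[OF x(1)]
  show "A (act (pw 1 n) x)" by (rule act_pw_A[OF rx _ x(2)]) simp
  have shift: "act (pw (- 1) (j + n)) (act (pw 1 n) x) = act (pw (- 1) j) x" for j
    using pw_back_fwd[OF rx x(2), of 1 j n] by simp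
  show "B (act (pw (- 1) (idx x + n)) (act (pw 1 n) x))"
    unfolding shift by (rule idx_props(1)[OF x])
  fix j assume j: "j < idx x + n"
  show "\<not> B (act (pw (- 1) j) (act (pw 1 n) x))"
  proof (cases "j < n")
    case True
    have "pw 1 n = kcomp (pw 1 j) (pw 1 (n - j))" using True pw_add[of 1 j "n - j"] by simp
    then have "act (pw 1 n) x = act (pw 1 j) (act (pw 1 (n - j)) x)" by (simp only: act_kcomp)
    moreover have "act (pw (- 1) j) (act (pw 1 j) (act (pw 1 (n - j)) x)) = act (pw 1 (n - j)) x"
      by (rule act_pw_cancel(1)[OF recurrent_act[OF rx] _ act_pw_A[OF rx _ x(2)]]) simp_all
    ultimately have "act (pw (- 1) j) (act (pw 1 n) x) = act (pw 1 (n - j)) x" by simp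
    then show ?thesis using noB[of "n - j"] True by simp
  next
    case False
    then have "act (pw (- 1) j) (act (pw 1 n) x) = act (pw (- 1) (j - n)) x" using shift[of "j - n"] by simp
    then show ?thesis using idx_props(2)[OF x, of "j - n"] False j by simp
  qed
qed

lemma idx_backward:
  assumes x: "marked x" "A x" and n: "n \<le> idx x"
  shows "idx (act (pw (- 1) n) x) = idx x - n"
proof (rule idx_eqI)
  note rx = marked_recurrent[OF x(1)]
  show "A (act (pw (- 1) n) x)" by (rule act_pw_A[OF rx _ x(2)]) simp
  have shift: "act (pw (- 1) j) (act (pw (- 1) n) x) = act (pw (- 1) (j + n)) x" for j
    by (simp only: pw_add act_kcomp)
  show "B (act (pw (- 1) (idx x - n)) (act (pw (- 1) n) x))"
    unfolding shift using idx_props(1)[OF x] n by simp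
  fix j assume j: "j < idx x - n"
  show "\<not> B (act (pw (- 1) j) (act (pw (- 1) n) x))"
    unfolding shift using idx_props(2)[OF x, of "j + n"] j by simp
qed

lemma full_forward:
  assumes x: "marked x" "full x" and n: "pos x + n < K"
  shows "full (act (pw 1 n) x)" "pos (act (pw 1 n) x) = pos x + n"
    "start (act (pw 1 n) x) + pw 1 n x = start x"
proof -
  note rx = marked_recurrent[OF x(1)]
  have Ax: "A x" and noB: "\<And>m. 1 \<le> m \<Longrightarrow> pos x + m < K \<Longrightarrow> \<not> B (act (pw 1 m) x)"
    using x(2) by (auto simp: full_def)
  define y where "y = act (pw 1 n) x"
  have idx: "idx y = idx x + n" unfolding y_def
    by (rule idx_forward[OF x(1) Ax]) (use noB n in simp)
  have "pos y = (pos x + n) mod K" unfolding pos_def idx by (rule mod_add_left_eq[symmetric])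
  then show pos: "pos (act (pw 1 n) x) = pos x + n" using n by (simp add: y_def)
  have Ay: "A (act (pw 1 n) x)" by (rule act_pw_A[OF rx _ Ax]) simp
  have shift: "act (pw 1 m) (act (pw 1 n) x) = act (pw 1 (m + n)) x" for m
    by (simp only: pw_add act_kcomp)
  show "full (act (pw 1 n) x)" unfolding full_def pos shift
  proof (intro conjI Ay allI impI)
    fix m assume "m < K" and m: "1 \<le> m \<and> pos x + n + m < K"
    show "\<not> B (act (pw 1 (m + n)) x)" by (rule noB) (use m in simp_all)
  qed
  have c: "act (pw (- 1) n) y = x" "pw (- 1) n y = - pw 1 n x"
    using act_pw_cancel[OF rx _ Ax, of 1 n] by (simp_all add: y_def)
  have "start y = pw (- 1) (pos x + n) y" unfolding start_def pos[folded y_def] ..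
  also have "\<dots> = pw (- 1) (pos x) x + pw (- 1) n y" unfolding pw_add kcomp_def c(1) ..
  finally show "start (act (pw 1 n) x) + pw 1 n x = start x"
    unfolding y_def[symmetric] c(2) by (simp add: start_def)
qed

lemma full_backward:
  assumes x: "marked x" "full x" and n: "n \<le> pos x"
  shows "full (act (pw (- 1) n) x)" "pos (act (pw (- 1) n) x) = pos x - n"
    "start (act (pw (- 1) n) x) + pw (- 1) n x = start x"
proof -
  note rx = marked_recurrent[OF x(1)]
  have Ax: "A x" and noB: "\<And>m. 1 \<le> m \<Longrightarrow> pos x + m < K \<Longrightarrow> \<not> B (act (pw 1 m) x)"
    using x(2) by (auto simp: full_def)
  have ni: "n \<le> idx x" using n mod_less_eq_dividend[of "idx x" K] unfolding pos_def by (rule order_trans)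
  define y where "y = act (pw (- 1) n) x"
  have idx: "idx y = idx x - n" unfolding y_def by (rule idx_backward[OF x(1) Ax ni])
  have posK: "pos x < K" unfolding pos_def using K_pos by simp
  have "idx x = pos x + K * (idx x div K)" unfolding pos_def by simp
  then have "idx x - n = (pos x - n) + K * (idx x div K)" using n by linarith
  then have "pos y = (pos x - n) mod K" unfolding pos_def[of y] idx by simp
  also have "\<dots> = pos x - n" using posK by simp
  finally have pos_y: "pos y = pos x - n" .
  then show pos: "pos (act (pw (- 1) n) x) = pos x - n" by (simp add: y_def)
  have Ay: "A y" unfolding y_def by (rule act_pw_A[OF rx _ Ax]) simp
  have ry: "recurrent y" unfolding y_def by (rule recurrent_act[OF rx])
  have c: "act (pw 1 n) y = x"
    using act_pw_cancel(1)[OF rx _ Ax, of "- 1" n] by (simp add: y_def)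
  show "full (act (pw (- 1) n) x)" unfolding y_def[symmetric] full_def pos_y
  proof (intro conjI Ay allI impI)
    fix m assume "m < K" and m: "1 \<le> m \<and> pos x - n + m < K"
    show "\<not> B (act (pw 1 m) y)"
    proof (cases "m \<le> n")
      case True
      have "pw (- 1) n = kcomp (pw (- 1) m) (pw (- 1) (n - m))" using True pw_add[of "- 1" m "n - m"] by simp
      then have "y = act (pw (- 1) m) (act (pw (- 1) (n - m)) x)" by (simp only: y_def act_kcomp)
      moreover have "act (pw (- (- 1)) m) (act (pw (- 1) m) (act (pw (- 1) (n - m)) x)) = act (pw (- 1) (n - m)) x"
        by (rule act_pw_cancel(1)[OF recurrent_act[OF rx] _ act_pw_A[OF rx _ Ax]]) simp_all
      ultimately have "act (pw 1 m) y = act (pw (- 1) (n - m)) x" by simp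
      moreover have "n - m < idx x" using True m ni by linarith
      ultimately show ?thesis using idx_props(2)[OF x(1) Ax] by simp
    next
      case False
      have "act (pw 1 m) y = act (pw 1 (m - n)) (act (pw 1 n) y)"
        using False pw_add[of 1 "m - n" n] by (simp add: act_kcomp[symmetric])
      moreover have "1 \<le> m - n" "pos x + (m - n) < K" using False m n by linarith+
      ultimately show ?thesis using noB[of "m - n"] unfolding c by simp
    qed
  qed
  have "pw (- 1) (pos x) x = pw (- 1) ((pos x - n) + n) x" using n by simp
  also have "\<dots> = pw (- 1) (pos x - n) y + pw (- 1) n x" unfolding pw_add kcomp_def y_def ..
  finally show "start (act (pw (- 1) n) x) + pw (- 1) n x = start x"
    unfolding y_def[symmetric] start_def pos_y by simp
qed

text \<open>If a point is at least \<open>\<bar>l\<bar>\<close> positions away from both ends of its block, then a visit to \<open>A\<close> at time \<open>l\<close> lies in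
  the same block, because there are at most \<open>\<bar>l\<bar>\<close> visits in between.\<close>
lemma full_near:
  assumes x: "marked x" "full x" and y: "A (tt l x)" and l: "\<bar>l\<bar> \<le> int (pos x)" "int (pos x) + \<bar>l\<bar> < int K"
  shows "full (tt l x)" "start (tt l x) + l = start x"
proof -
  note rx = marked_recurrent[OF x(1)]
  have Ax: "A x" using x(2) by (simp add: full_def)
  have "full (tt l x) \<and> start (tt l x) + l = start x"
  proof (cases "l \<ge> 0")
    case True
    have "A (tt (1 * int (nat l)) x)" using y True by simp
    from pw_reaches[OF rx _ Ax this] obtain j where j: "j \<le> nat l" "pw 1 j x = l" using True by auto
    then have "act (pw 1 j) x = tt l x" by (simp add: act_def)
    moreover have "pos x + j < K" using j(1) l(2) True by linarith
    ultimately show ?thesis using full_forward[OF x, of j] j(2) by simp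
  next
    case False
    have "A (tt (- 1 * int (nat (- l))) x)" using y False by simp
    from pw_reaches[OF rx _ Ax this] obtain j where j: "j \<le> nat (- l)" "pw (- 1) j x = l" using False by auto
    then have "act (pw (- 1) j) x = tt l x" by (simp add: act_def)
    moreover have "j \<le> pos x" using j(1) l(1) False by linarith
    ultimately show ?thesis using full_backward[OF x, of j] j(2) by simp
  qed
  then show "full (tt l x)" "start (tt l x) + l = start x" by blast+
qed

lemma full_division: "division full K pos start"
  unfolding division_def
proof (intro conjI pos_nlc start_nlc)
  have posK: "pos x < K" for x unfolding pos_def using K_pos by simp
  show "eventually (\<lambda>x. full x \<longrightarrow> pos x < K \<and> full (act start x) \<and> pos (act start x) = 0 \<and> (pos x = 0 \<longrightarrow> start x = 0)) NE"
    using marked_NE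
  proof eventually_elim
    case (elim x)
    have a: "act start x = act (pw (- 1) (pos x)) x" by (simp add: act_def start_def)
    show ?case
    proof
      assume x: "full x"
      show "pos x < K \<and> full (act start x) \<and> pos (act start x) = 0 \<and> (pos x = 0 \<longrightarrow> start x = 0)"
        unfolding a using full_backward[OF elim x order_refl] posK by (simp add: start_def)
    qed
  qed
  show "eventually (\<lambda>x. full x \<longrightarrow> (\<forall>i<K. \<exists>k. full (tt k x) \<and> pos (tt k x) = i \<and> start (tt k x) + k = start x)) NE"
    using marked_NE
  proof eventually_elim
    case (elim x)
    show ?case
    proof (intro impI allI)
      fix i assume x: "full x" and i: "i < K"
      show "\<exists>k. full (tt k x) \<and> pos (tt k x) = i \<and> start (tt k x) + k = start x"
      proof (cases "pos x \<le> i")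
        case True
        then have "pos x + (i - pos x) < K" using i by simp
        from full_forward[OF elim x this] show ?thesis using True
          by (intro exI[of _ "pw 1 (i - pos x) x"]) (simp add: act_def)
      next
        case False
        then have "pos x - i \<le> pos x" by simp
        from full_backward[OF elim x this] show ?thesis using False
          by (intro exI[of _ "pw (- 1) (pos x - i) x"]) (simp add: act_def)
      qed
    qed
  qed
  show "eventually (\<lambda>x. full x \<longrightarrow> (\<forall>k. full (tt k x) \<and> pos (tt k x) = pos x \<and> start (tt k x) + k = start x \<longrightarrow> k = 0)) NE"
    using marked_NE
  proof eventually_elim
    case (elim x)
    show ?case
    proof (intro impI allI)
      fix k assume x: "full x" and k: "full (tt k x) \<and> pos (tt k x) = pos x \<and> start (tt k x) + k = start x"
      have *: "pw 1 (pos y) (act start y) = - start y" if "full y" "recurrent y" for y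
      proof -
        have "A y" using that(1) by (simp add: full_def)
        then have "pw (- (- 1)) (pos y) (act (pw (- 1) (pos y)) y) = - pw (- 1) (pos y) y"
          by (intro act_pw_cancel(2) that(2)) simp_all
        then show ?thesis by (simp add: start_def act_def)
      qed
      have "act start (tt k x) = tt (start (tt k x) + k) x" by (simp add: act_def tt_add)
      then have "act start (tt k x) = act start x" using k by (simp add: act_def)
      then have "start (tt k x) = start x"
        using *[OF x marked_recurrent[OF elim]] *[OF _ recurrent_tt[OF marked_recurrent[OF elim]], of k] k by simp
      then show "k = 0" using k by simp
    qed
  qed
qed

text \<open>A block is incomplete only if one of the next \<open>K\<close> visits to \<open>A\<close> is in \<open>B\<close>.\<close>
lemma not_full_measure: "pr (\<lambda>x. A x \<and> \<not> full x) \<le> K * pr B"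
proof -
  let ?E = "\<lambda>m x. A x \<and> B (act (pw 1 m) x)"
  have E: "nlc (?E m)" for m by (intro nlc_conj A_nlc nlc_act[OF B_nlc pw_nlc]) simp
  have "pr (\<lambda>x. A x \<and> \<not> full x) \<le> prob (\<Union>m\<in>{..<K}. {x. ?E m x})"
  proof (rule finite_measure_mono)
    show "{x. A x \<and> \<not> full x} \<subseteq> (\<Union>m\<in>{..<K}. {x. ?E m x})" by (auto simp: full_def)
    show "(\<Union>m\<in>{..<K}. {x. ?E m x}) \<in> sets M" by (intro sets.finite_UN nlc_sets E) simp
  qed
  also have "\<dots> \<le> (\<Sum>m<K. pr (?E m))"
    by (rule finite_measure_subadditive_finite) (auto intro!: nlc_sets E)
  also have "\<dots> \<le> (\<Sum>m<K. pr B)"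
  proof (rule sum_mono, rule pr_act_le[OF A_nlc pw_nlc B_nlc])
    fix m
    show "injects A (pw 1 m)"
      using recurrent_NE
    proof eventually_elim
      case (elim x)
      show ?case
      proof (intro impI allI)
        fix k assume x: "A x" and k: "A (tt k x) \<and> pw 1 m (tt k x) + k = pw 1 m x"
        have "act (pw 1 m) (tt k x) = tt (pw 1 m (tt k x) + k) x" by (simp add: act_def tt_add)
        then have eq: "act (pw 1 m) (tt k x) = act (pw 1 m) x" using k by (simp add: act_def)
        have "pw (- 1) m (act (pw 1 m) x) = - pw 1 m x"
          using act_pw_cancel(2)[OF elim _ x, of 1] by simp
        moreover have "pw (- 1) m (act (pw 1 m) (tt k x)) = - pw 1 m (tt k x)"
          using act_pw_cancel(2)[OF recurrent_tt[OF elim] _ conjunct1[OF k], of 1] by simp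
        ultimately show "k = 0" using k eq by simp
      qed
    qed
  qed simp
  finally show ?thesis by simp
qed

end

text \<open>The role of the Rokhlin lemma. A marker set of measure \<open>pr A / L\<close> with \<open>L\<close> large compared with \<open>K / \<delta>\<close> leaves at
  most \<open>\<delta>\<close> outside complete blocks.\<close>
lemma block_division:
  assumes K: "K > 0" and \<delta>: "\<delta> > (0::real)"
  obtains C e b where "nlc C" "\<And>x. C x \<Longrightarrow> A x" "division C K e b" "pr (\<lambda>x. A x \<and> \<not> C x) \<le> \<delta>"
    "eventually (\<lambda>x. \<forall>l. C x \<and> A (tt l x) \<and> \<bar>l\<bar> \<le> int (e x) \<and> int (e x) + \<bar>l\<bar> < int K \<longrightarrow>
       C (tt l x) \<and> b (tt l x) + l = b x) NE"
proof -
  \<comment> \<open>the marker set is one of L equal parts of A\<close>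
  obtain L :: nat where L: "real K / \<delta> < L" using reals_Archimedean2 by blast
  have "0 \<le> real K / \<delta>" using \<delta> by simp
  then have L0: "0 < L" using L by linarith
  have KL: "real K / real L < \<delta>" using L L0 \<delta> by (simp add: field_simps)
  obtain p :: "'a \<Rightarrow> nat" where p: "nlc p" "\<And>x. p x < L" "\<And>i. i < L \<Longrightarrow> pr (\<lambda>x. A x \<and> p x = i) = pr A / L"
    by (rule equal_partition[OF A_nlc L0]) (rule that; assumption)
  let ?B = "\<lambda>x. A x \<and> p x = 0"
  have B: "nlc ?B" by (rule nlc_conj[OF A_nlc nlc_eq[OF p(1) nlc_const]])
  have prB: "pr ?B = pr A / L" using p(3)[OF L0] .
  then have B_pos: "pr ?B > 0" using A_pos L0 by simp
  show thesis
  proof (rule that)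
    show "nlc (full ?B K)" by (rule full_nlc[OF B B_pos _ K]) blast
    show "A x" if "full ?B K x" for x using that full_def[OF B B_pos _ K] by blast
    show "division (full ?B K) K (pos ?B K) (start ?B K)" by (rule full_division[OF B B_pos _ K]) blast
    have "pr (\<lambda>x. A x \<and> \<not> full ?B K x) \<le> K * pr ?B" by (rule not_full_measure[OF B B_pos _ K]) blast
    also have "\<dots> = (K / L) * pr A" using prB by simp
    also have "\<dots> \<le> (K / L) * 1" by (intro mult_left_mono) auto
    also have "\<dots> \<le> \<delta>" using KL by simp
    finally show "pr (\<lambda>x. A x \<and> \<not> full ?B K x) \<le> \<delta>" .
    have near: "full ?B K (tt l x) \<and> start ?B K (tt l x) + l = start ?B K x"
      if "marked ?B x" "full ?B K x" "A (tt l x)" "\<bar>l\<bar> \<le> int (pos ?B K x)" "int (pos ?B K x) + \<bar>l\<bar> < int K" for x l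
      using full_near[OF B B_pos _ K that] by blast
    have mk: "eventually (marked ?B) NE" by (rule marked_NE[OF B B_pos _ K]) blast
    show "eventually (\<lambda>x. \<forall>l. full ?B K x \<and> A (tt l x) \<and> \<bar>l\<bar> \<le> int (pos ?B K x) \<and> int (pos ?B K x) + \<bar>l\<bar> < int K \<longrightarrow>
       full ?B K (tt l x) \<and> start ?B K (tt l x) + l = start ?B K x) NE"
      using mk by eventually_elim (use near in blast)
  qed
qed

end

section \<open>Divisions that capture the dynamics\<close>


lemma pr_tail:
  fixes f :: "'a \<Rightarrow> int"
  assumes f: "nlc f" and \<epsilon>: "\<epsilon> > 0"
  obtains C :: nat where "pr (\<lambda>x. int C < \<bar>f x\<bar>) < \<epsilon>"
proof -
  let ?V = "\<lambda>n::nat. {x. int n < \<bar>f x\<bar>}"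
  have V: "?V n \<in> sets M" for n by (rule nlc_sets[OF nlc_comp[OF f, of "\<lambda>k. int n < \<bar>k\<bar>"]])
  have "decseq ?V" by (auto simp: decseq_def)
  then have "(\<lambda>n. prob (?V n)) \<longlonglongrightarrow> prob (\<Inter>n. ?V n)"
    using V by (intro finite_Lim_measure_decseq) auto
  moreover have "(\<Inter>n. ?V n) = {}"
  proof -
    have "x \<notin> ?V (nat \<bar>f x\<bar>)" for x by simp
    then show ?thesis by blast
  qed
  ultimately have "(\<lambda>n. prob (?V n)) \<longlonglongrightarrow> 0" by simp
  then have "eventually (\<lambda>n. prob (?V n) < \<epsilon>) sequentially" using \<epsilon> by (rule order_tendstoD)
  then show thesis using that by (auto simp: eventually_sequentially)
qed

lemma pr_levels_le:
  assumes A: "nlc A" and d: "division A K e b" and W: "W \<subseteq> {..<K}"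
  shows "pr (\<lambda>x. A x \<and> e x \<in> W) \<le> card W * (pr A / K)"
proof -
  have fin: "finite W" using W by (rule finite_subset) simp
  have "pr (\<lambda>x. A x \<and> e x \<in> W) = prob (\<Union>i\<in>W. {x. A x \<and> e x = i})" by (rule arg_cong[where f = prob]) auto
  also have "\<dots> \<le> (\<Sum>i\<in>W. pr (\<lambda>x. A x \<and> e x = i))"
    by (rule finite_measure_subadditive_finite[OF fin])
       (auto intro!: nlc_sets nlc_conj A nlc_eq[OF division_nlc(1)[OF d] nlc_const])
  also have "\<dots> = (\<Sum>i\<in>W. pr A / K)"
    by (rule sum.cong[OF refl]) (use W in \<open>auto intro!: division_measure[OF A d]\<close>)
  finally show ?thesis by simp
qed

text \<open>Let \<open>a\<close> and \<open>a'\<close> be the points of part \<open>0\<close> that belong to \<open>x\<close> and to \<open>T x\<close>. Except on a set of small measure, they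
  are at most \<open>J = 2 C0 + 1\<close> steps apart, where \<open>C0\<close> bounds most values of \<open>c\<close>. If the blocks are much longer
  than \<open>J\<close>, then most often \<open>a\<close> is not within \<open>J\<close> of an end of its block, and \<open>a'\<close> is in the same block.\<close>
lemma capturing_step:
  assumes d: "division (\<lambda>_. True) N D c" and \<epsilon>: "\<epsilon> > (0::real)"
  shows "\<exists>K0. \<forall>K\<ge>K0. \<exists>e b. division (\<lambda>x. D x = 0) K e b \<and>
    pr (\<lambda>x. kcomp b c x \<noteq> kcomp b c (tt 1 x) + 1) < \<epsilon>"
proof -
  note N = division_pos[OF d]
  have nD: "nlc D" and nc: "nlc c" by (rule division_nlc[OF d])+
  let ?A = "\<lambda>x. D x = 0"
  have A: "nlc ?A" by (rule nlc_eq[OF nD nlc_const])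
  have prA: "pr ?A = 1 / N" by (rule pr_base[OF d])
  have A_pos: "pr ?A > 0" using prA N by simp
  \<comment> \<open>epsilon / 8 each for large values of c at x and at its successor, epsilon / 4 each for the points outside the blocks and near the ends of blocks\<close>
  obtain C0 :: nat where C0: "pr (\<lambda>x. int C0 < \<bar>c x\<bar>) < \<epsilon> / 8"
    using pr_tail[OF nc, of "\<epsilon> / 8"] \<epsilon> by auto
  define J where "J = 2 * C0 + 1"
  obtain K0 :: nat where K0: "8 * real J / \<epsilon> < K0" using reals_Archimedean2 by blast
  show ?thesis
  proof (intro exI[of _ K0] allI impI)
    fix K assume "K0 \<le> K"
    then have KJ: "8 * real J / \<epsilon> < K" using K0 by linarith
    moreover have "0 \<le> 8 * real J / \<epsilon>" using \<epsilon> by simp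
    ultimately have K: "K > 0" by linarith
    have KJ': "2 * real J / K < \<epsilon> / 4" using KJ K \<epsilon> by (simp add: field_simps)
    have \<delta>: "\<epsilon> / (4 * N) > 0" using \<epsilon> N by simp
    obtain C e1 b1 where C: "nlc C" "\<And>x. C x \<Longrightarrow> ?A x" "division C K e1 b1"
      "pr (\<lambda>x. ?A x \<and> \<not> C x) \<le> \<epsilon> / (4 * N)"
      "eventually (\<lambda>x. \<forall>l. C x \<and> ?A (tt l x) \<and> \<bar>l\<bar> \<le> int (e1 x) \<and> int (e1 x) + \<bar>l\<bar> < int K \<longrightarrow>
         C (tt l x) \<and> b1 (tt l x) + l = b1 x) NE"
      by (rule block_division[OF A A_pos K \<delta>]) (rule that; assumption)
    let ?B = "\<lambda>x. ?A x \<and> \<not> C x"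
    have B: "nlc ?B" by (intro nlc_conj A nlc_not C(1))
    obtain e2 :: "'a \<Rightarrow> nat" where e2: "nlc e2" "\<And>x. e2 x < K" "\<And>i. i < K \<Longrightarrow> pr (\<lambda>x. ?B x \<and> e2 x = i) = pr ?B / K"
      by (rule equal_partition[OF B K]) (rule that; assumption)
    obtain b2 where b2: "division ?B K e2 b2" by (rule division_of_equal_parts[OF B e2(1) K e2(2,3)])
    define e where "e x = (if C x then e1 x else e2 x)" for x
    define b where "b x = (if C x then b1 x else b2 x)" for x
    have AC: "(\<lambda>x. C x \<or> ?B x) = ?A" using C(2) by blast
    have "\<not> (C x \<and> ?B x)" for x by blast
    from division_union[OF C(1) B this C(3) b2] have de: "division ?A K e b"
      unfolding AC e_def[abs_def] b_def[abs_def] .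
    have nb: "nlc b" by (rule division_nlc(2)[OF de])
    let ?W = "{i. i < K \<and> (i < J \<or> K \<le> i + J)}"
    let ?E = "\<lambda>x. C x \<and> e1 x \<in> ?W"
    have E: "nlc ?E" by (rule nlc_conj[OF C(1) nlc_comp[OF division_nlc(1)[OF C(3)]]])
    have cardW: "card ?W \<le> 2 * J"
    proof -
      have "card ?W \<le> card ({..<J} \<union> {K - J..<K})" by (intro card_mono) auto
      also have "\<dots> \<le> card {..<J} + card {K - J..<K}" by (rule card_Un_le)
      also have "\<dots> \<le> 2 * J" by simp
      finally show ?thesis .
    qed
    have "pr C \<le> pr ?A" by (rule pr_mono[OF A]) (use C(2) in simp)
    then have "pr C \<le> 1 / N" unfolding prA .
    have prE: "pr ?E \<le> 2 * J * (1 / N / K)"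
    proof -
      have "pr ?E \<le> card ?W * (pr C / K)" by (rule pr_levels_le[OF C(1,3)]) auto
      also have "\<dots> \<le> real (2 * J) * (1 / N / K)"
        using cardW \<open>pr C \<le> 1 / N\<close> by (intro mult_mono divide_right_mono) (simp_all del: of_nat_mult)
      finally show ?thesis by simp
    qed
    let ?P1 = "\<lambda>x. int C0 < \<bar>c x\<bar>"
    let ?P2 = "\<lambda>x. int C0 < \<bar>c (tt 1 x)\<bar>"
    let ?P3 = "\<lambda>x. True \<and> ?B (act c x)"
    let ?P4 = "\<lambda>x. True \<and> ?E (act c x)"
    have nP1: "nlc ?P1" by (rule nlc_comp[OF nc])
    have nP2: "nlc ?P2" by (rule nlc_shift[OF nP1])
    have nP3: "nlc ?P3" by (rule nlc_conj[OF nlc_const nlc_act[OF B nc]])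
    have nP4: "nlc ?P4" by (rule nlc_conj[OF nlc_const nlc_act[OF E nc]])
    have p2: "pr ?P2 = pr ?P1" by (rule pr_shift[OF nP1])
    have p3: "pr ?P3 \<le> \<epsilon> / 4"
    proof -
      have "pr ?P3 \<le> N * pr ?B" by (rule pr_pull_back_le[OF nlc_const d B])
      also have "\<dots> \<le> N * (\<epsilon> / (4 * N))" using C(4) by (rule mult_left_mono) simp
      also have "\<dots> = \<epsilon> / 4" using N by simp
      finally show ?thesis .
    qed
    have p4: "pr ?P4 \<le> 2 * J / K"
    proof -
      have "pr ?P4 \<le> N * pr ?E" by (rule pr_pull_back_le[OF nlc_const d E])
      also have "\<dots> \<le> N * (2 * J * (1 / N / K))" using prE by (rule mult_left_mono) simp
      also have "\<dots> = 2 * J / K" using N by simp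
      finally show ?thesis .
    qed
    let ?bad = "\<lambda>x. kcomp b c x \<noteq> kcomp b c (tt 1 x) + 1"
    have "pr ?bad \<le> pr (\<lambda>x. (?P1 x \<or> ?P2 x) \<or> (?P3 x \<or> ?P4 x))"
    proof (rule pr_mono)
      show "nlc (\<lambda>x. (?P1 x \<or> ?P2 x) \<or> (?P3 x \<or> ?P4 x))"
        by (rule nlc_disj[OF nlc_disj[OF nP1 nP2] nlc_disj[OF nP3 nP4]])
      show "eventually (\<lambda>x. ?bad x \<longrightarrow> (?P1 x \<or> ?P2 x) \<or> (?P3 x \<or> ?P4 x)) NE"
        using NE_orbit[OF division_base[OF d]] NE_orbit[OF C(5)] NE_orbit[OF division_base[OF C(3)]]
      proof eventually_elim
        case (elim x)
        show ?case
        proof (rule impI, rule ccontr)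
          assume bad: "?bad x" and "\<not> ((?P1 x \<or> ?P2 x) \<or> (?P3 x \<or> ?P4 x))"
          then have n: "\<bar>c x\<bar> \<le> int C0" "\<bar>c (tt 1 x)\<bar> \<le> int C0" "\<not> ?B (act c x)" "\<not> ?E (act c x)" by auto
          define a where "a = act c x"
          define l where "l = c (tt 1 x) + 1 - c x"
          have "?A (act c (tt 0 x))" "?A (act c (tt 1 x))" using elim(1) by blast+
          moreover have al: "act c (tt 1 x) = tt l a"
            by (simp add: act_def a_def l_def tt_add[symmetric])
          ultimately have Aa: "?A a" "?A (tt l a)" by (simp_all add: tt_0 a_def)
          have Ca: "C a" using n(3) Aa(1) by (auto simp: a_def)
          have "e1 a < K" using elim(3) Ca unfolding a_def act_def by blast
          then have e1a: "J \<le> e1 a" "e1 a + J < K" using n(4) Ca by (auto simp: a_def)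
          have "\<bar>l\<bar> \<le> int J" using n(1,2) by (simp add: l_def J_def)
          then have "C (tt l a) \<and> b1 (tt l a) + l = b1 a"
            using elim(2) Ca Aa(2) e1a unfolding a_def act_def by force
          then have "b (tt l a) + l = b a" using Ca by (simp add: b_def)
          then have "kcomp b c x = kcomp b c (tt 1 x) + 1"
            unfolding kcomp_def al a_def[symmetric] by (simp add: l_def)
          then show False using bad by blast
        qed
      qed
    qed
    also have "\<dots> \<le> (pr ?P1 + pr ?P2) + (pr ?P3 + pr ?P4)"
      using pr_disj[OF nlc_disj[OF nP1 nP2] nlc_disj[OF nP3 nP4]] pr_disj[OF nP1 nP2] pr_disj[OF nP3 nP4]
      by linarith
    also have "\<dots> < \<epsilon>" using C0 p2 p3 p4 KJ' \<epsilon> by linarith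
    finally have "pr ?bad < \<epsilon>" .
    with de show "\<exists>e b. division ?A K e b \<and> pr (\<lambda>x. kcomp b c x \<noteq> kcomp b c (tt 1 x) + 1) < \<epsilon>" by blast
  qed
qed

section \<open>Towers of divisions and the coding of points\<close>


text \<open>Even steps capture the transformation and odd steps separate points, with errors that tend to \<open>0\<close>.\<close>
definition tower_step where
  "tower_step q n N D c K D' c' \<longleftrightarrow>
     (\<exists>e b. division (\<lambda>x. D x = 0) K e b \<and> D' = (\<lambda>x. D x + N * e (act c x)) \<and> c' = kcomp b c) \<and>
     (if even n then pr (\<lambda>x. c' x \<noteq> c' (tt 1 x) + 1) < (1/2) ^ n
      else \<exists>S G. pr (\<lambda>x. D' x \<in> S) < (1/2) ^ n \<and> eventually G NE \<and>
        (\<forall>x y. G x \<longrightarrow> G y \<longrightarrow> D' x = D' y \<longrightarrow> D' x \<notin> S \<longrightarrow> (\<forall>k<n. q k x = q k y)))"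

lemma tower_step_exists:
  fixes q :: "nat \<Rightarrow> 'a \<Rightarrow> bool"
  assumes q: "\<And>k. nlc (q k)" and d: "division (\<lambda>_. True) N D c"
  shows "\<exists>K0. \<forall>K\<ge>K0. \<exists>D' c'. tower_step q n N D c K D' c'"
proof (cases "even n")
  case True
  have "(1/2::real) ^ n > 0" by simp
  from capturing_step[OF d this] obtain K0 where K0: "\<And>K. K \<ge> K0 \<Longrightarrow> \<exists>e b. division (\<lambda>x. D x = 0) K e b \<and>
    pr (\<lambda>x. kcomp b c x \<noteq> kcomp b c (tt 1 x) + 1) < (1/2) ^ n" by blast
  show ?thesis
  proof (intro exI[of _ K0] allI impI)
    fix K assume "K0 \<le> K"
    then obtain e b where eb: "division (\<lambda>x. D x = 0) K e b"
      "pr (\<lambda>x. kcomp b c x \<noteq> kcomp b c (tt 1 x) + 1) < (1/2) ^ n" using K0 by blast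
    show "\<exists>D' c'. tower_step q n N D c K D' c'"
      by (rule exI[of _ "\<lambda>x. D x + N * e (act c x)"], rule exI[of _ "kcomp b c"])
         (unfold tower_step_def if_P[OF True], use eb in blast)
  qed
next
  case False
  let ?w = "\<lambda>x. map (\<lambda>k. q k x) [0..<n]"
  have w: "nlc ?w" by (intro nlc_list_map q)
  have "range ?w \<subseteq> {xs. set xs \<subseteq> UNIV \<and> length xs = n}" by auto
  then have w': "finite (range ?w)" by (rule finite_subset) (rule finite_lists_length_eq, simp)
  have "(1/2::real) ^ n > 0" by simp
  from separating_step[OF d w w' this] obtain K0 where K0: "\<And>K. K \<ge> K0 \<Longrightarrow> \<exists>e b S G. division (\<lambda>x. D x = 0) K e b \<and>
    pr (\<lambda>x. D x + N * e (act c x) \<in> S) < (1/2) ^ n \<and> eventually G NE \<and>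
    (\<forall>x y. G x \<longrightarrow> G y \<longrightarrow> D x + N * e (act c x) = D y + N * e (act c y) \<longrightarrow>
       D x + N * e (act c x) \<notin> S \<longrightarrow> ?w x = ?w y)" by blast
  show ?thesis
  proof (intro exI[of _ K0] allI impI)
    fix K assume "K0 \<le> K"
    then obtain e b S G where eb: "division (\<lambda>x. D x = 0) K e b"
      "pr (\<lambda>x. D x + N * e (act c x) \<in> S) < (1/2) ^ n" "eventually G NE"
      "\<forall>x y. G x \<longrightarrow> G y \<longrightarrow> D x + N * e (act c x) = D y + N * e (act c y) \<longrightarrow>
       D x + N * e (act c x) \<notin> S \<longrightarrow> ?w x = ?w y" using K0 by blast
    have "\<forall>k<n. q k x = q k y" if "?w x = ?w y" for x y using that by auto
    with eb(4) have "\<forall>x y. G x \<longrightarrow> G y \<longrightarrow> D x + N * e (act c x) = D y + N * e (act c y) \<longrightarrow>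
       D x + N * e (act c x) \<notin> S \<longrightarrow> (\<forall>k<n. q k x = q k y)" by blast
    with eb(2,3) have "\<exists>S G. pr (\<lambda>x. D x + N * e (act c x) \<in> S) < (1/2) ^ n \<and> eventually G NE \<and>
      (\<forall>x y. G x \<longrightarrow> G y \<longrightarrow> D x + N * e (act c x) = D y + N * e (act c y) \<longrightarrow>
       D x + N * e (act c x) \<notin> S \<longrightarrow> (\<forall>k<n. q k x = q k y))" by blast
    then show "\<exists>D' c'. tower_step q n N D c K D' c'"
      by (intro exI[of _ "\<lambda>x. D x + N * e (act c x)"] exI[of _ "kcomp b c"])
         (unfold tower_step_def if_not_P[OF False], use eb(1) in blast)
  qed
qed

lemma tower_step_division:
  assumes d: "division (\<lambda>_. True) N D c" and s: "tower_step q n N D c K D' c'"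
  shows "division (\<lambda>_. True) (N * K) D' c'"
proof -
  obtain e b where eb: "division (\<lambda>x. D x = 0) K e b" "D' = (\<lambda>x. D x + N * e (act c x))" "c' = kcomp b c"
    using s unfolding tower_step_def by blast
  have "division (\<lambda>x. True \<and> D x = 0) K e b" using eb(1) by simp
  from division_refine[OF d this] show ?thesis unfolding eb(2,3) .
qed

lemma trivial_division: "division (\<lambda>_. True) 1 (\<lambda>_. 0) (\<lambda>_. 0)"
  unfolding division_def by (auto simp: act_def)

text \<open>What the matching of two systems needs to know about a tower of divisions. The codes \<open>D n x\<close> refine each other and
  are equidistributed. Two points of an orbit are in one class at stage \<open>n\<close> if the times \<open>c n\<close> lead to the
  same point; then their later codes differ by a constant, every number occurs in each
  class, and any two points of an orbit are in one class at some stage. On the set \<open>G\<close>, the codes are locally constant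
  and their level sets shrink to points.\<close>
definition coding :: "(nat \<Rightarrow> nat) \<Rightarrow> (nat \<Rightarrow> 'a \<Rightarrow> nat) \<Rightarrow> (nat \<Rightarrow> 'a \<Rightarrow> int) \<Rightarrow> ('a \<Rightarrow> bool) \<Rightarrow> bool" where
  "coding N D c G \<longleftrightarrow>
     eventually G NE \<and> (\<forall>n. nlc (D n)) \<and> (\<forall>n. \<forall>i<N n. pr (\<lambda>x. D n x = i) = 1 / N n) \<and>
     (\<forall>x k n m. n \<le> m \<longrightarrow> c n (tt k x) + k = c n x \<longrightarrow>
        D m (tt k x) + D n x = D m x + D n (tt k x)) \<and>
     (\<forall>x. G x \<longrightarrow>
        (\<forall>n. D n x < N n) \<and> (\<forall>n m. n \<le> m \<longrightarrow> D m x mod N n = D n x) \<and>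
        (\<forall>n. \<forall>i<N n. \<exists>k. D n (tt k x) = i \<and> c n (tt k x) + k = c n x) \<and>
        (\<forall>k. \<exists>n. c n (tt k x) + k = c n x) \<and>
        (\<forall>n. eventually (\<lambda>y. D n y = D n x) (nhds x)) \<and>
        (\<forall>U. open U \<longrightarrow> x \<in> U \<longrightarrow> (\<exists>n. \<forall>y. G y \<longrightarrow> D n y = D n x \<longrightarrow> y \<in> U)))"

context
  fixes q :: "nat \<Rightarrow> 'a \<Rightarrow> bool" and N K :: "nat \<Rightarrow> nat" and D :: "nat \<Rightarrow> 'a \<Rightarrow> nat" and c :: "nat \<Rightarrow> 'a \<Rightarrow> int"
  assumes q: "\<And>k. nlc (q k)"
    and basis: "\<And>x U. open U \<Longrightarrow> x \<in> U \<Longrightarrow> \<exists>k. q k x \<and> (\<forall>y. q k y \<longrightarrow> y \<in> U)"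
    and div: "\<And>n. division (\<lambda>_. True) (N n) (D n) (c n)"
    and N_Suc: "\<And>n. N (Suc n) = N n * K n"
    and step: "\<And>n. tower_step q n (N n) (D n) (c n) (K n) (D (Suc n)) (c (Suc n))"
begin

lemma tower_nlc: "nlc (D n)" "nlc (c n)"
  by (rule division_nlc[OF div])+

lemma tower_measure: "i < N n \<Longrightarrow> pr (\<lambda>x. D n x = i) = 1 / N n"
  using division_measure[OF nlc_const div, of i n] by (simp add: prob_UNIV)

lemma tower_tail:
  assumes "n \<le> m" "c n (tt k x) + k = c n x"
  shows "c m (tt k x) + k = c m x \<and> D m (tt k x) + D n x = D m x + D n (tt k x)"
  using assms(1)
proof (induction m rule: dec_induct)
  case base
  then show ?case using assms(2) by simp
next
  case (step m)
  obtain e b where eb: "D (Suc m) = (\<lambda>x. D m x + N m * e (act (c m) x))" "c (Suc m) = kcomp b (c m)"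
    using \<open>\<And>n. tower_step q n (N n) (D n) (c n) (K n) (D (Suc n)) (c (Suc n))\<close>[of m]
    unfolding tower_step_def by blast
  have "act (c m) (tt k x) = tt (c m (tt k x) + k) x" by (simp add: act_def tt_add)
  then have a: "act (c m) (tt k x) = act (c m) x" using step.IH by (simp add: act_def)
  show ?case unfolding eb kcomp_def a using step.IH by simp
qed

lemma tower_mod: "eventually (\<lambda>x. \<forall>n m. n \<le> m \<longrightarrow> D m x mod N n = D n x) NE"
proof -
  have "eventually (\<lambda>x. \<forall>n. D n x < N n) NE"
    by (rule NE_all_countable) (use division_base[OF div] in eventually_elim, blast)
  then show ?thesis
  proof eventually_elim
    case (elim x)
    have dvd: "N n dvd N m" if "n \<le> m" for n m
      using that by (induction m rule: dec_induct) (simp_all add: N_Suc)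
    have suc: "D (Suc m) x mod N m = D m x" for m
    proof -
      obtain e where "D (Suc m) = (\<lambda>x. D m x + N m * e (act (c m) x))"
        using step[of m] unfolding tower_step_def by blast
      then show ?thesis using elim by simp
    qed
    show ?case
    proof (intro allI impI)
      fix n m :: nat assume "n \<le> m"
      then show "D m x mod N n = D n x"
      proof (induction m rule: dec_induct)
        case base
        then show ?case using elim by simp
      next
        case (step m)
        have "D (Suc m) x mod N n = (D (Suc m) x mod N m) mod N n"
          by (rule mod_mod_cancel[symmetric], rule dvd[OF step.hyps(1)])
        then show ?case using suc step.IH by simp
      qed
    qed
  qed
qed

text \<open>The points whose successor is never in their class form a set of measure at most \<open>(1/2) ^ (2 * n)\<close> for
  every \<open>n\<close>. Classes only grow, so finitely many successive points of an orbit are in one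
  class as soon as this holds for all pairs of neighbours.\<close>
lemma tower_captures: "eventually (\<lambda>x. \<forall>k. \<exists>n. c n (tt k x) + k = c n x) NE"
proof -
  let ?R = "\<lambda>n x. c n x = c n (tt 1 x) + 1"
  have R: "nlc (?R n)" for n
    by (rule nlc_eq[OF tower_nlc(2) nlc_plus[OF nlc_shift[OF tower_nlc(2)] nlc_const]])
  let ?V = "{x. \<forall>n. \<not> ?R n x}"
  have V: "?V \<in> sets M" by (rule all_countable_sets[OF nlc_sets[OF nlc_not[OF R]]])
  have small: "prob ?V \<le> (1/2) ^ (2 * n)" for n
  proof -
    have "pr (\<lambda>x. \<not> ?R (Suc (2 * n)) x) < (1/2) ^ (2 * n)"
      using step[of "2 * n"] unfolding tower_step_def by simp
    moreover have "prob ?V \<le> pr (\<lambda>x. \<not> ?R (Suc (2 * n)) x)"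
      by (rule finite_measure_mono) (auto intro!: nlc_sets[OF nlc_not[OF R]])
    ultimately show ?thesis by linarith
  qed
  have "prob ?V \<le> 0"
  proof (rule LIMSEQ_le_const)
    have "(\<lambda>n. ((1/2)^2::real) ^ n) \<longlonglongrightarrow> 0" by (rule LIMSEQ_power_zero) (simp add: power2_eq_square)
    then show "(\<lambda>n. (1/2::real) ^ (2 * n)) \<longlonglongrightarrow> 0" by (simp only: power_mult)
    show "\<exists>N. \<forall>n\<ge>N. prob ?V \<le> (1/2) ^ (2 * n)" using small by blast
  qed
  then have "prob ?V = 0" by (simp add: measure_le_0_iff)
  then have "AE x in M. x \<notin> ?V" by (simp only: prob_eq_0[OF V])
  then have "AE x in M. \<exists>n. ?R n x" by simp
  then have "eventually (\<lambda>x. \<exists>n. ?R n x) NE" by (rule NE_of_AE_search[OF R])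
  from NE_orbit[OF this] show ?thesis
  proof eventually_elim
    case (elim x)
    \<comment> \<open>stages only have to be compared along finitely many successive points\<close>
    have fwd: "\<exists>n. c n (tt (j + int k) x) + int k = c n (tt j x)" for j and k :: nat
    proof (induction k)
      case (Suc k)
      then obtain n1 where n1: "c n1 (tt (int k) (tt j x)) + int k = c n1 (tt j x)"
        by (auto simp: tt_add[symmetric] add.commute)
      obtain n2 where n2: "c n2 (tt 1 (tt (int k) (tt j x))) + 1 = c n2 (tt (int k) (tt j x))"
        using elim[rule_format, of "int k + j"] unfolding tt_add by (metis (no_types))
      let ?m = "max n1 n2"
      have "c ?m (tt (int k) (tt j x)) + int k = c ?m (tt j x)"
        using tower_tail[OF _ n1, of ?m] by simp
      moreover have "c ?m (tt 1 (tt (int k) (tt j x))) + 1 = c ?m (tt (int k) (tt j x))"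
        using tower_tail[OF _ n2, of ?m] by simp
      moreover have "tt 1 (tt (int k) (tt j x)) = tt (j + int (Suc k)) x"
        by (simp add: tt_add[symmetric] algebra_simps)
      ultimately show ?case by (intro exI[of _ ?m]) simp
    qed simp
    show ?case
    proof
      fix k :: int
      show "\<exists>n. c n (tt k x) + k = c n x"
      proof (cases "k \<ge> 0")
        case True
        then show ?thesis using fwd[of 0 "nat k"] by (simp add: tt_0)
      next
        case False
        then obtain n where "c n x - k = c n (tt k x)" using fwd[of k "nat (- k)"] by (auto simp: tt_0)
        then show ?thesis by (intro exI[of _ n]) simp
      qed
    qed
  qed
qed

text \<open>The code decides the membership in \<open>q k\<close> at every odd stage \<open>n > k\<close> whose exceptional codes \<open>S n\<close> the point
  avoids, and such a stage exists nearly everywhere.\<close>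
lemma tower_separates:
  obtains G where "eventually G NE"
    "\<And>x k. G x \<Longrightarrow> \<exists>n. \<forall>y. G y \<longrightarrow> D n y = D n x \<longrightarrow> q k y = q k x"
proof -
  let ?H = "\<lambda>n S G. pr (\<lambda>x. D (Suc n) x \<in> S) < (1/2) ^ n \<and> eventually G NE \<and>
    (\<forall>x y. G x \<longrightarrow> G y \<longrightarrow> D (Suc n) x = D (Suc n) y \<longrightarrow> D (Suc n) x \<notin> S \<longrightarrow> (\<forall>k<n. q k x = q k y))"
  have "\<forall>n. \<exists>S G. odd n \<longrightarrow> ?H n S G"
  proof
    fix n
    show "\<exists>S G. odd n \<longrightarrow> ?H n S G"
    proof (cases "odd n")
      case True
      from step[of n, unfolded tower_step_def if_not_P[OF True]] show ?thesis by blast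
    qed blast
  qed
  from choice[OF this] obtain S where "\<forall>n. \<exists>G. odd n \<longrightarrow> ?H n (S n) G" by (rule exE)
  from choice[OF this] obtain G where SG: "\<forall>n. odd n \<longrightarrow> ?H n (S n) (G n)" by (rule exE)
  have small: "pr (\<lambda>x. D (Suc n) x \<in> S n) < (1/2) ^ n" and NE_G: "eventually (G n) NE"
    and sep: "\<And>x y k. G n x \<Longrightarrow> G n y \<Longrightarrow> D (Suc n) x = D (Suc n) y \<Longrightarrow> D (Suc n) x \<notin> S n \<Longrightarrow> k < n \<Longrightarrow> q k x = q k y"
    if "odd n" for n using SG that by blast+
  have good: "eventually (\<lambda>x. \<exists>n. odd n \<and> k < n \<and> D (Suc n) x \<notin> S n) NE" for k
  proof (rule NE_of_AE_search)
    have nlcS: "nlc (\<lambda>x. D (Suc n) x \<in> S n)" for n by (rule nlc_comp[OF tower_nlc(1)])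
    let ?R = "\<lambda>n x. odd n \<and> k < n \<and> D (Suc n) x \<notin> S n"
    show R: "nlc (?R n)" for n by (rule nlc_conj[OF nlc_const nlc_conj[OF nlc_const nlc_not[OF nlcS]]])
    let ?V = "{x. \<forall>n. \<not> ?R n x}"
    have V: "?V \<in> sets M" by (rule all_countable_sets[OF nlc_sets[OF nlc_not[OF R]]])
    have bound: "prob ?V \<le> (1/2) ^ n" if n: "n \<ge> k" for n
    proof -
      have odd: "odd (Suc (2 * n))" by simp
      have "prob ?V \<le> pr (\<lambda>x. D (Suc (Suc (2 * n))) x \<in> S (Suc (2 * n)))"
      proof (rule finite_measure_mono[OF _ nlc_sets[OF nlcS]])
        have "k < Suc (2 * n)" using n by simp
        then show "?V \<subseteq> {x. D (Suc (Suc (2 * n))) x \<in> S (Suc (2 * n))}" using odd by blast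
      qed
      also have "\<dots> < (1/2) ^ Suc (2 * n)" by (rule small[OF odd])
      also have "\<dots> \<le> (1/2) ^ n" by (rule power_decreasing) simp_all
      finally show ?thesis by simp
    qed
    have "prob ?V \<le> 0"
    proof (rule LIMSEQ_le_const)
      show "(\<lambda>n. (1/2::real) ^ n) \<longlonglongrightarrow> 0" by (rule LIMSEQ_power_zero) simp
      show "\<exists>N. \<forall>n\<ge>N. prob ?V \<le> (1/2) ^ n" using bound by blast
    qed
    then have "prob ?V = 0" by (simp add: measure_le_0_iff)
    then have "AE x in M. x \<notin> ?V" by (simp only: prob_eq_0[OF V])
    then show "AE x in M. \<exists>n. ?R n x" by (rule eventually_mono) blast
  qed
  define H where "H x \<longleftrightarrow> (\<forall>k. \<exists>n. odd n \<and> k < n \<and> D (Suc n) x \<notin> S n) \<and> (\<forall>n. odd n \<longrightarrow> G n x)" for x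
  show thesis
  proof (rule that)
    have "eventually (\<lambda>x. \<forall>n. odd n \<longrightarrow> G n x) NE"
    proof (rule NE_all_countable)
      fix n show "eventually (\<lambda>x. odd n \<longrightarrow> G n x) NE"
        by (cases "odd n") (use NE_G[of n] in \<open>auto elim!: eventually_mono\<close>)
    qed
    moreover have "eventually (\<lambda>x. \<forall>k. \<exists>n. odd n \<and> k < n \<and> D (Suc n) x \<notin> S n) NE"
      by (rule NE_all_countable) (rule good)
    ultimately show "eventually H NE" unfolding H_def by eventually_elim blast
    fix x k assume x: "H x"
    then obtain n where n: "odd n" "k < n" "D (Suc n) x \<notin> S n" unfolding H_def by blast
    have "q k y = q k x" if "H y" "D (Suc n) y = D (Suc n) x" for y
    proof -
      have "G n x" "G n y" using x that(1) n(1) unfolding H_def by blast+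
      from sep[OF n(1) this that(2)[symmetric] n(3,2)] show ?thesis by simp
    qed
    then show "\<exists>n. \<forall>y. H y \<longrightarrow> D n y = D n x \<longrightarrow> q k y = q k x" by blast
  qed
qed

lemma tower_coding:
  obtains G where "coding N D c G"
proof -
  obtain H where H: "eventually H NE"
    "\<And>x k. H x \<Longrightarrow> \<exists>n. \<forall>y. H y \<longrightarrow> D n y = D n x \<longrightarrow> q k y = q k x" by (rule tower_separates) (rule that; assumption)
  define G where "G x \<longleftrightarrow> H x \<and> (\<forall>n. D n x < N n) \<and> (\<forall>n m. n \<le> m \<longrightarrow> D m x mod N n = D n x) \<and>
        (\<forall>n. \<forall>i<N n. \<exists>k. D n (tt k x) = i \<and> c n (tt k x) + k = c n x) \<and>
        (\<forall>k. \<exists>n. c n (tt k x) + k = c n x) \<and>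
        (\<forall>n. eventually (\<lambda>y. D n y = D n x) (nhds x))" for x
  have "eventually (\<lambda>x. \<forall>n. D n x < N n) NE"
    by (rule NE_all_countable) (use division_base[OF div] in eventually_elim, blast)
  moreover have "eventually (\<lambda>x. \<forall>n. \<forall>i<N n. \<exists>k. D n (tt k x) = i \<and> c n (tt k x) + k = c n x) NE"
    by (rule NE_all_countable) (use division_onto[OF div] in eventually_elim, blast)
  moreover have "eventually (\<lambda>x. \<forall>n. eventually (\<lambda>y. D n y = D n x) (nhds x)) NE"
    by (rule NE_all_countable) (rule tower_nlc(1)[unfolded nlc_def])
  ultimately have G: "eventually G NE"
    using H(1) tower_mod tower_captures unfolding G_def by eventually_elim blast
  have shrink: "\<exists>n. \<forall>y. G y \<longrightarrow> D n y = D n x \<longrightarrow> y \<in> U" if Gx: "G x" and U: "open U" "x \<in> U" for x U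
  proof -
    obtain k where k: "q k x" "\<And>y. q k y \<Longrightarrow> y \<in> U" using basis[OF U] by blast
    have "H x" using Gx unfolding G_def by blast
    then obtain n where n: "\<And>y. H y \<Longrightarrow> D n y = D n x \<Longrightarrow> q k y = q k x" using H(2) by blast
    have "y \<in> U" if "G y" "D n y = D n x" for y
    proof -
      have "H y" using that(1) unfolding G_def by blast
      from n[OF this that(2)] k show ?thesis by blast
    qed
    then show ?thesis by blast
  qed
  show thesis
  proof (rule that[of G], unfold coding_def, intro conjI G allI impI, goal_cases)
    case (1 n) show ?case by (rule tower_nlc)
  next
    case (2 n i) then show ?case by (rule tower_measure)
  next
    case (3 x k n m) then show ?case using tower_tail by blast
  next
    case (4 x n) then show ?case unfolding G_def by blast
  next
    case (5 x n m) then show ?case unfolding G_def by blast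
  next
    case (6 x n i) then show ?case unfolding G_def by blast
  next
    case (7 x k) then show ?case unfolding G_def by blast
  next
    case (8 x n) then show ?case unfolding G_def by blast
  next
    case (9 x U) then show ?case using shrink by blast
  qed
qed

end

section \<open>Matching points of two systems with equal codes\<close>


lemma codingD:
  assumes "coding N D c G"
  shows coding_NE: "eventually G NE"
    and coding_nlc: "nlc (D n)"
    and coding_prob: "i < N n \<Longrightarrow> pr (\<lambda>x. D n x = i) = 1 / N n"
    and coding_tail: "n \<le> m \<Longrightarrow> c n (tt k x) + k = c n x \<Longrightarrow>
      D m (tt k x) + D n x = D m x + D n (tt k x)"
    and coding_lt: "G x \<Longrightarrow> D n x < N n"
    and coding_mod: "G x \<Longrightarrow> n \<le> m \<Longrightarrow> D m x mod N n = D n x"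
    and coding_onto: "G x \<Longrightarrow> i < N n \<Longrightarrow> \<exists>k. D n (tt k x) = i \<and> c n (tt k x) + k = c n x"
    and coding_captures: "G x \<Longrightarrow> \<exists>n. c n (tt k x) + k = c n x"
    and coding_cont: "G x \<Longrightarrow> eventually (\<lambda>y. D n y = D n x) (nhds x)"
    and coding_shrink: "G x \<Longrightarrow> open U \<Longrightarrow> x \<in> U \<Longrightarrow> \<exists>n. \<forall>y. G y \<longrightarrow> D n y = D n x \<longrightarrow> y \<in> U"
proof -
  note * = assms[unfolded coding_def]
  note c2 = conjunct2
  show "eventually G NE" using * by (rule conjunct1)
  show "nlc (D n)" using *[THEN c2, THEN conjunct1] by (rule spec)
  show "i < N n \<Longrightarrow> pr (\<lambda>x. D n x = i) = 1 / N n"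
    using *[THEN c2, THEN c2, THEN conjunct1, THEN spec, THEN spec] by (rule mp)
  show "n \<le> m \<Longrightarrow> c n (tt k x) + k = c n x \<Longrightarrow>
      D m (tt k x) + D n x = D m x + D n (tt k x)"
    by (rule *[THEN c2, THEN c2, THEN c2, THEN conjunct1, THEN spec, THEN spec, THEN spec, THEN spec, THEN mp, THEN mp])
  note g = *[THEN c2, THEN c2, THEN c2, THEN c2, THEN spec, THEN mp]
  show "G x \<Longrightarrow> D n x < N n" by (rule g[THEN conjunct1, THEN spec])
  show "G x \<Longrightarrow> n \<le> m \<Longrightarrow> D m x mod N n = D n x"
    by (rule g[THEN c2, THEN conjunct1, THEN spec, THEN spec, THEN mp])
  show "G x \<Longrightarrow> i < N n \<Longrightarrow> \<exists>k. D n (tt k x) = i \<and> c n (tt k x) + k = c n x"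
    by (rule g[THEN c2, THEN c2, THEN conjunct1, THEN spec, THEN spec, THEN mp])
  show "G x \<Longrightarrow> \<exists>n. c n (tt k x) + k = c n x"
    by (rule g[THEN c2, THEN c2, THEN c2, THEN conjunct1, THEN spec])
  show "G x \<Longrightarrow> eventually (\<lambda>y. D n y = D n x) (nhds x)"
    by (rule g[THEN c2, THEN c2, THEN c2, THEN c2, THEN conjunct1, THEN spec])
  show "G x \<Longrightarrow> open U \<Longrightarrow> x \<in> U \<Longrightarrow> \<exists>n. \<forall>y. G y \<longrightarrow> D n y = D n x \<longrightarrow> y \<in> U"
    by (rule g[THEN c2, THEN c2, THEN c2, THEN c2, THEN c2, THEN spec, THEN mp, THEN mp])
qed

text \<open>A limit that depends on \<open>N\<close> and \<open>P\<close> only, so two systems with the same \<open>N\<close> give the same probability. Up to stage \<open>k\<close>,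
  the event is decided by the code \<open>D k\<close>, which is uniformly distributed.\<close>
lemma coding_measure:
  assumes cod: "coding N D c G"
  shows "(\<lambda>k. card {s. s < N k \<and> (\<exists>n\<le>k. P n (s mod N n))} / N k) \<longlonglongrightarrow> pr (\<lambda>x. \<exists>n. P n (D n x))"
proof -
  note G = coding_NE[OF cod] and D = coding_nlc[OF cod] and eq = coding_prob[OF cod]
    and lt = coding_lt[OF cod] and md = coding_mod[OF cod]
  let ?E = "\<lambda>k. {x. \<exists>n\<le>k. P n (D n x)}"
  let ?S = "\<lambda>k. {s. s < N k \<and> (\<exists>n\<le>k. P n (s mod N n))}"
  have E: "?E k \<in> sets M" for k
  proof -
    have "nlc (\<lambda>x. \<exists>n<Suc k. P n (D n x))" by (rule nlc_ex_less) (rule nlc_comp[OF D])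
    then have "{x. \<exists>n<Suc k. P n (D n x)} \<in> sets M" by (rule nlc_sets)
    then show ?thesis by (simp only: less_Suc_eq_le)
  qed
  have "prob (?E k) = card (?S k) / N k" for k
  proof -
    have "prob (?E k) = prob (\<Union>s\<in>?S k. {x. D k x = s})"
    proof (rule finite_measure_eq_AE[OF _ E])
      show "(\<Union>s\<in>?S k. {x. D k x = s}) \<in> sets M"
        by (intro sets.finite_UN nlc_sets nlc_eq[OF D nlc_const]) simp
      show "AE x in M. (x \<in> ?E k) = (x \<in> (\<Union>s\<in>?S k. {x. D k x = s}))"
        using NE_AE[OF G]
      proof eventually_elim
        case (elim x)
        have "D k x < N k" by (rule lt[OF elim])
        moreover have "n \<le> k \<Longrightarrow> D k x mod N n = D n x" for n by (rule md[OF elim])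
        ultimately show ?case by auto
      qed
    qed
    also have "\<dots> = (\<Sum>s\<in>?S k. pr (\<lambda>x. D k x = s))"
      by (rule finite_measure_finite_Union)
         (auto simp: disjoint_family_on_def intro!: nlc_sets nlc_eq[OF D nlc_const])
    also have "\<dots> = (\<Sum>s\<in>?S k. 1 / N k)" by (rule sum.cong[OF refl]) (simp add: eq)
    finally show ?thesis by simp
  qed
  moreover have "(\<lambda>k. prob (?E k)) \<longlonglongrightarrow> prob (\<Union>k. ?E k)"
  proof (rule finite_Lim_measure_incseq)
    show "range ?E \<subseteq> sets M" using E by blast
    show "incseq ?E" unfolding incseq_def by (intro allI impI Collect_mono) (meson le_trans)
  qed
  moreover have "(\<Union>k. ?E k) = {x. \<exists>n. P n (D n x)}" by blast
  ultimately show ?thesis by simp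
qed

lemma coding_code_exists:
  assumes cod: "coding N D c G" and i: "i < N n"
  shows "\<exists>x. G x \<and> D n x = i"
proof (rule ccontr)
  assume none: "\<not> (\<exists>x. G x \<and> D n x = i)"
  note G = coding_NE[OF cod] and eq = coding_prob[OF cod i]
  have "pr (\<lambda>x. D n x = i) \<le> pr (\<lambda>x. False)"
    by (rule pr_mono[OF nlc_const]) (use G none in \<open>auto elim!: eventually_mono\<close>)
  then show False using eq i by simp
qed

lemma coding_mono:
  assumes cod: "coding N D c G" and H: "eventually H NE" "\<And>x. H x \<Longrightarrow> G x"
  shows "coding N D c H"
  unfolding coding_def
proof (intro conjI allI impI, goal_cases)
  case 1 show ?case by (rule H(1))
next
  case (2 n) show ?case by (rule coding_nlc[OF cod])
next
  case (3 n i) then show ?case by (rule coding_prob[OF cod])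
next
  case (4 x k n m) then show ?case using coding_tail[OF cod] by blast
next
  case (5 x n) then show ?case by (rule coding_lt[OF cod H(2)])
next
  case (6 x n m) then show ?case by (rule coding_mod[OF cod H(2)])
next
  case (7 x n i) then show ?case by (rule coding_onto[OF cod H(2)])
next
  case (8 x k) then show ?case by (rule coding_captures[OF cod H(2)])
next
  case (9 x n) then show ?case by (rule coding_cont[OF cod H(2)])
next
  case (10 x U)
  from coding_shrink[OF cod H(2)[OF 10(1)] 10(2,3)] show ?case using H(2) by blast
qed

end

text \<open>Two systems with codes in the same range. The codes behave well on the invariant \<open>G\<^sub>\<delta>\<close> sets \<open>\<Inter>\<U>\<close> and \<open>\<Inter>\<V>\<close>. All
  facts are proved in one direction, and \<open>swap\<close> gives the other.\<close>
locale coded_pair = X: ergodic_Z_action M tt + Y: ergodic_Z_action M' tt'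
  for M :: "'a::polish_space measure" and tt :: "int \<Rightarrow> 'a \<Rightarrow> 'a"
    and M' :: "'b::polish_space measure" and tt' :: "int \<Rightarrow> 'b \<Rightarrow> 'b" +
  fixes N :: "nat \<Rightarrow> nat" and D c D' c' and \<U> :: "'a set set" and \<V> :: "'b set set"
  assumes cX: "X.coding N D c (\<lambda>x. x \<in> \<Inter>\<U>)" and cY: "Y.coding N D' c' (\<lambda>y. y \<in> \<Inter>\<V>)"
    and U: "countable \<U>" "\<And>U. U \<in> \<U> \<Longrightarrow> open U" "\<And>x k. x \<in> \<Inter>\<U> \<Longrightarrow> tt k x \<in> \<Inter>\<U>"
    and V: "countable \<V>" "\<And>V. V \<in> \<V> \<Longrightarrow> open V" "\<And>y k. y \<in> \<Inter>\<V> \<Longrightarrow> tt' k y \<in> \<Inter>\<V>"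
begin

lemma swap: "coded_pair M' tt' M tt N D' c' D c \<V> \<U>"
proof -
  have "ergodic_Z_action M' tt'" "ergodic_Z_action M tt" by unfold_locales
  then show ?thesis
    unfolding coded_pair_def coded_pair_axioms_def using cX cY U V by blast
qed

definition matched :: "'a \<Rightarrow> 'b \<Rightarrow> bool" where
  "matched x y \<longleftrightarrow> x \<in> \<Inter>\<U> \<and> y \<in> \<Inter>\<V> \<and> (\<forall>n. D n x = D' n y)"

definition partnered :: "'a set" where "partnered = {x. \<exists>y. matched x y}"

lemmas code_lt = X.coding_lt[OF cX] and code_mod = X.coding_mod[OF cX]
  and code_captures = X.coding_captures[OF cX] and code_cont = X.coding_cont[OF cX]
  and code_tail = X.coding_tail[OF cX]

lemmas code'_mod = Y.coding_mod[OF cY]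
  and code'_onto = Y.coding_onto[OF cY] and code'_cont = Y.coding_cont[OF cY]
  and code'_tail = Y.coding_tail[OF cY] and code'_shrink = Y.coding_shrink[OF cY]

lemma matched_unique:
  assumes "matched x y" "matched x z"
  shows "y = z"
proof (rule ccontr)
  assume "y \<noteq> z"
  have y: "y \<in> \<Inter>\<V>" and z: "z \<in> \<Inter>\<V>" and eq: "D' n z = D' n y" for n
    using assms unfolding matched_def by auto
  have "open (- {z})" "y \<in> - {z}" using \<open>y \<noteq> z\<close> by auto
  from code'_shrink[OF y this] obtain n where "\<forall>w. w \<in> \<Inter>\<V> \<longrightarrow> D' n w = D' n y \<longrightarrow> w \<in> - {z}" by blast
  with z eq show False by blast
qed

text \<open>At a stage \<open>n\<close> where \<open>x\<close> and \<open>tt k x\<close> are in one class, the class of \<open>y\<close> has a point with the code of \<open>tt k x\<close>. Later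
  codes agree as they differ by a constant from those of \<open>x\<close> and \<open>y\<close>, earlier ones as they are remainders.\<close>
lemma matched_orbit:
  assumes "matched x y"
  shows "\<exists>l. matched (tt k x) (tt' l y)"
proof -
  have x: "x \<in> \<Inter>\<U>" and y: "y \<in> \<Inter>\<V>" and eq: "D m x = D' m y" for m
    using assms unfolding matched_def by auto
  have kx: "tt k x \<in> \<Inter>\<U>" by (rule U(3)[OF x])
  obtain n where n: "c n (tt k x) + k = c n x" using code_captures[OF x] by blast
  obtain l where l: "D' n (tt' l y) = D n (tt k x)" "c' n (tt' l y) + l = c' n y"
    using code'_onto[OF y code_lt[OF kx]] by blast
  have ly: "tt' l y \<in> \<Inter>\<V>" by (rule V(3)[OF y])
  have "D m (tt k x) = D' m (tt' l y)" for m
  proof (cases "n \<le> m")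
    case True
    show ?thesis using code_tail[OF True n] code'_tail[OF True l(2)] l(1) eq[of n] eq[of m] by simp
  next
    case False
    then have "m \<le> n" by simp
    from code_mod[OF kx this] code'_mod[OF ly this] show ?thesis using l(1) by simp
  qed
  then show ?thesis using kx ly unfolding matched_def by blast
qed

lemma partnered_invariant: "x \<in> partnered \<Longrightarrow> tt k x \<in> partnered"
  using matched_orbit unfolding partnered_def by blast

definition \<phi> :: "'a \<Rightarrow> 'b" where "\<phi> x = (THE y. matched x y)"

lemma phi_eq: "matched x y \<Longrightarrow> \<phi> x = y"
  unfolding \<phi>_def using matched_unique by blast

lemma matched_phi: "x \<in> partnered \<Longrightarrow> matched x (\<phi> x)"
  unfolding partnered_def using phi_eq by auto

lemma continuous_phi: "continuous_on partnered \<phi>"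
  unfolding continuous_on_def
proof (intro ballI topological_tendstoI)
  fix x W assume x: "x \<in> partnered" and W: "open W" "\<phi> x \<in> W"
  have m: "x \<in> \<Inter>\<U>" "\<phi> x \<in> \<Inter>\<V>" "\<And>n. D n x = D' n (\<phi> x)"
    using matched_phi[OF x] unfolding matched_def by auto
  obtain n where n: "\<And>z. z \<in> \<Inter>\<V> \<Longrightarrow> D' n z = D' n (\<phi> x) \<Longrightarrow> z \<in> W" using code'_shrink[OF m(2) W] by blast
  have "eventually (\<lambda>z. D n z = D n x) (nhds x)" by (rule code_cont[OF m(1)])
  then have "eventually (\<lambda>z. D n z = D n x) (at x within partnered)"
    by (rule eventually_at_filter[THEN iffD2, OF eventually_mono]) simp
  moreover have "eventually (\<lambda>z. z \<in> partnered) (at x within partnered)"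
    by (rule eventually_at_filter[THEN iffD2]) simp
  ultimately show "eventually (\<lambda>z. \<phi> z \<in> W) (at x within partnered)"
  proof eventually_elim
    case (elim z)
    have "\<phi> z \<in> \<Inter>\<V>" "D n z = D' n (\<phi> z)" using matched_phi[OF elim(2)] unfolding matched_def by auto
    then show ?case using n elim(1) m(3) by simp
  qed
qed

text \<open>The points of the second system with code \<open>s\<close> at stage \<open>n\<close> are close together, and their limits lie in \<open>W\<close>. That
  the code of \<open>x\<close> pins down a point in this sense is an open condition, and it expresses the existence of a
  partner of \<open>x\<close> without mentioning the partner.\<close>
definition pins :: "'b set \<Rightarrow> nat \<Rightarrow> nat \<Rightarrow> nat \<Rightarrow> bool" where
  "pins W m n s \<longleftrightarrow> (\<forall>y z. y \<in> \<Inter>\<V> \<longrightarrow> z \<in> \<Inter>\<V> \<longrightarrow> D' n y = s \<longrightarrow> D' n z = s \<longrightarrow> dist y z < 1 / (real m + 1)) \<and>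
     closure {y. y \<in> \<Inter>\<V> \<and> D' n y = s} \<subseteq> W"

lemma eventually_pinned:
  assumes y: "y \<in> \<Inter>\<V>" and W: "open W" "y \<in> W"
  shows "\<exists>n. pins W m n (D' n y)"
proof -
  obtain r where r: "r > 0" "cball y r \<subseteq> W" using W open_contains_cball by blast
  define \<rho> where "\<rho> = min r (1 / (2 * (real m + 1)))"
  have \<rho>: "\<rho> > 0" "\<rho> \<le> r" "2 * \<rho> \<le> 1 / (real m + 1)"
    using r(1) by (auto simp: \<rho>_def min_def field_simps)
  obtain n where n: "\<And>z. z \<in> \<Inter>\<V> \<Longrightarrow> D' n z = D' n y \<Longrightarrow> z \<in> ball y \<rho>"
    using code'_shrink[OF y open_ball, of y \<rho>] \<rho>(1) by auto
  have "dist z w < 1 / (real m + 1)" if "z \<in> \<Inter>\<V>" "w \<in> \<Inter>\<V>" "D' n z = D' n y" "D' n w = D' n y" for z w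
    using n[OF that(1,3)] n[OF that(2,4)] dist_triangle3[of z w y] \<rho>(3) by (simp add: dist_commute)
  moreover have "closure {z. z \<in> \<Inter>\<V> \<and> D' n z = D' n y} \<subseteq> W"
  proof -
    have "{z. z \<in> \<Inter>\<V> \<and> D' n z = D' n y} \<subseteq> cball y r"
    proof
      fix z assume "z \<in> {z. z \<in> \<Inter>\<V> \<and> D' n z = D' n y}"
      then have "dist y z < \<rho>" using n[of z] by simp
      then show "z \<in> cball y r" using \<rho>(2) by simp
    qed
    then have "closure {z. z \<in> \<Inter>\<V> \<and> D' n z = D' n y} \<subseteq> cball y r" by (rule closure_minimal) simp
    then show ?thesis using r(2) by blast
  qed
  ultimately show ?thesis unfolding pins_def by blast
qed

text \<open>Every code occurs in the second system. Points with the codes of \<open>x\<close> form a Cauchy sequence, and the limit is in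
  every \<open>W \<in> \<V>\<close>. It has the codes of \<open>x\<close>, since codes are locally constant at points of \<open>\<Inter>\<V>\<close>.\<close>
lemma matched_if_pinned:
  assumes x: "x \<in> \<Inter>\<U>" and pin: "\<And>W m. W \<in> insert UNIV \<V> \<Longrightarrow> \<exists>n. pins W m n (D n x)"
  shows "x \<in> partnered"
proof -
  define C where "C n = {y. y \<in> \<Inter>\<V> \<and> D' n y = D n x}" for n
  have C_mono: "C m \<subseteq> C n" if "n \<le> m" for n m
  proof
    fix y assume "y \<in> C m"
    then have y: "y \<in> \<Inter>\<V>" "D' m y = D m x" unfolding C_def by blast+
    have "D' n y = D n x" using code'_mod[OF y(1) that] code_mod[OF x that] y(2) by simp
    then show "y \<in> C n" using y(1) unfolding C_def by blast
  qed
  have "\<exists>y. y \<in> C n" for n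
    using Y.coding_code_exists[OF cY code_lt[OF x], of n] unfolding C_def by blast
  then obtain y where y: "\<And>n. y n \<in> C n" by metis
  have yC: "y k \<in> C n" if "n \<le> k" for n k using y[of k] C_mono[OF that] by blast
  have "Cauchy y"
  proof (rule metric_CauchyI)
    fix \<epsilon> :: real assume "\<epsilon> > 0"
    then obtain m :: nat where m: "1 / (real m + 1) < \<epsilon>"
      using reals_Archimedean[of \<epsilon>] by (auto simp: inverse_eq_divide add.commute)
    obtain n where n: "pins UNIV m n (D n x)" using pin[of UNIV m] by blast
    have "dist (y i) (y k) < \<epsilon>" if "i \<ge> n" "k \<ge> n" for i k
    proof -
      have "dist (y i) (y k) < 1 / (real m + 1)"
        using n yC[OF that(1)] yC[OF that(2)] unfolding pins_def C_def by blast
      then show ?thesis using m by simp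
    qed
    then show "\<exists>n. \<forall>i\<ge>n. \<forall>k\<ge>n. dist (y i) (y k) < \<epsilon>" by blast
  qed
  then obtain z where z: "y \<longlonglongrightarrow> z" using Cauchy_convergent convergent_def by blast
  have cl: "z \<in> closure (C n)" for n
  proof (rule closure_sequential[THEN iffD2], intro exI conjI allI)
    show "(\<lambda>k. y (k + n)) \<longlonglongrightarrow> z" using z by (rule LIMSEQ_ignore_initial_segment)
    show "y (k + n) \<in> C n" for k by (rule yC) simp
  qed
  have zV: "z \<in> \<Inter>\<V>"
  proof
    fix W assume "W \<in> \<V>"
    then obtain n where "pins W 0 n (D n x)" using pin[of W 0] by blast
    then have "closure (C n) \<subseteq> W" unfolding pins_def C_def by blast
    then show "z \<in> W" using cl by blast
  qed
  have "D n x = D' n z" for n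
  proof -
    have "eventually (\<lambda>w. D' n w = D' n z) (nhds z)" by (rule code'_cont[OF zV])
    then have "eventually (\<lambda>k. D' n (y k) = D' n z) sequentially"
      using z by (rule eventually_compose_filterlim)
    then obtain k where k: "k \<ge> n" "D' n (y k) = D' n z"
      unfolding eventually_sequentially by (meson nat_le_linear)
    then show ?thesis using yC[OF k(1)] unfolding C_def by simp
  qed
  then show ?thesis using x zV unfolding partnered_def matched_def by blast
qed

lemma pinned_if_matched:
  assumes "x \<in> partnered" "W \<in> insert UNIV \<V>"
  shows "\<exists>n. pins W m n (D n x)"
proof -
  obtain y where y: "matched x y" using assms(1) unfolding partnered_def by blast
  have "y \<in> \<Inter>\<V>" "open W" "y \<in> W" using y assms(2) V(2) unfolding matched_def by auto
  from eventually_pinned[OF this, of m] obtain n where n: "pins W m n (D' n y)" by blast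
  moreover have "D n x = D' n y" using y unfolding matched_def by blast
  ultimately show ?thesis by (intro exI[of _ n]) simp
qed

text \<open>The test set \<open>UNIV\<close> is included for the condition on distances alone, which would be lost for empty \<open>\<V>\<close>.\<close>
lemma partnered_gdelta:
  obtains \<G> where "countable \<G>" "\<And>G. G \<in> \<G> \<Longrightarrow> open G" "partnered = \<Inter>\<G>"
proof -
  define Q where "Q W m = interior {x. \<exists>n. pins W m n (D n x)}" for W and m :: nat
  let ?\<G> = "\<U> \<union> (\<lambda>(W, m). Q W m) ` (insert UNIV \<V> \<times> UNIV)"
  show thesis
  proof (rule that[of ?\<G>])
    show "countable ?\<G>" using U(1) V(1) by auto
    show "open G" if "G \<in> ?\<G>" for G using that U(2) by (auto simp: Q_def)
    show "partnered = \<Inter>?\<G>"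
    proof (intro equalityI subsetI)
      fix x assume x: "x \<in> partnered"
      have xU: "x \<in> \<Inter>\<U>" using x unfolding partnered_def matched_def by blast
      have "x \<in> Q W m" if W: "W \<in> insert UNIV \<V>" for W m
      proof -
        obtain n where n: "pins W m n (D n x)" using pinned_if_matched[OF x W] by blast
        obtain T where T: "open T" "x \<in> T" "\<And>y. y \<in> T \<Longrightarrow> D n y = D n x"
          using code_cont[OF xU, of n] unfolding eventually_nhds by blast
        have "T \<subseteq> {x. \<exists>n. pins W m n (D n x)}"
        proof
          fix y assume "y \<in> T"
          then have "pins W m n (D n y)" using T(3) n by simp
          then show "y \<in> {x. \<exists>n. pins W m n (D n x)}" by blast
        qed
        then show ?thesis unfolding Q_def using T(1,2) by (meson interior_maximal subsetD)
      qed
      then show "x \<in> \<Inter>?\<G>" using xU by auto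
    next
      fix x assume x: "x \<in> \<Inter>?\<G>"
      show "x \<in> partnered"
      proof (rule matched_if_pinned)
        show "x \<in> \<Inter>\<U>" using x by blast
        fix W m assume "W \<in> insert UNIV \<V>"
        then have "x \<in> Q W m" using x by auto
        then show "\<exists>n. pins W m n (D n x)" unfolding Q_def using interior_subset by blast
      qed
    qed
  qed
qed

lemma partnered_borel: "partnered \<in> sets borel"
proof -
  obtain \<G> where G: "countable \<G>" "\<And>G. G \<in> \<G> \<Longrightarrow> open G" "partnered = \<Inter>\<G>" by (rule partnered_gdelta) (rule that; assumption)
  show ?thesis
  proof (cases "\<G> = {}")
    case True
    then show ?thesis using G(3) by simp
  next
    case False
    have "(\<lambda>G. G) ` \<G> \<subseteq> sets borel" using borel_open[OF G(2)] by blast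
    from sets.countable_INT'[OF G(1) False this] show ?thesis unfolding G(3) by simp
  qed
qed

lemma code_events: "X.prob {x. \<exists>n. P n (D n x)} = Y.prob {y. \<exists>n. P n (D' n y)}"
  by (rule LIMSEQ_unique[OF X.coding_measure[OF cX] Y.coding_measure[OF cY]])

lemma events_sets: "{x. \<exists>n. P n (D n x)} \<in> sets M" "{y. \<exists>n. P n (D' n y)} \<in> sets M'"
  by (rule X.ex_countable_sets[OF X.nlc_sets[OF X.nlc_comp[OF X.coding_nlc[OF cX]]]]
    Y.ex_countable_sets[OF Y.nlc_sets[OF Y.nlc_comp[OF Y.coding_nlc[OF cY]]]])+

lemma AE_code': "AE y in M'. y \<in> \<Inter>\<V>"
  by (rule Y.NE_AE[OF Y.coding_NE[OF cY]])

lemma AE_code: "AE x in M. x \<in> \<Inter>\<U>"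
  by (rule X.NE_AE[OF X.coding_NE[OF cX]])

text \<open>The points of the second system satisfy the pinning conditions, and these concern codes
  only, so they have the same probability in the first system.\<close>
lemma partnered_full: "AE x in M. x \<in> partnered"
proof -
  have pin: "AE x in M. \<exists>n. pins W m n (D n x)" if W: "W \<in> insert UNIV \<V>" for W m
  proof -
    have "AE y in M'. \<exists>n. pins W m n (D' n y)"
      using AE_code' by eventually_elim (rule eventually_pinned, use W V(2) in auto)
    then have "AE y in M'. y \<in> {y. \<exists>n. pins W m n (D' n y)}" by simp
    then have "Y.prob {y. \<exists>n. pins W m n (D' n y)} = 1" using Y.prob_eq_1[OF events_sets(2)] by blast
    then have "X.prob {x. \<exists>n. pins W m n (D n x)} = 1" unfolding code_events .
    then have "AE x in M. x \<in> {x. \<exists>n. pins W m n (D n x)}" using X.prob_eq_1[OF events_sets(1)] by blast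
    then show ?thesis by simp
  qed
  have cnt: "countable (insert UNIV \<V>)" using V(1) by simp
  have "AE x in M. \<forall>m. \<exists>n. pins W m n (D n x)" if "W \<in> insert UNIV \<V>" for W
    unfolding AE_all_countable using pin[OF that] by (rule allI)
  then have "AE x in M. \<forall>W\<in>insert UNIV \<V>. \<forall>m. \<exists>n. pins W m n (D n x)"
    unfolding AE_ball_countable[OF cnt] by (rule ballI)
  with AE_code show ?thesis
  proof eventually_elim
    case (elim x)
    from elim(1) show ?case by (rule matched_if_pinned) (rule elim(2)[rule_format])
  qed
qed

text \<open>Membership of \<open>\<phi> x\<close> in an open set is decided by one of the codes of \<open>x\<close>.\<close>
lemma phi_open_measure:
  assumes W: "open W"
  shows "X.prob {x. x \<in> partnered \<and> \<phi> x \<in> W} = Y.prob W"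
proof -
  \<comment> \<open>the code s at stage n forces membership in W\<close>
  let ?P = "\<lambda>n s. \<forall>y. y \<in> \<Inter>\<V> \<longrightarrow> D' n y = s \<longrightarrow> y \<in> W"
  have iff: "(\<exists>n. ?P n (D' n y)) \<longleftrightarrow> y \<in> W" if "y \<in> \<Inter>\<V>" for y
    using code'_shrink[OF that W] that by blast
  have sX: "{x. \<exists>n. ?P n (D n x)} \<in> sets M" by (rule events_sets(1))
  have sY: "{y. \<exists>n. ?P n (D' n y)} \<in> sets M'" by (rule events_sets(2))
  have ae: "AE x in M. x \<in> {x. x \<in> partnered \<and> \<phi> x \<in> W} \<longleftrightarrow> x \<in> {x. \<exists>n. ?P n (D n x)}"
    using partnered_full
  proof eventually_elim
    case (elim x)
    have "\<phi> x \<in> \<Inter>\<V>" "\<And>n. D n x = D' n (\<phi> x)" using matched_phi[OF elim] unfolding matched_def by auto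
    then show ?case using iff[of "\<phi> x"] elim by simp
  qed
  note sdom = partnered_borel
  have "{x. x \<in> partnered \<and> \<phi> x \<in> W} \<in> sets M"
  proof -
    obtain T where T: "open T" "T \<inter> partnered = \<phi> -` W \<inter> partnered"
      using continuous_phi W unfolding continuous_on_open_invariant by blast
    have "{x. x \<in> partnered \<and> \<phi> x \<in> W} = T \<inter> partnered" unfolding T(2) by blast
    then show ?thesis using T(1) sdom X.borel_sub by auto
  qed
  then have "X.prob {x. x \<in> partnered \<and> \<phi> x \<in> W} = X.prob {x. \<exists>n. ?P n (D n x)}"
    by (rule X.finite_measure_eq_AE[OF ae _ sX])
  also have "\<dots> = Y.prob {y. \<exists>n. ?P n (D' n y)}" by (rule code_events)
  also have "\<dots> = Y.prob W"
  proof (rule Y.finite_measure_eq_AE[OF _ sY Y.open_sets[OF W]])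
    show "AE y in M'. y \<in> {y. \<exists>n. ?P n (D' n y)} \<longleftrightarrow> y \<in> W"
      using AE_code' by eventually_elim (use iff in simp)
  qed
  finally show ?thesis .
qed

lemma orbit_subset:
  assumes "x \<in> partnered"
  shows "\<phi> (tt k x) \<in> range (\<lambda>l. tt' l (\<phi> x))"
  using matched_orbit[OF matched_phi[OF assms], of k] phi_eq by blast

end

section \<open>Construction of a pair of systems with equal codes\<close>

text \<open>The two towers are built at the same time. At each stage, both steps are possible for all sufficiently large \<open>K\<close>,
  and the maximum of the two bounds is used.\<close>
lemma coded_pair_exists:
  fixes M :: "'a::polish_space measure" and M' :: "'b::polish_space measure"
  assumes "ergodic_Z_action M tt" and "ergodic_Z_action M' tt'"
  shows "\<exists>N D c D' c' \<U> \<V>. coded_pair M tt M' tt' N D c D' c' \<U> \<V>"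
proof -
  interpret X: ergodic_Z_action M tt by fact
  interpret Y: ergodic_Z_action M' tt' by fact
  obtain q where q: "\<And>k. X.nlc (q k)"
    "\<And>x U. open U \<Longrightarrow> x \<in> U \<Longrightarrow> \<exists>k::nat. q k x \<and> (\<forall>y. q k y \<longrightarrow> y \<in> U)"
    by (rule X.nlc_basis) (rule that; assumption)
  obtain q' where q': "\<And>k. Y.nlc (q' k)"
    "\<And>x U. open U \<Longrightarrow> x \<in> U \<Longrightarrow> \<exists>k::nat. q' k x \<and> (\<forall>y. q' k y \<longrightarrow> y \<in> U)"
    by (rule Y.nlc_basis) (rule that; assumption)
  let ?P = "\<lambda>(n::nat) (N, D, c, D', c'). X.division (\<lambda>_. True) N D c \<and> Y.division (\<lambda>_. True) N D' c'"
  let ?Q = "\<lambda>n (N, D, c, D', c') (N1, D1, c1, D1', c1'). \<exists>K. N1 = N * K \<and>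
    X.tower_step q n N D c K D1 c1 \<and> Y.tower_step q' n N D' c' K D1' c1'"
  have "\<exists>f. \<forall>n. ?P n (f n) \<and> ?Q n (f n) (f (Suc n))"
  proof (rule dependent_nat_choice)
    show "\<exists>s. ?P 0 s"
      by (rule exI[of _ "(1, \<lambda>_. 0, \<lambda>_. 0, \<lambda>_. 0, \<lambda>_. 0)"])
         (simp add: X.trivial_division[simplified] Y.trivial_division[simplified])
    fix s n assume s: "?P n s"
    obtain N D c D' c' where s_eq: "s = (N, D, c, D', c')" by (cases s) auto
    have d: "X.division (\<lambda>_. True) N D c" "Y.division (\<lambda>_. True) N D' c'" using s s_eq by simp_all
    obtain K0 where K0: "\<And>K. K \<ge> K0 \<Longrightarrow> \<exists>D1 c1. X.tower_step q n N D c K D1 c1"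
      using X.tower_step_exists[of q, OF q(1) d(1), of n] by blast
    obtain K1 where K1: "\<And>K. K \<ge> K1 \<Longrightarrow> \<exists>D1 c1. Y.tower_step q' n N D' c' K D1 c1"
      using Y.tower_step_exists[of q', OF q'(1) d(2), of n] by blast
    let ?K = "max K0 K1"
    obtain D1 c1 where x: "X.tower_step q n N D c ?K D1 c1" using K0[of ?K] by auto
    obtain D1' c1' where y: "Y.tower_step q' n N D' c' ?K D1' c1'" using K1[of ?K] by auto
    have "?P (Suc n) (N * ?K, D1, c1, D1', c1')"
      using X.tower_step_division[OF d(1) x] Y.tower_step_division[OF d(2) y] by simp
    moreover have "?Q n s (N * ?K, D1, c1, D1', c1')" unfolding s_eq using x y by blast
    ultimately show "\<exists>s'. ?P (Suc n) s' \<and> ?Q n s s'" by (intro exI conjI)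
  qed
  then obtain f where f0: "\<forall>n. ?P n (f n) \<and> ?Q n (f n) (f (Suc n))" by (rule exE)
  have f: "?P n (f n)" "?Q n (f n) (f (Suc n))" for n
    by (rule f0[THEN spec, THEN conjunct1], rule f0[THEN spec, THEN conjunct2])
  define N D c D' c' where "N n = fst (f n)" and "D n = fst (snd (f n))" and "c n = fst (snd (snd (f n)))"
    and "D' n = fst (snd (snd (snd (f n))))" and "c' n = snd (snd (snd (snd (f n))))" for n
  have f_eq: "f n = (N n, D n, c n, D' n, c' n)" for n
    by (simp add: N_def D_def c_def D'_def c'_def)
  have div: "X.division (\<lambda>_. True) (N n) (D n) (c n)" "Y.division (\<lambda>_. True) (N n) (D' n) (c' n)" for n
    using f(1)[of n] unfolding f_eq by simp_all
  have "\<exists>K. N (Suc n) = N n * K \<and> X.tower_step q n (N n) (D n) (c n) K (D (Suc n)) (c (Suc n)) \<and>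
    Y.tower_step q' n (N n) (D' n) (c' n) K (D' (Suc n)) (c' (Suc n))" for n
    using f(2)[of n] unfolding f_eq by simp
  then obtain K where K: "\<And>n. N (Suc n) = N n * K n"
    "\<And>n. X.tower_step q n (N n) (D n) (c n) (K n) (D (Suc n)) (c (Suc n))"
    "\<And>n. Y.tower_step q' n (N n) (D' n) (c' n) (K n) (D' (Suc n)) (c' (Suc n))" by metis
  obtain G where G: "X.coding N D c G"
    by (rule X.tower_coding[of q N D c K, OF q(1,2) div(1) K(1,2)])
  obtain G' where G': "Y.coding N D' c' G'"
    by (rule Y.tower_coding[of q' N D' c' K, OF q'(1,2) div(2) K(1,3)])
  obtain \<U> where U: "countable \<U>" "\<And>U. U \<in> \<U> \<Longrightarrow> open U" "AE x in M. x \<in> \<Inter>\<U>"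
    "\<And>x. x \<in> \<Inter>\<U> \<Longrightarrow> G x" "\<And>x k. x \<in> \<Inter>\<U> \<Longrightarrow> tt k x \<in> \<Inter>\<U>"
    by (rule X.NE_gdelta_invariant[OF X.coding_NE[OF G]]) (rule that; assumption)
  obtain \<V> where V: "countable \<V>" "\<And>U. U \<in> \<V> \<Longrightarrow> open U" "AE x in M'. x \<in> \<Inter>\<V>"
    "\<And>x. x \<in> \<Inter>\<V> \<Longrightarrow> G' x" "\<And>x k. x \<in> \<Inter>\<V> \<Longrightarrow> tt' k x \<in> \<Inter>\<V>"
    by (rule Y.NE_gdelta_invariant[OF Y.coding_NE[OF G']]) (rule that; assumption)
  have "eventually (\<lambda>x. x \<in> \<Inter>\<U>) X.NE"
    unfolding X.eventually_NE
    by (rule exI[of _ \<U>]) (use U(1-3) in \<open>auto elim!: eventually_mono\<close>)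
  then have cX: "X.coding N D c (\<lambda>x. x \<in> \<Inter>\<U>)" by (rule X.coding_mono[OF G _ U(4)])
  have "eventually (\<lambda>x. x \<in> \<Inter>\<V>) Y.NE"
    unfolding Y.eventually_NE
    by (rule exI[of _ \<V>]) (use V(1-3) in \<open>auto elim!: eventually_mono\<close>)
  then have cY: "Y.coding N D' c' (\<lambda>x. x \<in> \<Inter>\<V>)" by (rule Y.coding_mono[OF G' _ V(4)])
  have "coded_pair M tt M' tt' N D c D' c' \<U> \<V>"
    by (intro coded_pair.intro coded_pair_axioms.intro assms cX cY U(1,2,5) V(1,2,5))
  then show ?thesis by blast
qed

context
  fixes T :: "'a::topological_space \<Rightarrow> 'a"
  assumes T: "homeomorphism UNIV UNIV T (inv T)"
begin

lemma T_inv: "T (inv T x) = x" "inv T (T x) = x"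
  using T unfolding homeomorphism_def by auto

lemma int_iterate_0: "int_iterate T 0 x = x"
  by (simp add: int_iterate_def)

lemma int_iterate_Suc: "int_iterate T (k + 1) x = T (int_iterate T k x)"
proof (cases "k \<ge> 0")
  case True
  then have "nat (k + 1) = Suc (nat k)" by simp
  then show ?thesis using True by (simp add: int_iterate_def)
next
  case False
  then obtain m where m: "nat (- k) = Suc m" by (metis Suc_pred' neg_0_less_iff_less not_le zero_less_nat_eq)
  then have k: "k = - int (Suc m)" by linarith
  have "int_iterate T k x = inv T ((inv T ^^ m) x)" using m False by (simp add: int_iterate_def)
  moreover have "int_iterate T (k + 1) x = (inv T ^^ m) x"
    using k by (cases "m = 0") (auto simp: int_iterate_def)
  ultimately show ?thesis by (simp add: T_inv)
qed

lemma int_iterate_pred: "int_iterate T (k - 1) x = inv T (int_iterate T k x)"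
  using int_iterate_Suc[of "k - 1" x] by (simp add: T_inv)

lemma int_iterate_add: "int_iterate T (j + k) x = int_iterate T j (int_iterate T k x)"
proof (induction j rule: int_induct[where k = 0])
  case (step1 i)
  have "i + 1 + k = (i + k) + 1" by simp
  then show ?case using step1 by (simp only: int_iterate_Suc)
next
  case (step2 i)
  have "i - 1 + k = (i + k) - 1" by simp
  then show ?case using step2 by (simp only: int_iterate_pred)
qed (simp add: int_iterate_0)

lemma int_iterate_continuous: "continuous_on UNIV (int_iterate T k)"
proof (induction k rule: int_induct[where k = 0])
  case base
  show ?case unfolding int_iterate_0[abs_def] by (rule continuous_on_id)
next
  case (step1 i)
  have "continuous_on UNIV (T \<circ> int_iterate T i)"
    by (rule continuous_on_compose[OF step1(2)], rule continuous_on_subset[OF homeomorphism_cont1[OF T]]) simp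
  then show ?case by (simp add: int_iterate_Suc o_def)
next
  case (step2 i)
  have "continuous_on UNIV (inv T \<circ> int_iterate T i)"
    by (rule continuous_on_compose[OF step2(2)], rule continuous_on_subset[OF homeomorphism_cont2[OF T]]) simp
  then show ?case by (simp add: int_iterate_pred o_def)
qed

lemma int_iterate_borel: "E \<in> sets borel \<Longrightarrow> int_iterate T k -` E \<in> sets borel"
  using measurable_sets[OF borel_measurable_continuous_onI[OF int_iterate_continuous]] by simp

lemma int_iterate_1: "int_iterate T 1 = T"
  using int_iterate_Suc[of 0] by (simp add: int_iterate_0 fun_eq_iff)

lemma int_orbit_range: "int_orbit T x = range (\<lambda>k. int_iterate T k x)"
  by (auto simp: int_orbit_def)

text \<open>Downwards, preservation by the inverse follows from that by \<open>T\<close>, applied to the image of \<open>E\<close>.\<close>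
lemma int_iterate_emeasure:
  assumes m: "sets \<mu> = sets borel" "measure_preserving \<mu> T" and E: "E \<in> sets borel"
  shows "emeasure \<mu> (int_iterate T k -` E) = emeasure \<mu> E"
  using E
proof (induction k arbitrary: E rule: int_induct[where k = 0])
  case base
  then show ?case by (simp add: int_iterate_0)
next
  case (step1 i)
  have sp: "space \<mu> = UNIV" using sets_eq_imp_space_eq[OF m(1)] by simp
  have TE: "T -` E \<in> sets borel" using int_iterate_borel[OF step1(3), of 1] by (simp add: int_iterate_1)
  have "int_iterate T (i + 1) -` E = int_iterate T i -` (T -` E)" by (auto simp: int_iterate_Suc)
  then have "emeasure \<mu> (int_iterate T (i + 1) -` E) = emeasure \<mu> (T -` E)" using step1(2)[OF TE] by simp
  also have "\<dots> = emeasure (distr \<mu> \<mu> T) E"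
    using m step1(3) by (subst emeasure_distr) (auto simp: measure_preserving_def sp)
  finally show ?case using m(2) by (simp add: measure_preserving_def)
next
  case (step2 i)
  have sp: "space \<mu> = UNIV" using sets_eq_imp_space_eq[OF m(1)] by simp
  have inv1: "int_iterate T (- 1) = inv T" using int_iterate_pred[of 0] by (simp add: int_iterate_0 fun_eq_iff)
  have TE: "inv T -` E \<in> sets borel" using int_iterate_borel[OF step2(3), of "- 1"] by (simp add: inv1)
  have "int_iterate T (i - 1) -` E = int_iterate T i -` (inv T -` E)" by (auto simp: int_iterate_pred)
  then have "emeasure \<mu> (int_iterate T (i - 1) -` E) = emeasure \<mu> (inv T -` E)" using step2(2)[OF TE] by simp
  also have "\<dots> = emeasure (distr \<mu> \<mu> T) (inv T -` E)" using m(2) by (simp add: measure_preserving_def)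
  also have "\<dots> = emeasure \<mu> (T -` (inv T -` E))"
    using m TE by (subst emeasure_distr) (auto simp: measure_preserving_def sp)
  also have "T -` (inv T -` E) = E" by (auto simp: T_inv)
  finally show ?case .
qed

end

lemma non_atomic_singleton:
  assumes "sets \<mu> = sets borel" "non_atomic \<mu>"
  shows "emeasure \<mu> {x::'a::t1_space} = 0"
proof (rule ccontr)
  assume "emeasure \<mu> {x} \<noteq> 0"
  then have "measure_atom \<mu> {x}"
    unfolding measure_atom_def using assms(1) by (auto simp: subset_singleton_iff zero_less_iff_neq_zero)
  then show False using assms(2) unfolding non_atomic_def by blast
qed

text \<open>A set of positive measure in the completion contains a Borel set \<open>?S\<close> of the same measure. The union
  of the preimages of \<open>?S\<close> is Borel and strictly invariant, so the ergodicity of \<open>T\<close> applies to it.\<close>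
lemma ergodic_Z_action_completion:
  fixes \<mu> :: "'a::polish_space measure" and T :: "'a \<Rightarrow> 'a"
  assumes "prob_space \<mu>" and m: "sets \<mu> = sets borel" and na: "non_atomic \<mu>"
    and T: "homeomorphism UNIV UNIV T (inv T)" and mp: "measure_preserving \<mu> T" and erg: "ergodic \<mu> T"
  shows "ergodic_Z_action (completion \<mu>) (int_iterate T)"
proof -
  interpret prob_space \<mu> by fact
  have sp: "space \<mu> = UNIV" using sets_eq_imp_space_eq[OF m] by simp
  let ?tt = "int_iterate T"
  note vim = int_iterate_borel[OF T, folded m] and em = int_iterate_emeasure[OF T m mp, folded m]
  have vim_null: "?tt k -` N \<in> null_sets \<mu>" if "N \<in> null_sets \<mu>" for k N
    using that vim[of N k] em[of N k] by (auto simp: null_sets_def)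
  have vim_c: "?tt k -` E \<in> sets (completion \<mu>) \<and> emeasure (completion \<mu>) (?tt k -` E) = emeasure (completion \<mu>) E"
    if E: "E \<in> sets (completion \<mu>)" for k E
  proof -
    obtain S N N' where S: "E = S \<union> N" "N \<subseteq> N'" "N' \<in> null_sets \<mu>" "S \<in> sets \<mu>"
      using E by (rule sets_completionE)
    have eq: "?tt k -` E = ?tt k -` S \<union> ?tt k -` N" using S(1) by blast
    have sub: "?tt k -` N \<subseteq> ?tt k -` N'" using S(2) by blast
    have 1: "?tt k -` E \<in> sets (completion \<mu>)"
      by (rule sets_completionI[OF eq sub vim_null[OF S(3)] vim[OF S(4)]])
    have ae: "AE x in completion \<mu>. x \<notin> N'" and ae': "AE x in completion \<mu>. x \<notin> ?tt k -` N'"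
      by (rule AE_completion[OF AE_not_in[OF S(3)]], rule AE_completion[OF AE_not_in[OF vim_null[OF S(3)]]])
    have "emeasure (completion \<mu>) E = emeasure (completion \<mu>) S"
      by (rule emeasure_eq_AE[OF _ E]) (use ae S in \<open>auto elim!: eventually_mono\<close>)
    moreover have "emeasure (completion \<mu>) (?tt k -` E) = emeasure (completion \<mu>) (?tt k -` S)"
      by (rule emeasure_eq_AE[OF _ 1]) (use ae' S vim[OF S(4)] in \<open>auto elim!: eventually_mono\<close>)
    ultimately show ?thesis using 1 em[OF S(4)] vim[OF S(4)] S(4) by simp
  qed
  have ps: "prob_space (completion \<mu>)"
    by (rule prob_spaceI) (simp add: emeasure_space_1)
  show ?thesis
  proof (intro ergodic_Z_action.intro ergodic_Z_action_axioms.intro)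
    show "prob_space (completion \<mu>)" by (rule ps)
    show "complete_measure (completion \<mu>)" by unfold_locales
    show "space (completion \<mu>) = UNIV" using sp by simp
    show "sets borel \<subseteq> sets (completion \<mu>)" using m by auto
    show "?tt 0 x = x" for x by (rule int_iterate_0[OF T])
    show "?tt (j + k) x = ?tt j (?tt k x)" for j k x by (rule int_iterate_add[OF T])
    show "continuous_on UNIV (?tt k)" for k by (rule int_iterate_continuous[OF T])
    show "?tt k -` E \<in> sets (completion \<mu>)" if "E \<in> sets (completion \<mu>)" for E k using vim_c[OF that] by blast
    show "emeasure (completion \<mu>) (?tt k -` E) = emeasure (completion \<mu>) E" if "E \<in> sets (completion \<mu>)" for E k
      using vim_c[OF that] by blast
    show "emeasure (completion \<mu>) {x} = 0" for x
      using non_atomic_singleton[OF m na, of x] m by simp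
    show "AE x in completion \<mu>. \<exists>k. ?tt k x \<in> E"
      if E: "E \<in> sets (completion \<mu>)" "emeasure (completion \<mu>) E > 0" for E
    proof -
      let ?S = "main_part \<mu> E"
      have "?S \<subseteq> ?S \<union> null_part \<mu> E" by blast
      then have "?S \<subseteq> E" by (simp only: main_part_null_part_Un[OF E(1)])
      with E have S: "?S \<in> sets \<mu>" "?S \<subseteq> E" "emeasure \<mu> ?S > 0" by simp_all
      let ?F = "\<Union>k. ?tt k -` ?S"
      have F: "?F \<in> sets \<mu>" using vim[OF S(1)] by blast
      have "T -` ?F = ?F"
      proof (intro equalityI subsetI)
        fix x assume "x \<in> T -` ?F"
        then obtain k where "?tt k (T x) \<in> ?S" by blast
        then have "?tt (k + 1) x \<in> ?S" by (simp add: int_iterate_add[OF T] int_iterate_1[OF T])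
        then show "x \<in> ?F" by blast
      next
        fix x assume "x \<in> ?F"
        then obtain k where k: "?tt k x \<in> ?S" by blast
        have "?tt (k - 1) (T x) = ?tt (k - 1 + 1) x"
          unfolding int_iterate_add[OF T] by (simp add: int_iterate_1[OF T])
        then have "?tt (k - 1) (T x) \<in> ?S" using k by simp
        then show "x \<in> T -` ?F" by blast
      qed
      then have "?F \<in> null_sets \<mu> \<or> space \<mu> - ?F \<in> null_sets \<mu>"
        using erg F sp unfolding ergodic_def by auto
      moreover have "?F \<notin> null_sets \<mu>"
      proof
        assume "?F \<in> null_sets \<mu>"
        moreover have "?S \<subseteq> ?F" using int_iterate_0[OF T] by (auto intro!: exI[of _ 0])
        ultimately have "emeasure \<mu> ?S = 0" using S(1) F by (meson null_setsD1 null_sets_subset)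
        then show False using S(3) by simp
      qed
      ultimately have "space \<mu> - ?F \<in> null_sets \<mu>" by blast
      then have "AE x in \<mu>. x \<notin> space \<mu> - ?F" by (rule AE_not_in)
      then have "AE x in \<mu>. \<exists>k. ?tt k x \<in> E"
        by eventually_elim (use S(2) sp in blast)
      then show ?thesis by (rule AE_completion)
    qed
  qed
qed

theorem theorem1:
  fixes \<mu> :: "'a::polish_space measure" and \<nu> :: "'b::polish_space measure"
    and T :: "'a \<Rightarrow> 'a" and S :: "'b \<Rightarrow> 'b"
  assumes "prob_space \<mu>" and "sets \<mu> = sets borel" and "non_atomic \<mu>"
    and "prob_space \<nu>" and "sets \<nu> = sets borel" and "non_atomic \<nu>"
    and "homeomorphism UNIV UNIV T (inv T)" and "measure_preserving \<mu> T" and "ergodic \<mu> T"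
    and "homeomorphism UNIV UNIV S (inv S)" and "measure_preserving \<nu> S" and "ergodic \<nu> S"
  shows "\<exists>X' Y' \<phi> \<psi>.
    gdelta_in euclidean X' \<and> T ` X' = X' \<and> emeasure \<mu> X' = 1 \<and>
    gdelta_in euclidean Y' \<and> S ` Y' = Y' \<and> emeasure \<nu> Y' = 1 \<and>
    homeomorphism X' Y' \<phi> \<psi> \<and>
    distr (restrict_space \<mu> X') (restrict_space \<nu> Y') \<phi> = restrict_space \<nu> Y' \<and>
    (\<forall>x\<in>X'. \<phi> ` int_orbit T x = int_orbit S (\<phi> x))"
proof -
  let ?M = "completion \<mu>" and ?N = "completion \<nu>" and ?t = "int_iterate T" and ?s = "int_iterate S"
  have "ergodic_Z_action ?M ?t" "ergodic_Z_action ?N ?s"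
    by (intro ergodic_Z_action_completion assms)+
  from coded_pair_exists[OF this] obtain N D c D' c' \<U> \<V>
    where "coded_pair ?M ?t ?N ?s N D c D' c' \<U> \<V>" by blast
  then interpret P: coded_pair ?M ?t ?N ?s N D c D' c' \<U> \<V> .
  interpret Q: coded_pair ?N ?s ?M ?t N D' c' D c \<V> \<U> by (rule P.swap)
  have Q_matched: "Q.matched y x \<longleftrightarrow> P.matched x y" for x y
    unfolding P.matched_def Q.matched_def by auto
  let ?X = P.partnered and ?Y = Q.partnered
  have sb: "sets borel = sets \<mu>" "sets borel = sets \<nu>" using assms(2,5) by simp_all
  have sp: "space \<mu> = UNIV" "space \<nu> = UNIV" using sets_eq_imp_space_eq[OF assms(2)] sets_eq_imp_space_eq[OF assms(5)] by simp_all
  have phi_Y: "P.\<phi> x \<in> ?Y" and psi_phi: "Q.\<phi> (P.\<phi> x) = x" if "x \<in> ?X" for x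
  proof -
    have "Q.matched (P.\<phi> x) x" unfolding Q_matched by (rule P.matched_phi[OF that])
    then show "P.\<phi> x \<in> ?Y" "Q.\<phi> (P.\<phi> x) = x" using Q.phi_eq unfolding Q.partnered_def by blast+
  qed
  have psi_X: "Q.\<phi> y \<in> ?X" and phi_psi: "P.\<phi> (Q.\<phi> y) = y" if "y \<in> ?Y" for y
  proof -
    have "P.matched (Q.\<phi> y) y" unfolding Q_matched[symmetric] by (rule Q.matched_phi[OF that])
    then show "Q.\<phi> y \<in> ?X" "P.\<phi> (Q.\<phi> y) = y" using P.phi_eq unfolding P.partnered_def by blast+
  qed
  obtain \<G> where G: "countable \<G>" "\<And>G. G \<in> \<G> \<Longrightarrow> open G" "?X = \<Inter>\<G>" by (rule P.partnered_gdelta) (rule that; assumption)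
  obtain \<H> where H: "countable \<H>" "\<And>G. G \<in> \<H> \<Longrightarrow> open G" "?Y = \<Inter>\<H>" by (rule Q.partnered_gdelta) (rule that; assumption)
  have gX: "gdelta_in euclidean ?X"
    unfolding gdelta_in_alt intersection_of_def using G by auto
  have gY: "gdelta_in euclidean ?Y"
    unfolding gdelta_in_alt intersection_of_def using H by auto
  have bX: "?X \<in> sets \<mu>" unfolding sb(1)[symmetric] by (rule P.partnered_borel)
  have bY: "?Y \<in> sets \<nu>" unfolding sb(2)[symmetric] by (rule Q.partnered_borel)
  have "emeasure ?M ?X = 1"
    using P.X.prob_eq_1[of ?X] P.partnered_full bX by (simp add: P.X.emeasure_eq_measure)
  then have mX: "emeasure \<mu> ?X = 1" using bX by simp
  have "emeasure ?N ?Y = 1"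
    using P.Y.prob_eq_1[of ?Y] Q.partnered_full bY by (simp add: P.Y.emeasure_eq_measure)
  then have mY: "emeasure \<nu> ?Y = 1" using bY by simp
  have T1: "?t 1 = T" and S1: "?s 1 = S" using int_iterate_1 assms(7,10) by blast+
  have TX: "T ` ?X = ?X"
  proof
    show "T ` ?X \<subseteq> ?X" using P.partnered_invariant[of _ 1] unfolding T1 by blast
    have "x \<in> T ` ?X" if "x \<in> ?X" for x
      using P.partnered_invariant[OF that, of "- 1"] P.X.tt_inverse(2)[of 1 x] unfolding T1 by (metis imageI)
    then show "?X \<subseteq> T ` ?X" by blast
  qed
  have SY: "S ` ?Y = ?Y"
  proof
    show "S ` ?Y \<subseteq> ?Y" using Q.partnered_invariant[of _ 1] unfolding S1 by blast
    have "x \<in> S ` ?Y" if "x \<in> ?Y" for x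
      using Q.partnered_invariant[OF that, of "- 1"] P.Y.tt_inverse(2)[of 1 x] unfolding S1 by (metis imageI)
    then show "?Y \<subseteq> S ` ?Y" by blast
  qed
  have homeo: "homeomorphism ?X ?Y P.\<phi> Q.\<phi>"
    unfolding homeomorphism_def
  proof (intro conjI ballI P.continuous_phi Q.continuous_phi)
    show "P.\<phi> ` ?X = ?Y" using phi_Y phi_psi psi_X by (metis image_eqI image_subsetI subsetI subset_antisym)
    show "Q.\<phi> ` ?Y = ?X" using psi_X psi_phi phi_Y by (metis image_eqI image_subsetI subsetI subset_antisym)
  qed (use psi_phi phi_psi in auto)
  have meas: "P.\<phi> \<in> measurable (restrict_space \<mu> ?X) (restrict_space \<nu> ?Y)"
  proof (rule measurable_restrict_space2)
    show "P.\<phi> \<in> space (restrict_space \<mu> ?X) \<rightarrow> ?Y" using phi_Y by (auto simp: space_restrict_space)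
    have "P.\<phi> \<in> borel_measurable (restrict_space borel ?X)"
      by (rule borel_measurable_continuous_on_restrict[OF P.continuous_phi])
    moreover have "sets (restrict_space borel ?X) = sets (restrict_space \<mu> ?X)"
      by (intro sets_restrict_space_cong sb)
    ultimately show "P.\<phi> \<in> measurable (restrict_space \<mu> ?X) \<nu>"
      using measurable_cong_sets sb(2) by blast
  qed
  have push: "distr (restrict_space \<mu> ?X) (restrict_space \<nu> ?Y) P.\<phi> = restrict_space \<nu> ?Y"
  proof (rule measure_eqI_generator_eq)
    let ?E = "(\<lambda>W. ?Y \<inter> W) ` {W. open W}"
    show "Int_stable ?E"
    proof (rule Int_stableI)
      fix a b assume "a \<in> ?E" "b \<in> ?E"
      then obtain V W where "open V" "open W" "a = ?Y \<inter> V" "b = ?Y \<inter> W" by blast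
      then show "a \<inter> b \<in> ?E" by (intro image_eqI[of _ _ "V \<inter> W"]) auto
    qed
    show "?E \<subseteq> Pow ?Y" by blast
    have "sets (restrict_space \<nu> ?Y) = (\<lambda>W. ?Y \<inter> W) ` sigma_sets UNIV {W. open W}"
      unfolding sets_restrict_space sb(2)[symmetric] by (simp add: borel_def)
    also have "\<dots> = sigma_sets ?Y ?E"
      by (rule sigma_sets_Int) (use bY sb(2) in \<open>simp_all add: borel_def\<close>)
    finally show "sets (restrict_space \<nu> ?Y) = sigma_sets ?Y ?E" .
    then show "sets (distr (restrict_space \<mu> ?X) (restrict_space \<nu> ?Y) P.\<phi>) = sigma_sets ?Y ?E" by simp
    show "range (\<lambda>i::nat. ?Y) \<subseteq> ?E" by (auto intro!: image_eqI[of _ _ UNIV])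
    show "(\<Union>i::nat. ?Y) = ?Y" by blast
    show "emeasure (distr (restrict_space \<mu> ?X) (restrict_space \<nu> ?Y) P.\<phi>) ?Y \<noteq> \<infinity>"
    proof -
      have "P.\<phi> -` ?Y \<inter> space (restrict_space \<mu> ?X) = ?X" using phi_Y by (auto simp: space_restrict_space sp)
      moreover have "?Y \<in> sets (restrict_space \<nu> ?Y)" using bY by (auto simp: sets_restrict_space_iff sp)
      ultimately show ?thesis using bX mX by (simp add: emeasure_distr[OF meas] emeasure_restrict_space sp)
    qed
    fix B assume "B \<in> ?E"
    then obtain W where W: "open W" "B = ?Y \<inter> W" by blast
    have bW: "W \<in> sets \<nu>" unfolding sb(2)[symmetric] by (rule borel_open[OF W(1)])
    have bB: "B \<in> sets (restrict_space \<nu> ?Y)" unfolding W(2) using bW bY by (auto simp: sets_restrict_space_iff sp)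
    have eq: "P.\<phi> -` B \<inter> space (restrict_space \<mu> ?X) = {x. x \<in> ?X \<and> P.\<phi> x \<in> W}"
      using phi_Y unfolding W(2) by (auto simp: space_restrict_space sp)
    have sB: "{x. x \<in> ?X \<and> P.\<phi> x \<in> W} \<in> sets (restrict_space \<mu> ?X)"
      using measurable_sets[OF meas bB] unfolding eq .
    then have sB': "{x. x \<in> ?X \<and> P.\<phi> x \<in> W} \<in> sets \<mu>"
      using bX by (simp add: sets_restrict_space_iff sp)
    have "emeasure (distr (restrict_space \<mu> ?X) (restrict_space \<nu> ?Y) P.\<phi>) B = emeasure \<mu> {x. x \<in> ?X \<and> P.\<phi> x \<in> W}"
      unfolding emeasure_distr[OF meas bB] eq
      by (rule emeasure_restrict_space) (use bX in \<open>auto simp: sp\<close>)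
    also have "\<dots> = emeasure ?M {x. x \<in> ?X \<and> P.\<phi> x \<in> W}" using sB' by simp
    also have "\<dots> = emeasure ?N W"
      unfolding P.X.emeasure_eq_measure P.Y.emeasure_eq_measure P.phi_open_measure[OF W(1)] ..
    also have "\<dots> = emeasure ?N B"
    proof (rule emeasure_eq_AE)
      show "AE x in ?N. (x \<in> W) = (x \<in> B)" using Q.partnered_full by eventually_elim (use W(2) in blast)
      show "W \<in> sets ?N" using bW by simp
      show "B \<in> sets ?N" unfolding W(2) using bW bY by auto
    qed
    also have "\<dots> = emeasure \<nu> B" unfolding W(2) using bW bY by simp
    also have "\<dots> = emeasure (restrict_space \<nu> ?Y) B"
      by (rule emeasure_restrict_space[symmetric]) (use bY W(2) in \<open>auto simp: sp\<close>)
    finally show "emeasure (distr (restrict_space \<mu> ?X) (restrict_space \<nu> ?Y) P.\<phi>) B = emeasure (restrict_space \<nu> ?Y) B" .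
  qed
  have orb: "P.\<phi> ` int_orbit T x = int_orbit S (P.\<phi> x)" if x: "x \<in> ?X" for x
    unfolding int_orbit_range[OF assms(7)] int_orbit_range[OF assms(10)]
  proof (intro equalityI subsetI)
    fix y assume "y \<in> P.\<phi> ` range (\<lambda>k. ?t k x)"
    then show "y \<in> range (\<lambda>l. ?s l (P.\<phi> x))" using P.orbit_subset[OF x] by blast
  next
    fix y assume "y \<in> range (\<lambda>l. ?s l (P.\<phi> x))"
    then obtain l where l: "y = ?s l (P.\<phi> x)" by blast
    have "y \<in> ?Y" unfolding l by (rule Q.partnered_invariant[OF phi_Y[OF x]])
    obtain k where "Q.\<phi> y = ?t k x" using Q.orbit_subset[OF phi_Y[OF x], of l] unfolding psi_phi[OF x] l by blast
    then have "y = P.\<phi> (?t k x)" using phi_psi[OF \<open>y \<in> ?Y\<close>] by simp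
    then show "y \<in> P.\<phi> ` range (\<lambda>k. ?t k x)" by blast
  qed
  show ?thesis
    by (rule exI[of _ ?X], rule exI[of _ ?Y], rule exI[of _ P.\<phi>], rule exI[of _ Q.\<phi>])
      (intro conjI ballI gX TX mX gY SY mY homeo push orb)
qed

end
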